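(* Let $m,n$ be positive integers and let $f_1,\ldots,f_m,g_1,\ldots,g_n$ be non-constant, non-negative operator monotone functions on $[0,\infty)$. Assume that the function \[ F(t)=\frac{\prod_{i=1}^m f_i(t)}{t^{m-1}\prod_{j=1}^n g_j(t)} \] is operator monotone on $[0,\infty)$. For non-negative real numbers $a_1,\ldots,a_m,b_1,\ldots,b_n$ define \[ h(t)=\prod_{i=1}^m\frac{t-a_i}{f_i(t)-f_i(a_i)}\prod_{j=1}^n\frac{g_j(t)(t-b_j)}{t g_j(t)-b_j g_j(b_j)}\qquad (t\ge 0). \] Then the following hold. (1) If all $f_i$ and $g_j$ ($1\le i\le m$, $1\le j\le n$) are continuous on $\overline{\mathbb{H}_+}$ and \[ f_i(t)-f_i(a_i)\ne 0,\qquad t g_j(t)-b_j g_j(b_j)\neq 0\qquad\text{for all } t\in(-\infty,0) \] and all $1\le i\le m$, $1\le j\le n$, then $h(t)$ is operator monotone on $[0,\infty)$. (2) If there exists a positive number $\alpha$ such that $\alpha\arg z\le\arg F(z)$ for all $z\in\mathbb{H}_+$, then $h(t)$ is operator monotone on $[0,\infty)$.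
   Context: A real continuous function $f$ on an interval $I$ is called operator monotone on $I$ if $A\le B$ implies $f(A)\le f(B)$ for all self-adjoint matrices $A,B$ (of any common size) with spectra contained in $I$. Let $\mathbb{H}_+=\{z\in\mathbb{C}: \operatorname{Im} z>0\}$, with closure $\overline{\mathbb{H}_+}$ in $\mathbb{C}$; for $z\in\mathbb{H}_+$ the argument is chosen with $0<\arg z<\pi$. By Loewner's theorem, an operator monotone function $f$ on $[0,\infty)$ has an analytic continuation to $\mathbb{H}_+$, again denoted $f(z)$, which maps $\mathbb{H}_+$ into itself unless $f$ is constant (a positive constant has argument $0$). Saying that $f$ is continuous on $\overline{\mathbb{H}_+}$ means that this analytic continuation extends continuously to $\overline{\mathbb{H}_+}$; for $t\in(-\infty,0)$, $f(t)$ denotes the value of this extension (the boundary value from $\mathbb{H}_+$). Functions given by a formula that is formally undefined at isolated points of $[0,\infty)$ ($F$ at $0$; $h$ at $a_i$, $b_j$, $0$) are understood there by continuous extension; in particular the hypothesis on $F$ means that $F$ extends continuously to $[0,\infty)$ and the extension is operator monotone. *)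

theory Defs
  imports "HOL-Complex_Analysis.Complex_Analysis" "Jordan_Normal_Form.Spectral_Radius"
begin

text \<open>Matrices are the complex matrices of \<open>Jordan_Normal_Form\<close>, whose size is an ordinary
  natural number, so that operator monotonicity can quantify over all sizes.\<close>

definition hermitian :: "complex mat \<Rightarrow> bool" where
  "hermitian A \<longleftrightarrow> square_mat A \<and> mat_adjoint A = A"

definition unitary :: "complex mat \<Rightarrow> bool" where
  "unitary U \<longleftrightarrow> square_mat U \<and> U * mat_adjoint U = 1\<^sub>m (dim_row U)"

definition pos_semidef :: "complex mat \<Rightarrow> bool" where
  "pos_semidef A \<longleftrightarrow>
     hermitian A \<and> (\<forall>v \<in> carrier_vec (dim_row A). Re ((A *\<^sub>v v) \<bullet>c v) \<ge> 0)"

definition loewner_le :: "complex mat \<Rightarrow> complex mat \<Rightarrow> bool" where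
  "loewner_le A B \<longleftrightarrow> pos_semidef (B - A)"

text \<open>Functional calculus: \<open>f(A) = U diag(f(d\<^sub>0), \<dots>, f(d\<^sub>n\<^sub>-\<^sub>1)) U\<^sup>*\<close> for any unitary
  diagonalisation \<open>A = U diag(d\<^sub>0, \<dots>, d\<^sub>n\<^sub>-\<^sub>1) U\<^sup>*\<close>. For hermitian \<open>A\<close> a diagonalisation
  exists and the result does not depend on it.\<close>

definition herm_apply :: "(real \<Rightarrow> real) \<Rightarrow> complex mat \<Rightarrow> complex mat" where
  "herm_apply f A = (THE B. \<exists>U d. U \<in> carrier_mat (dim_row A) (dim_row A) \<and> unitary U \<and>
     A = U * mat_diag (dim_row A) (\<lambda>i. complex_of_real (d i)) * mat_adjoint U \<and>
     B = U * mat_diag (dim_row A) (\<lambda>i. complex_of_real (f (d i))) * mat_adjoint U)"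

definition operator_monotone_on :: "real set \<Rightarrow> (real \<Rightarrow> real) \<Rightarrow> bool" where
  "operator_monotone_on I f \<longleftrightarrow> continuous_on I f \<and>
     (\<forall>n. \<forall>A \<in> carrier_mat n n. \<forall>B \<in> carrier_mat n n.
        hermitian A \<longrightarrow> hermitian B \<longrightarrow>
        spectrum A \<subseteq> complex_of_real ` I \<longrightarrow> spectrum B \<subseteq> complex_of_real ` I \<longrightarrow>
        loewner_le A B \<longrightarrow> loewner_le (herm_apply f A) (herm_apply f B))"

definition upper_half_plane :: "complex set" where
  "upper_half_plane = {z. Im z > 0}"

text \<open>The value at \<open>z\<close> in the upper half-plane of the analytic continuation of \<open>f\<close> from
  \<open>(0,\<infinity>)\<close>. The continuation is unique by the identity theorem (its domain is convex); for
  operator monotone \<open>f\<close> it exists by Loewner's theorem.\<close>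

definition upper_continuation :: "(real \<Rightarrow> real) \<Rightarrow> complex \<Rightarrow> complex" where
  "upper_continuation f z = (THE w. \<exists>\<phi>.
     \<phi> analytic_on (upper_half_plane \<union> complex_of_real ` {0<..}) \<and>
     (\<forall>t>0. \<phi> (complex_of_real t) = complex_of_real (f t)) \<and> w = \<phi> z)"

definition continuous_on_closed_half_plane :: "(real \<Rightarrow> real) \<Rightarrow> bool" where
  "continuous_on_closed_half_plane f \<longleftrightarrow>
     (\<exists>\<phi>. continuous_on (closure upper_half_plane) \<phi> \<and>
          (\<forall>z \<in> upper_half_plane. \<phi> z = upper_continuation f z))"

definition boundary_value :: "(real \<Rightarrow> real) \<Rightarrow> real \<Rightarrow> complex" where
  "boundary_value f t =
     Lim (at (complex_of_real t) within upper_half_plane) (upper_continuation f)"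

text \<open>A formula \<open>f\<close> that may be undefined at the points of \<open>E\<close> extends continuously to \<open>I\<close>, and
  the extension is operator monotone. (Continuity is part of \<^const>\<open>operator_monotone_on\<close>; when
  \<open>I - E\<close> is dense in \<open>I\<close>, the extension is unique on \<open>I\<close>.)\<close>

definition extends_operator_monotone ::
  "real set \<Rightarrow> real set \<Rightarrow> (real \<Rightarrow> real) \<Rightarrow> bool" where
  "extends_operator_monotone I E f \<longleftrightarrow>
     (\<exists>f'. operator_monotone_on I f' \<and> (\<forall>t \<in> I - E. f' t = f t))"

end

theory Submission
  imports Defs
begin

text \<open>
  Both directions of Loewner's theorem pass through a dual cone: \<open>f\<close> belongs to it if
  \<open>\<Sum> c\<^sub>t f(t) \<ge> 0\<close> for all finitely supported \<open>c\<close> on \<open>(0,\<infinity>)\<close> with \<open>\<Sum> c\<^sub>t t/(t + \<lambda>) \<ge> 0\<close> for all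
  \<open>\<lambda> \<ge> 0\<close>. Rank-one perturbations with prescribed interlacing eigenvalues, together with a
  sum-of-squares decomposition of polynomials that are nonnegative on the half-line, show that
  nonnegative operator monotone functions lie in it. Its members are finite-point limits of sums
  \<open>\<Sum> w\<^sub>k t/(t + \<lambda>\<^sub>k)\<close>, which are operator monotone (resolvents are antitone) and form a normal family
  on \<open>\<complex> - (-\<infinity>,0]\<close>, so that Montel's theorem yields the analytic continuation. Conversely, a contour
  integral puts every \<open>exp H\<close> with \<open>0 \<le> Im H \<le> arg\<close> on the upper half-plane into the dual cone.

  For \<open>h\<close> take for \<open>H\<close> the sum of the logarithms of its factors. If \<open>arg z = \<theta>\<close>, elementary estimates
  bound the argument of the \<open>i\<close>-th factor of the first product by \<open>\<pi> - arg f\<^sub>i(z)\<close> and of the \<open>j\<close>-th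
  factor of the second by \<open>(\<pi> - \<theta>) + arg g\<^sub>j(z)\<close>, and both from below by \<open>\<theta> - \<pi>\<close>. Since
  \<open>arg F(z) = \<Sum> arg f\<^sub>i(z) - (m - 1) \<theta> - \<Sum> arg g\<^sub>j(z) \<ge> 0\<close>, this gives
  \<open>-(m + n)(\<pi> - \<theta>) \<le> Im H \<le> \<pi> + (m + n - 1)(\<pi> - \<theta>)\<close> on the ray \<open>arg z = \<theta>\<close>. The maximum principle
  in the sector \<open>0 < arg z < \<theta>\<close> and \<open>\<theta> \<rightarrow> \<pi>\<close> give \<open>0 \<le> Im H \<le> arg z\<close>.
\<close>

text \<open>The functions t/(t + l) are the atoms of Loewner's integral representation. Inequalities
  at finitely many points replace the representing measure, so that the matrix side needs only one
  family of rank-one perturbations and the analytic side only one contour integral. The obstacle for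
  h is that adding up the estimates of the factors does not give 0 <= Im H <= arg z pointwise: both
  bounds are missed by (m + n)(pi - arg z). This defect vanishes towards the negative axis, where H
  may have no boundary values, and so it is read off on rays arg z = theta instead. As Im H is 0 on
  the positive axis, the harmonic function Im H lies below the multiple of arg z that matches the
  ray bound; this multiple tends to 1 as theta tends to pi, and to 0 when the same is done for -H.
  The bound Im H <= arg does more than keep exp H in the closed half-plane: on a sector of opening p
  pi with p < 1 it keeps exp H away from the negative axis, so that h/(1 + eps h) is bounded there
  and the contour integral converges.\<close>

unbundle no vec_syntax
unbundle no fps_syntax

section \<open>Functional calculus\<close>

lemma mat_adjoint_dim [simp]:
  "dim_row (mat_adjoint A) = dim_col A" "dim_col (mat_adjoint A) = dim_row A"
  by (auto simp: mat_adjoint_def)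

lemma mat_adjoint_carrier [simp]: "A \<in> carrier_mat n m \<Longrightarrow> mat_adjoint A \<in> carrier_mat m n"
  by auto

lemma mat_adjoint_index [simp]:
  "i < dim_col A \<Longrightarrow> j < dim_row A \<Longrightarrow> mat_adjoint A $$ (i, j) = conjugate (A $$ (j, i))"
  by (auto simp: mat_adjoint_def mat_of_rows_index)

lemma mat_adjoint_adjoint [simp]: "mat_adjoint (mat_adjoint A) = A"
  by (rule eq_matI) auto

lemma mat_adjoint_mult:
  fixes A :: "complex mat"
  assumes "A \<in> carrier_mat n m" "B \<in> carrier_mat m k"
  shows "mat_adjoint (A * B) = mat_adjoint B * mat_adjoint A"
  using assms by (intro eq_matI) (auto simp: scalar_prod_def mult.commute)

lemma index_mult_mat_sum:
  assumes "A \<in> carrier_mat n m" "B \<in> carrier_mat m k" "i < n" "j < k"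
  shows "(A * B) $$ (i, j) = (\<Sum>l<m. A $$ (i, l) * B $$ (l, j))"
  using assms by (auto simp: scalar_prod_def atLeast0LessThan)

lemma unitaryD:
  assumes "U \<in> carrier_mat n n" "unitary U"
  shows "U * mat_adjoint U = 1\<^sub>m n" "mat_adjoint U * U = 1\<^sub>m n"
proof -
  show 1: "U * mat_adjoint U = 1\<^sub>m n"
    using assms unfolding unitary_def by auto
  show "mat_adjoint U * U = 1\<^sub>m n"
    using mat_mult_left_right_inverse[OF assms(1) _ 1] assms by auto
qed

lemma unitaryI:
  assumes "U \<in> carrier_mat n n" "mat_adjoint U * U = 1\<^sub>m n"
  shows "unitary U"
  using mat_mult_left_right_inverse[OF _ assms(1) assms(2)] assms
  by (auto simp: unitary_def)

lemma mat_diag_adjoint: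
  "mat_adjoint (mat_diag n (\<lambda>i. complex_of_real (d i))) = mat_diag n (\<lambda>i. complex_of_real (d i))"
  by (rule eq_matI) (auto simp: mat_diag_def)

definition diagonalised :: "nat \<Rightarrow> complex mat \<Rightarrow> (nat \<Rightarrow> real) \<Rightarrow> complex mat" where
  "diagonalised n U d = U * mat_diag n (\<lambda>i. complex_of_real (d i)) * mat_adjoint U"

lemma diagonalised_carrier [simp]:
  "U \<in> carrier_mat n n \<Longrightarrow> diagonalised n U d \<in> carrier_mat n n"
  by (auto simp: diagonalised_def)

lemma diagonalised_dim:
  "dim_row (diagonalised n U d) = dim_row U" "dim_col (diagonalised n U d) = dim_row U"
  by (auto simp: diagonalised_def)

lemma diagonalised_index:
  assumes "U \<in> carrier_mat n n" "i < n" "j < n"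
  shows "diagonalised n U d $$ (i, j) = (\<Sum>k<n. U $$ (i, k) * complex_of_real (d k) * cnj (U $$ (j, k)))"
proof -
  have "U * mat_diag n (\<lambda>i. complex_of_real (d i)) = mat n n (\<lambda>(i, j). U $$ (i, j) * complex_of_real (d j))"
    using assms(1) by (rule mat_diag_mult_right)
  then show ?thesis
    using assms by (simp add: diagonalised_def scalar_prod_def atLeast0LessThan)
qed

lemma hermitian_diagonalised:
  assumes "U \<in> carrier_mat n n"
  shows "hermitian (diagonalised n U d)"
proof -
  have dim: "dim_row (diagonalised n U d) = n" "dim_col (diagonalised n U d) = n"
    using diagonalised_carrier[OF assms, of d] by auto
  have "mat_adjoint (diagonalised n U d) = diagonalised n U d"
    using assms by (intro eq_matI) (auto simp: dim diagonalised_index mult.commute mult.left_commute intro!: sum.cong)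
  then show ?thesis
    using dim unfolding hermitian_def by auto
qed

lemma diagonalised_mult_unitary:
  assumes "U \<in> carrier_mat n n" "unitary U"
  shows "diagonalised n U d * U = U * mat_diag n (\<lambda>i. complex_of_real (d i))"
proof -
  let ?D = "mat_diag n (\<lambda>i. complex_of_real (d i))"
  have "diagonalised n U d * U = U * ?D * (mat_adjoint U * U)"
    unfolding diagonalised_def by (rule assoc_mult_mat[of _ n n _ n _ n]) (use assms in auto)
  also have "\<dots> = U * ?D"
    using assms by (simp add: unitaryD[OF assms] right_mult_one_mat[of _ n n])
  finally show ?thesis .
qed

lemma adjoint_mult_diagonalised:
  assumes "U \<in> carrier_mat n n" "unitary U"
  shows "mat_adjoint U * diagonalised n U d = mat_diag n (\<lambda>i. complex_of_real (d i)) * mat_adjoint U"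
proof -
  have "mat_adjoint (diagonalised n U d * U) = mat_adjoint (U * mat_diag n (\<lambda>i. complex_of_real (d i)))"
    using diagonalised_mult_unitary[OF assms, of d] by simp
  then show ?thesis
    using assms hermitian_diagonalised[OF assms(1), of d]
    by (simp add: mat_adjoint_mult[of _ n n _ n] mat_diag_adjoint hermitian_def)
qed

text \<open>The unitary \<open>W\<close> = V* U intertwines the two diagonal matrices, which means
  \<open>W $$ (i, j) * d j = e i * W $$ (i, j)\<close> entrywise. Where an entry is nonzero,
  \<open>d j = e i\<close>, so \<open>f\<close> may be applied on both sides. This is what makes the
  description in \<open>herm_apply\<close> definite.\<close>

lemma diagonalised_unique:
  assumes U: "U \<in> carrier_mat n n" "unitary U" and V: "V \<in> carrier_mat n n" "unitary V"
    and eq: "diagonalised n U d = diagonalised n V e"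
  shows "diagonalised n U (\<lambda>i. f (d i)) = diagonalised n V (\<lambda>i. f (e i))"
proof -
  let ?D = "\<lambda>d. mat_diag n (\<lambda>i. complex_of_real (d i))"
  define W where "W = mat_adjoint V * U"
  have W: "W \<in> carrier_mat n n" using U V by (auto simp: W_def)
  have VW: "V * W = U"
    unfolding W_def using U V
    by (subst assoc_mult_mat[symmetric, of _ n n _ n _ n]) (auto simp: unitaryD)
  note Vd = adjoint_mult_diagonalised[OF V]
  have "W * ?D d = mat_adjoint V * (U * ?D d)"
    unfolding W_def using U V by (intro assoc_mult_mat[of _ n n _ n _ n]) auto
  also have "\<dots> = mat_adjoint V * (diagonalised n V e * U)"
    using diagonalised_mult_unitary[OF U, of d] eq by simp
  also have "\<dots> = mat_adjoint V * diagonalised n V e * U"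
    using U V by (intro assoc_mult_mat[of _ n n _ n _ n, symmetric]) auto
  also have "\<dots> = ?D e * W"
    unfolding W_def Vd using U V by (intro assoc_mult_mat[of _ n n _ n _ n]) auto
  finally have comm: "W * ?D d = ?D e * W" .
  have ent: "W $$ (i, j) * f (d j) = f (e i) * W $$ (i, j)" if "i < n" "j < n" for i j
  proof -
    have "(W * ?D d) $$ (i, j) = (?D e * W) $$ (i, j)" using comm by simp
    then have "W $$ (i, j) * d j = e i * W $$ (i, j)"
      using that W by (simp add: mat_diag_mult_right[OF W] mat_diag_mult_left[OF W])
    then show ?thesis by (cases "W $$ (i, j) = 0") auto
  qed
  have commf: "W * ?D (\<lambda>i. f (d i)) = ?D (\<lambda>i. f (e i)) * W"
    using W ent by (intro eq_matI) (auto simp: mat_diag_mult_right[OF W] mat_diag_mult_left[OF W])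
  have "diagonalised n U (\<lambda>i. f (d i)) = V * W * ?D (\<lambda>i. f (d i)) * mat_adjoint U"
    by (simp add: diagonalised_def VW)
  also have "V * W * ?D (\<lambda>i. f (d i)) = V * (W * ?D (\<lambda>i. f (d i)))"
    using V W by (intro assoc_mult_mat[of _ n n _ n _ n]) auto
  also have "\<dots> = V * ?D (\<lambda>i. f (e i)) * W"
    unfolding commf using V W by (intro assoc_mult_mat[of _ n n _ n _ n, symmetric]) auto
  also have "\<dots> * mat_adjoint U = V * ?D (\<lambda>i. f (e i)) * (W * mat_adjoint U)"
    using V W U by (intro assoc_mult_mat[of _ n n _ n _ n]) auto
  also have "W * mat_adjoint U = mat_adjoint V"
    unfolding W_def using U V
    by (subst assoc_mult_mat[of _ n n _ n _ n]) (auto simp: unitaryD)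
  finally show ?thesis by (simp add: diagonalised_def)
qed

lemma herm_apply_diagonalised:
  assumes "U \<in> carrier_mat n n" "unitary U"
  shows "herm_apply f (diagonalised n U d) = diagonalised n U (\<lambda>i. f (d i))"
proof -
  have dim: "dim_row (diagonalised n U d) = n"
    using diagonalised_carrier[OF assms(1)] by auto
  show ?thesis
    unfolding herm_apply_def dim
  proof (rule the_equality)
    show "\<exists>V e. V \<in> carrier_mat n n \<and> unitary V \<and>
       diagonalised n U d = V * mat_diag n (\<lambda>i. complex_of_real (e i)) * mat_adjoint V \<and>
       diagonalised n U (\<lambda>i. f (d i)) = V * mat_diag n (\<lambda>i. complex_of_real (f (e i))) * mat_adjoint V"
      by (rule exI[of _ U], rule exI[of _ d]) (use assms in \<open>simp add: diagonalised_def\<close>)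
  next
    fix B
    assume "\<exists>V e. V \<in> carrier_mat n n \<and> unitary V \<and>
       diagonalised n U d = V * mat_diag n (\<lambda>i. complex_of_real (e i)) * mat_adjoint V \<and>
       B = V * mat_diag n (\<lambda>i. complex_of_real (f (e i))) * mat_adjoint V"
    then obtain V e where V: "V \<in> carrier_mat n n" "unitary V"
      and "diagonalised n U d = V * mat_diag n (\<lambda>i. complex_of_real (e i)) * mat_adjoint V"
      and B: "B = V * mat_diag n (\<lambda>i. complex_of_real (f (e i))) * mat_adjoint V"
      by auto
    then have "diagonalised n U d = diagonalised n V e" by (simp add: diagonalised_def)
    from diagonalised_unique[OF V assms this[symmetric], of f] B
    show "B = diagonalised n U (\<lambda>i. f (d i))" by (simp add: diagonalised_def)
  qed
qed

text \<open>The coordinate of \<open>v\<close> along the \<open>k\<close>-th column of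
  \<open>U\<close>, that is, entry \<open>k\<close> of U* v.\<close>

definition eigencoef :: "nat \<Rightarrow> complex mat \<Rightarrow> complex vec \<Rightarrow> nat \<Rightarrow> complex" where
  "eigencoef n U v k = (\<Sum>i<n. cnj (U $$ (i, k)) * v $ i)"

lemma cscalar_prod_sum:
  fixes v w :: "complex vec"
  assumes "v \<in> carrier_vec n" "w \<in> carrier_vec n"
  shows "v \<bullet>c w = (\<Sum>i<n. v $ i * cnj (w $ i))"
  using assms by (auto simp: scalar_prod_def atLeast0LessThan)

lemma mult_mat_vec_index_sum:
  assumes "A \<in> carrier_mat n m" "v \<in> carrier_vec m" "i < n"
  shows "(A *\<^sub>v v) $ i = (\<Sum>j<m. A $$ (i, j) * v $ j)"
  using assms by (auto simp: scalar_prod_def atLeast0LessThan)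

lemma diagonalised_quadratic:
  assumes U: "U \<in> carrier_mat n n" and v: "v \<in> carrier_vec n"
  shows "(diagonalised n U d *\<^sub>v v) \<bullet>c v = complex_of_real (\<Sum>k<n. d k * (cmod (eigencoef n U v k))\<^sup>2)"
proof -
  have "(diagonalised n U d *\<^sub>v v) \<bullet>c v
      = (\<Sum>i<n. (\<Sum>j<n. (\<Sum>k<n. U $$ (i, k) * d k * cnj (U $$ (j, k))) * v $ j) * cnj (v $ i))"
    using assms by (simp add: cscalar_prod_sum[of _ n] mult_mat_vec_index_sum[of _ n n] diagonalised_index
        mult_mat_vec_carrier[OF diagonalised_carrier[OF U] v])
  also have "\<dots> = (\<Sum>i<n. \<Sum>j<n. \<Sum>k<n. d k * ((cnj (U $$ (j, k)) * v $ j) * cnj (cnj (U $$ (i, k)) * v $ i)))"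
    by (simp add: sum_distrib_right sum_distrib_left mult_ac)
  also have "\<dots> = (\<Sum>i<n. \<Sum>k<n. \<Sum>j<n. d k * ((cnj (U $$ (j, k)) * v $ j) * cnj (cnj (U $$ (i, k)) * v $ i)))"
    by (intro sum.cong refl sum.swap)
  also have "\<dots> = (\<Sum>k<n. \<Sum>i<n. \<Sum>j<n. d k * ((cnj (U $$ (j, k)) * v $ j) * cnj (cnj (U $$ (i, k)) * v $ i)))"
    by (rule sum.swap)
  also have "\<dots> = (\<Sum>k<n. d k * (eigencoef n U v k * cnj (eigencoef n U v k)))"
    by (intro sum.cong refl) (simp add: eigencoef_def sum_product sum_distrib_left mult_ac)
  finally show ?thesis by (simp add: complex_norm_square[symmetric])
qed

section \<open>The spectral theorem for hermitian matrices\<close>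

lemma unitary_mult:
  assumes "U \<in> carrier_mat n n" "unitary U" "V \<in> carrier_mat n n" "unitary V"
  shows "unitary (U * V)"
proof (rule unitaryI[of _ n])
  have "mat_adjoint (U * V) * (U * V) = mat_adjoint V * mat_adjoint U * (U * V)"
    using assms by (simp add: mat_adjoint_mult[of _ n n _ n])
  also have "\<dots> = mat_adjoint V * (mat_adjoint U * (U * V))"
    using assms by (intro assoc_mult_mat[of _ n n _ n _ n]) auto
  also have "mat_adjoint U * (U * V) = mat_adjoint U * U * V"
    using assms by (intro assoc_mult_mat[of _ n n _ n _ n, symmetric]) auto
  also have "mat_adjoint V * \<dots> = 1\<^sub>m n"
    using assms by (simp add: unitaryD)
  finally show "mat_adjoint (U * V) * (U * V) = 1\<^sub>m n" .
qed (use assms in auto)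

lemma diagonalised_conj:
  assumes "U \<in> carrier_mat n n" "V \<in> carrier_mat n n"
  shows "diagonalised n (U * V) d = U * diagonalised n V d * mat_adjoint U"
proof -
  let ?D = "mat_diag n (\<lambda>i. complex_of_real (d i))"
  have D: "?D \<in> carrier_mat n n" by simp
  have UVD: "U * V * ?D \<in> carrier_mat n n" by (rule mult_carrier_mat[OF mult_carrier_mat[OF assms] D])
  have "diagonalised n (U * V) d = U * V * ?D * (mat_adjoint V * mat_adjoint U)"
    using assms by (simp add: diagonalised_def mat_adjoint_mult[of _ n n _ n])
  also have "\<dots> = U * V * ?D * mat_adjoint V * mat_adjoint U"
    using assms UVD by (intro assoc_mult_mat[of _ n n _ n _ n, symmetric]) auto
  also have "U * V * ?D = U * (V * ?D)"
    using assms by (intro assoc_mult_mat[of _ n n _ n _ n]) auto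
  also have "\<dots> * mat_adjoint V = U * diagonalised n V d"
    unfolding diagonalised_def using assms by (intro assoc_mult_mat[of _ n n _ n _ n]) auto
  finally show ?thesis .
qed

lemma unitary_completion:
  fixes v :: "complex vec"
  assumes v: "v \<in> carrier_vec n" "v \<noteq> 0\<^sub>v n" and n: "n > 0"
  obtains W c where "W \<in> carrier_mat n n" "unitary W" "c \<noteq> 0" "\<And>i. i < n \<Longrightarrow> W $$ (i, 0) = c * v $ i"
proof -
  interpret cof_vec_space n "TYPE(complex)" .
  define b where "b = basis_completion v"
  define ws where "ws = gram_schmidt n b"
  from basis_completion[OF v, folded b_def]
  have b: "distinct b" "\<not> lin_dep (set b)" "set b \<subseteq> carrier_vec n" "hd b = v" "length b = n" by auto
  then obtain vs where bv: "b = v # vs" using n by (cases b) auto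
  from gram_schmidt_result[OF b(3,1,2) refl, folded ws_def] b(5)
  have ws: "set ws \<subseteq> carrier_vec n" "corthogonal ws" "length ws = n" by auto
  have hd: "hd ws = v" unfolding ws_def using gram_schmidt_hd[OF v(1), of vs] bv by simp
  then have ws0: "ws ! 0 = v" using ws(3) n by (cases ws) auto
  have wsc: "ws ! j \<in> carrier_vec n" if "j < n" for j using ws that by auto
  \<comment> \<open>Gram-Schmidt delivers an orthogonal list without normalising it;
    \<open>s j\<close> is the squared length by which column \<open>j\<close> is rescaled. The first
    column therefore is \<open>v\<close> only up to a scalar.\<close>
  define s where "s j = (\<Sum>l<n. (cmod (ws ! j $ l))\<^sup>2)" for j
  have ip: "(\<Sum>l<n. ws ! i $ l * cnj (ws ! j $ l)) = (if i = j then complex_of_real (s i) else 0)"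
    if "i < n" "j < n" for i j
  proof (cases "i = j")
    case True then show ?thesis by (simp add: s_def complex_norm_square del: of_real_power)
  next
    case False then show ?thesis
      using corthogonalD[OF ws(2), of i j] that ws(3) cscalar_prod_sum[OF wsc wsc, of i j] by simp
  qed
  have spos: "s j > 0" if "j < n" for j
  proof -
    have "s j \<ge> 0" by (simp add: s_def sum_nonneg)
    moreover have "complex_of_real (s j) \<noteq> 0"
      using corthogonalD[OF ws(2), of j j] that ws(3) cscalar_prod_sum[OF wsc wsc, of j j] ip[of j j]
      by simp
    ultimately show ?thesis by auto
  qed
  define W where "W = mat n n (\<lambda>(i, j). complex_of_real (1 / sqrt (s j)) * ws ! j $ i)"
  have W: "W \<in> carrier_mat n n" by (auto simp: W_def)
  have "mat_adjoint W * W = 1\<^sub>m n"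
  proof (rule eq_matI)
    fix i j assume "i < dim_row (1\<^sub>m n :: complex mat)" "j < dim_col (1\<^sub>m n :: complex mat)"
    then have ij: "i < n" "j < n" by auto
    have "(mat_adjoint W * W) $$ (i, j)
        = complex_of_real (1 / sqrt (s i) * (1 / sqrt (s j))) * (\<Sum>l<n. ws ! j $ l * cnj (ws ! i $ l))"
      unfolding index_mult_mat_sum[OF mat_adjoint_carrier[OF W] W ij] sum_distrib_left
      by (rule sum.cong) (use ij W in \<open>auto simp: W_def\<close>)
    then show "(mat_adjoint W * W) $$ (i, j) = 1\<^sub>m n $$ (i, j)"
      using ij spos[of i] by (auto simp: ip real_sqrt_mult[symmetric] simp flip: of_real_mult)
  qed (use W in auto)
  then have "unitary W" by (rule unitaryI[OF W])
  then show ?thesis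
    using that[of W "complex_of_real (1 / sqrt (s 0))"] W spos[OF n] n ws0 by (auto simp: W_def)
qed

text \<open>Deflation: a unitary \<open>W\<close> whose first column is an eigenvector turns
  \<open>A\<close> into a hermitian \<open>B\<close> whose first column is a multiple of the first
  unit vector. By symmetry the first row is too, and the induction hypothesis applies to the
  remaining block.\<close>

theorem hermitian_diagonalisable:
  assumes "A \<in> carrier_mat n n" "hermitian A"
  shows "\<exists>U d. U \<in> carrier_mat n n \<and> unitary U \<and> A = diagonalised n U d"
  using assms
proof (induction n arbitrary: A)
  case 0
  have "unitary (1\<^sub>m 0 :: complex mat)" by (rule unitaryI[of _ 0]) (auto intro: eq_matI)
  moreover have "A = diagonalised 0 (1\<^sub>m 0) d" for d
    using 0 by (intro eq_matI) (auto simp: diagonalised_dim)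
  ultimately show ?case by (intro exI[of _ "1\<^sub>m 0"]) auto
next
  case (Suc n)
  note A = Suc.prems(1)
  have adjA: "mat_adjoint A = A" using Suc.prems(2) by (simp add: hermitian_def)
  obtain e v where v: "v \<in> carrier_vec (Suc n)" "v \<noteq> 0\<^sub>v (Suc n)" and ev: "A *\<^sub>v v = e \<cdot>\<^sub>v v"
  proof -
    obtain e where "eigenvalue A e"
      using spectrum_non_empty[OF A] by (auto simp: spectrum_def)
    then show ?thesis
      using A that by (auto simp: eigenvalue_def eigenvector_def)
  qed
  obtain W c where W: "W \<in> carrier_mat (Suc n) (Suc n)" "unitary W" and c: "c \<noteq> 0"
    and W0: "\<And>i. i < Suc n \<Longrightarrow> W $$ (i, 0) = c * v $ i"
    using unitary_completion[OF v] by auto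
  have W': "mat_adjoint W \<in> carrier_mat (Suc n) (Suc n)" using W by auto
  define B where "B = mat_adjoint W * (A * W)"
  have AW: "A * W \<in> carrier_mat (Suc n) (Suc n)" using A W by auto
  have B: "B \<in> carrier_mat (Suc n) (Suc n)" using W AW by (auto simp: B_def)
  have A_eq: "A = W * B * mat_adjoint W"
  proof -
    have "W * B = W * mat_adjoint W * (A * W)"
      unfolding B_def using W W' AW by (intro assoc_mult_mat[symmetric]) auto
    also have "\<dots> = A * W" using AW by (simp only: unitaryD[OF W] left_mult_one_mat)
    finally have "W * B * mat_adjoint W = A * (W * mat_adjoint W)"
      using W W' A by (simp add: assoc_mult_mat[of _ "Suc n" "Suc n" _ "Suc n" _ "Suc n"])
    then show ?thesis using W A by (simp add: unitaryD)
  qed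
  have adjB: "mat_adjoint B = B"
  proof -
    have "mat_adjoint B = mat_adjoint (A * W) * W"
      unfolding B_def using W W' AW by (simp add: mat_adjoint_mult[of _ "Suc n" "Suc n" _ "Suc n"])
    also have "\<dots> = mat_adjoint W * A * W"
      using W A by (simp add: mat_adjoint_mult[of _ "Suc n" "Suc n" _ "Suc n"] adjA)
    also have "\<dots> = B"
      unfolding B_def using W W' A by (intro assoc_mult_mat) auto
    finally show ?thesis .
  qed
  have Bsym: "B $$ (j, i) = cnj (B $$ (i, j))" if "i < Suc n" "j < Suc n" for i j
    using mat_adjoint_index[of j B i] that B by (simp add: adjB)
  have AW0: "(A * W) $$ (l, 0) = e * W $$ (l, 0)" if l: "l < Suc n" for l
  proof -
    have "(A * W) $$ (l, 0) = c * (\<Sum>k<Suc n. A $$ (l, k) * v $ k)"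
      unfolding index_mult_mat_sum[OF A W(1) l zero_less_Suc] sum_distrib_left
      by (rule sum.cong) (auto simp: W0)
    also have "(\<Sum>k<Suc n. A $$ (l, k) * v $ k) = e * v $ l"
      using mult_mat_vec_index_sum[OF A v(1) l] l v by (simp add: ev)
    finally show ?thesis using l by (simp add: W0)
  qed
  have B0: "B $$ (i, 0) = (if i = 0 then e else 0)" if i: "i < Suc n" for i
  proof -
    have "B $$ (i, 0) = e * (\<Sum>l<Suc n. mat_adjoint W $$ (i, l) * W $$ (l, 0))"
      unfolding B_def index_mult_mat_sum[OF W' AW i zero_less_Suc] sum_distrib_left
      by (rule sum.cong) (auto simp: AW0)
    also have "(\<Sum>l<Suc n. mat_adjoint W $$ (i, l) * W $$ (l, 0)) = (mat_adjoint W * W) $$ (i, 0)"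
      by (rule index_mult_mat_sum[OF W' W(1) i zero_less_Suc, symmetric])
    finally show ?thesis using i by (simp add: unitaryD[OF W])
  qed
  have B0': "B $$ (0, i) = (if i = 0 then e else 0)" if i: "i < Suc n" for i
    using Bsym[of i 0] Bsym[of 0 0] B0[OF i] B0[of 0] i by auto
  have e: "complex_of_real (Re e) = e"
    using Bsym[of 0 0] B0[of 0] by (simp add: complex_eq_iff)
  define C where "C = mat n n (\<lambda>(i, j). B $$ (Suc i, Suc j))"
  have C: "C \<in> carrier_mat n n" by (auto simp: C_def)
  have "hermitian C"
    unfolding hermitian_def
  proof
    show "mat_adjoint C = C"
      using C by (intro eq_matI) (auto simp: C_def Bsym[symmetric])
  qed (use C in auto)
  from Suc.IH[OF C this] obtain P d where P: "P \<in> carrier_mat n n" "unitary P"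
    and CP: "C = diagonalised n P d" by auto
  \<comment> \<open>The block matrix with corner 1 and block \<open>P\<close>; \<open>d'\<close>
    puts the eigenvalue \<open>e\<close>, real as a diagonal entry of a hermitian matrix, in front
    of \<open>d\<close>.\<close>
  define Q where "Q = mat (Suc n) (Suc n)
    (\<lambda>(i, j). if i = 0 \<or> j = 0 then (if i = j then 1 else 0) else P $$ (i - 1, j - 1))"
  define d' where "d' = case_nat (Re e) d"
  have Q: "Q \<in> carrier_mat (Suc n) (Suc n)" by (auto simp: Q_def)
  have Q0: "Q $$ (0, j) = (if j = 0 then 1 else 0)" "Q $$ (j, 0) = (if j = 0 then 1 else 0)" if "j < Suc n" for j
    using that by (auto simp: Q_def)
  have QS: "Q $$ (Suc i, Suc j) = P $$ (i, j)" if "i < n" "j < n" for i j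
    using that by (auto simp: Q_def)
  have "mat_adjoint Q * Q = 1\<^sub>m (Suc n)"
  proof (rule eq_matI)
    fix i j assume "i < dim_row (1\<^sub>m (Suc n) :: complex mat)" "j < dim_col (1\<^sub>m (Suc n) :: complex mat)"
    then have ij: "i < Suc n" "j < Suc n" by auto
    have "(mat_adjoint Q * Q) $$ (i, j) = (\<Sum>l<Suc n. cnj (Q $$ (l, i)) * Q $$ (l, j))"
      unfolding index_mult_mat_sum[OF mat_adjoint_carrier[OF Q] Q ij]
      by (rule sum.cong) (use ij Q in auto)
    also have "\<dots> = 1\<^sub>m (Suc n) $$ (i, j)"
    proof (cases i; cases j)
      fix i' j' assume ij': "i = Suc i'" "j = Suc j'"
      have "(\<Sum>l<n. cnj (P $$ (l, i')) * P $$ (l, j')) = (mat_adjoint P * P) $$ (i', j')"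
        unfolding index_mult_mat_sum[OF mat_adjoint_carrier[OF P(1)] P(1) , of i' j', OF ij[unfolded ij' Suc_less_eq]]
        by (rule sum.cong) (use ij ij' P in auto)
      then show ?thesis using ij ij' P
        by (simp add: sum.lessThan_Suc_shift Q0 QS unitaryD del: sum.lessThan_Suc)
    qed (use ij in \<open>auto simp: sum.lessThan_Suc_shift Q0 QS simp del: sum.lessThan_Suc\<close>)
    finally show "(mat_adjoint Q * Q) $$ (i, j) = 1\<^sub>m (Suc n) $$ (i, j)" .
  qed (use Q in auto)
  then have uQ: "unitary Q" by (rule unitaryI[OF Q])
  have BQ: "B = diagonalised (Suc n) Q d'"
  proof (rule eq_matI)
    fix i j assume "i < dim_row (diagonalised (Suc n) Q d')" "j < dim_col (diagonalised (Suc n) Q d')"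
    then have ij: "i < Suc n" "j < Suc n" using diagonalised_carrier[OF Q, of d'] by auto
    show "B $$ (i, j) = diagonalised (Suc n) Q d' $$ (i, j)"
    proof (cases i; cases j)
      fix i' j' assume ij': "i = Suc i'" "j = Suc j'"
      have "B $$ (i, j) = C $$ (i', j')" using ij ij' by (simp add: C_def)
      then show ?thesis using ij ij' Q P
        by (simp add: CP diagonalised_index sum.lessThan_Suc_shift Q0 QS d'_def del: sum.lessThan_Suc)
    qed (use ij Q in \<open>auto simp: diagonalised_index B0 B0' sum.lessThan_Suc_shift Q0 QS d'_def e simp del: sum.lessThan_Suc\<close>)
  qed (use B diagonalised_carrier[OF Q, of d'] in auto)
  have "A = diagonalised (Suc n) (W * Q) d'"
    unfolding diagonalised_conj[OF W(1) Q] BQ[symmetric] by (rule A_eq)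
  then show ?case using unitary_mult[OF W Q uQ] W Q by (intro exI[of _ "W * Q"] exI[of _ d']) auto
qed

lemma diagonalised_eigenvalue:
  assumes U: "U \<in> carrier_mat n n" "unitary U" and k: "k < n"
  shows "complex_of_real (d k) \<in> spectrum (diagonalised n U d)"
proof -
  let ?A = "diagonalised n U d"
  have A: "?A \<in> carrier_mat n n" using U by simp
  have "?A *\<^sub>v col U k = d k \<cdot>\<^sub>v col U k"
  proof (rule eq_vecI)
    fix i assume "i < dim_vec (complex_of_real (d k) \<cdot>\<^sub>v col U k)"
    then have i: "i < n" using U by auto
    have "(?A *\<^sub>v col U k) $ i = (?A * U) $$ (i, k)"
      using U i k by (simp add: diagonalised_dim)
    also have "\<dots> = U $$ (i, k) * d k"
      using i k U by (simp add: diagonalised_mult_unitary[OF U] mat_diag_mult_right[OF U(1)])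
    finally show "(?A *\<^sub>v col U k) $ i = (complex_of_real (d k) \<cdot>\<^sub>v col U k) $ i"
      using i k U by (simp add: mult.commute)
  qed (use A U in \<open>auto simp: diagonalised_dim\<close>)
  moreover have "col U k \<noteq> 0\<^sub>v n"
  proof
    assume z: "col U k = 0\<^sub>v n"
    have "(mat_adjoint U * U) $$ (k, k) = (\<Sum>l<n. mat_adjoint U $$ (k, l) * U $$ (l, k))"
      by (rule index_mult_mat_sum[of _ n n _ n]) (use U k in auto)
    also have "\<dots> = 0"
    proof (rule sum.neutral, safe)
      fix l assume "l < n"
      then have "U $$ (l, k) = col U k $ l" using U k by auto
      also have "\<dots> = 0" using z \<open>l < n\<close> by simp
      finally show "mat_adjoint U $$ (k, l) * U $$ (l, k) = 0" by simp
    qed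
    finally show False using k by (simp add: unitaryD[OF U])
  qed
  moreover have "col U k \<in> carrier_vec n" using U k by auto
  moreover have "dim_row ?A = n" using U by (simp add: diagonalised_dim)
  ultimately show ?thesis
    by (auto simp: spectrum_def eigenvalue_def eigenvector_def)
qed

lemma spectrum_diagonalised:
  assumes U: "U \<in> carrier_mat n n" "unitary U"
  shows "spectrum (diagonalised n U d) \<subseteq> (\<lambda>k. complex_of_real (d k)) ` {..<n}"
proof
  let ?A = "diagonalised n U d"
  let ?D = "mat_diag n (\<lambda>i. complex_of_real (d i))"
  have A: "?A \<in> carrier_mat n n" using U by simp
  fix x assume "x \<in> spectrum ?A"
  then obtain v where v: "v \<in> carrier_vec n" "v \<noteq> 0\<^sub>v n" and ev: "?A *\<^sub>v v = x \<cdot>\<^sub>v v"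
    using A unfolding spectrum_def eigenvalue_def eigenvector_def by auto
  define w where "w = mat_adjoint U *\<^sub>v v"
  have w: "w \<in> carrier_vec n" unfolding w_def by (rule mult_mat_vec_carrier[OF mat_adjoint_carrier[OF U(1)] v(1)])
  have "U *\<^sub>v w = v"
    unfolding w_def using U v
    by (subst assoc_mult_mat_vec[symmetric, of _ n n _ n]) (auto simp: unitaryD)
  moreover have "U *\<^sub>v 0\<^sub>v n = 0\<^sub>v n" using U by (intro eq_vecI) auto
  ultimately have "w \<noteq> 0\<^sub>v n" using v by auto
  then obtain k where k: "k < n" "w $ k \<noteq> 0" using w by (metis carrier_vecD eq_vecI index_zero_vec)
  have "mat_adjoint U *\<^sub>v (?A *\<^sub>v v) = (mat_adjoint U * ?A) *\<^sub>v v"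
    using U A v by (intro assoc_mult_mat_vec[symmetric]) auto
  also have "mat_adjoint U * ?A = ?D * mat_adjoint U"
    by (rule adjoint_mult_diagonalised[OF U])
  also have "\<dots> *\<^sub>v v = ?D *\<^sub>v w"
    unfolding w_def using U v by (intro assoc_mult_mat_vec[of _ n n _ n]) auto
  finally have "?D *\<^sub>v w = x \<cdot>\<^sub>v w"
    unfolding ev w_def using U v by (simp add: mult_mat_vec[of _ n n])
  then have "(?D *\<^sub>v w) $ k = (x \<cdot>\<^sub>v w) $ k" by simp
  moreover have "(?D *\<^sub>v w) $ k = d k * w $ k"
    unfolding mult_mat_vec_index_sum[OF mat_diag_dim w k(1)]
    using k by (simp add: mat_diag_def if_distrib[of "\<lambda>x. x * _"] cong: if_cong)
  ultimately have "x = d k" using k w by simp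
  then show "x \<in> (\<lambda>k. complex_of_real (d k)) ` {..<n}" using k by auto
qed


section \<open>The Loewner order in eigenvector coordinates\<close>

lemma eigencoef_parseval:
  assumes U: "U \<in> carrier_mat n n" "unitary U"
  shows "(\<Sum>k<n. eigencoef n U v k * cnj (eigencoef n U w k)) = (\<Sum>i<n. v $ i * cnj (w $ i))"
proof -
  have orth: "(\<Sum>k<n. U $$ (j, k) * cnj (U $$ (i, k))) = (if i = j then 1 else 0)" if "i < n" "j < n" for i j
  proof -
    have "(\<Sum>k<n. U $$ (j, k) * cnj (U $$ (i, k))) = (U * mat_adjoint U) $$ (j, i)"
      unfolding index_mult_mat_sum[OF U(1) mat_adjoint_carrier[OF U(1)] that(2,1)]
      by (rule sum.cong) (use U that in auto)
    then show ?thesis using that by (simp add: unitaryD[OF U])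
  qed
  have "(\<Sum>k<n. eigencoef n U v k * cnj (eigencoef n U w k))
      = (\<Sum>k<n. \<Sum>i<n. \<Sum>j<n. v $ i * cnj (w $ j) * (U $$ (j, k) * cnj (U $$ (i, k))))"
    by (simp add: eigencoef_def sum_product mult_ac)
  also have "\<dots> = (\<Sum>i<n. \<Sum>k<n. \<Sum>j<n. v $ i * cnj (w $ j) * (U $$ (j, k) * cnj (U $$ (i, k))))"
    by (rule sum.swap)
  also have "\<dots> = (\<Sum>i<n. \<Sum>j<n. v $ i * cnj (w $ j) * (\<Sum>k<n. U $$ (j, k) * cnj (U $$ (i, k))))"
    unfolding sum_distrib_left by (intro sum.cong refl sum.swap)
  also have "\<dots> = (\<Sum>i<n. \<Sum>j<n. if j = i then v $ i * cnj (w $ j) else 0)"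
    by (intro sum.cong refl) (auto simp: orth)
  finally show ?thesis by (simp add: sum.delta)
qed

lemma eigencoef_norm:
  assumes U: "U \<in> carrier_mat n n" "unitary U" and V: "V \<in> carrier_mat n n" "unitary V"
  shows "(\<Sum>k<n. (cmod (eigencoef n U v k))\<^sup>2) = (\<Sum>k<n. (cmod (eigencoef n V v k))\<^sup>2)"
proof -
  have "(\<Sum>k<n. eigencoef n U v k * cnj (eigencoef n U v k)) = (\<Sum>k<n. eigencoef n V v k * cnj (eigencoef n V v k))"
    unfolding eigencoef_parseval[OF U] eigencoef_parseval[OF V] ..
  then have "complex_of_real (\<Sum>k<n. (cmod (eigencoef n U v k))\<^sup>2) = complex_of_real (\<Sum>k<n. (cmod (eigencoef n V v k))\<^sup>2)"
    by (simp add: complex_norm_square del: of_real_power)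
  then show ?thesis by (simp only: of_real_eq_iff)
qed

text \<open>Translates the matrix order into inequalities between real weighted sums. Through the
  next two lemmas, which rest on it, all later arguments about matrix monotonicity take place in
  these coordinates.\<close>

lemma loewner_le_diagonalised_iff:
  assumes U: "U \<in> carrier_mat n n" and V: "V \<in> carrier_mat n n"
  shows "loewner_le (diagonalised n U d) (diagonalised n V e) \<longleftrightarrow>
    (\<forall>v \<in> carrier_vec n. (\<Sum>k<n. d k * (cmod (eigencoef n U v k))\<^sup>2) \<le> (\<Sum>k<n. e k * (cmod (eigencoef n V v k))\<^sup>2))"
proof -
  let ?A = "diagonalised n U d" and ?B = "diagonalised n V e"
  have A: "?A \<in> carrier_mat n n" and B: "?B \<in> carrier_mat n n" using U V by auto
  have "mat_adjoint (?B - ?A) = mat_adjoint ?B - mat_adjoint ?A"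
    using A B by (intro eq_matI) auto
  then have "hermitian (?B - ?A)"
    using hermitian_diagonalised[OF U, of d] hermitian_diagonalised[OF V, of e] A B
    by (auto simp: hermitian_def)
  moreover have "Re (((?B - ?A) *\<^sub>v v) \<bullet>c v)
      = (\<Sum>k<n. e k * (cmod (eigencoef n V v k))\<^sup>2) - (\<Sum>k<n. d k * (cmod (eigencoef n U v k))\<^sup>2)"
    if v: "v \<in> carrier_vec n" for v
  proof -
    have "((?B - ?A) *\<^sub>v v) \<bullet>c v = (?B *\<^sub>v v) \<bullet>c v - (?A *\<^sub>v v) \<bullet>c v"
      unfolding minus_mult_distrib_mat_vec[OF B A v]
      by (rule minus_scalar_prod_distrib[of _ n])
        (use v mult_mat_vec_carrier[OF A v] mult_mat_vec_carrier[OF B v] in auto)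
    then show ?thesis by (simp add: diagonalised_quadratic U V v del: of_real_sum)
  qed
  moreover have "dim_row (?B - ?A) = n" using U by (simp add: diagonalised_dim)
  ultimately show ?thesis by (auto simp: loewner_le_def pos_semidef_def)
qed

lemma operator_monotone_onD:
  assumes "operator_monotone_on I f"
    and U: "U \<in> carrier_mat n n" "unitary U" and V: "V \<in> carrier_mat n n" "unitary V"
    and I: "\<And>k. k < n \<Longrightarrow> d k \<in> I" "\<And>k. k < n \<Longrightarrow> e k \<in> I"
    and le: "loewner_le (diagonalised n U d) (diagonalised n V e)"
    and v: "v \<in> carrier_vec n"
  shows "(\<Sum>k<n. f (d k) * (cmod (eigencoef n U v k))\<^sup>2) \<le> (\<Sum>k<n. f (e k) * (cmod (eigencoef n V v k))\<^sup>2)"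
proof -
  have "spectrum (diagonalised n U d) \<subseteq> complex_of_real ` I" "spectrum (diagonalised n V e) \<subseteq> complex_of_real ` I"
    using spectrum_diagonalised[OF U, of d] spectrum_diagonalised[OF V, of e] I by auto
  then have "loewner_le (herm_apply f (diagonalised n U d)) (herm_apply f (diagonalised n V e))"
    using assms(1) le diagonalised_carrier[OF U(1)] diagonalised_carrier[OF V(1)]
      hermitian_diagonalised[OF U(1)] hermitian_diagonalised[OF V(1)]
    unfolding operator_monotone_on_def by blast
  then show ?thesis
    using U V v by (simp add: herm_apply_diagonalised loewner_le_diagonalised_iff)
qed

lemma operator_monotone_onI:
  assumes "continuous_on I f"
    and mono: "\<And>n U V d e v. \<lbrakk>U \<in> carrier_mat n n; unitary U; V \<in> carrier_mat n n; unitary V;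
      \<And>k. k < n \<Longrightarrow> d k \<in> I; \<And>k. k < n \<Longrightarrow> e k \<in> I;
      loewner_le (diagonalised n U d) (diagonalised n V e); v \<in> carrier_vec n\<rbrakk> \<Longrightarrow>
      (\<Sum>k<n. f (d k) * (cmod (eigencoef n U v k))\<^sup>2) \<le> (\<Sum>k<n. f (e k) * (cmod (eigencoef n V v k))\<^sup>2)"
  shows "operator_monotone_on I f"
  unfolding operator_monotone_on_def
proof (intro conjI assms(1) allI ballI impI)
  fix n A B
  assume A: "A \<in> carrier_mat n n" "hermitian A" "spectrum A \<subseteq> complex_of_real ` I"
    and B: "B \<in> carrier_mat n n" "hermitian B" "spectrum B \<subseteq> complex_of_real ` I"
    and le: "loewner_le A B"
  obtain U d where U: "U \<in> carrier_mat n n" "unitary U" and AU: "A = diagonalised n U d"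
    using hermitian_diagonalisable[OF A(1,2)] by auto
  obtain V e where V: "V \<in> carrier_mat n n" "unitary V" and BV: "B = diagonalised n V e"
    using hermitian_diagonalisable[OF B(1,2)] by auto
  have "d k \<in> I" "e k \<in> I" if "k < n" for k
    using diagonalised_eigenvalue[OF U that, of d] diagonalised_eigenvalue[OF V that, of e] A(3) B(3)
    by (auto simp: AU BV)
  then show "loewner_le (herm_apply f A) (herm_apply f B)"
    unfolding AU BV herm_apply_diagonalised[OF U] herm_apply_diagonalised[OF V]
      loewner_le_diagonalised_iff[OF U(1) V(1)]
    using mono U V le unfolding AU BV by blast
qed

text \<open>The quadratic form of the inverse of \<open>A + \<mu>\<close> at \<open>v\<close> is the supremum over \<open>y\<close> of
  \<open>2 Re \<langle>v, y\<rangle> - \<langle>y, (A + \<mu>) y\<rangle>\<close>; the proof inserts the maximiser belonging to the larger matrix.\<close>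

lemma resolvent_antitone:
  assumes U: "U \<in> carrier_mat n n" "unitary U" and V: "V \<in> carrier_mat n n" "unitary V"
    and le: "loewner_le (diagonalised n U d) (diagonalised n V e)"
    and pos: "\<And>k. k < n \<Longrightarrow> d k + \<mu> > 0" "\<And>k. k < n \<Longrightarrow> e k + \<mu> > 0"
    and v: "v \<in> carrier_vec n"
  shows "(\<Sum>k<n. (cmod (eigencoef n V v k))\<^sup>2 / (e k + \<mu>)) \<le> (\<Sum>k<n. (cmod (eigencoef n U v k))\<^sup>2 / (d k + \<mu>))"
    (is "?SB \<le> ?SA")
proof -
  define \<gamma> where "\<gamma> k = eigencoef n V v k" for k
  define \<alpha> where "\<alpha> k = eigencoef n U v k" for k
  define y where "y = vec n (\<lambda>i. \<Sum>k<n. V $$ (i, k) * (\<gamma> k / complex_of_real (e k + \<mu>)))"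
  define \<beta> where "\<beta> k = eigencoef n U y k" for k
  have y: "y \<in> carrier_vec n" by (simp add: y_def)
  have Vy: "eigencoef n V y k = \<gamma> k / complex_of_real (e k + \<mu>)" if k: "k < n" for k
  proof -
    have "eigencoef n V y k
        = (\<Sum>i<n. \<Sum>l<n. (cnj (V $$ (i, k)) * V $$ (i, l)) * (\<gamma> l / complex_of_real (e l + \<mu>)))"
      by (simp add: eigencoef_def y_def sum_distrib_left mult.assoc)
    also have "\<dots> = (\<Sum>l<n. (\<Sum>i<n. cnj (V $$ (i, k)) * V $$ (i, l)) * (\<gamma> l / complex_of_real (e l + \<mu>)))"
      unfolding sum_distrib_right by (rule sum.swap)
    also have "\<dots> = (\<Sum>l<n. if l = k then \<gamma> l / complex_of_real (e l + \<mu>) else 0)"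
    proof (rule sum.cong)
      fix l assume "l \<in> {..<n}"
      then have l: "l < n" by simp
      have "(\<Sum>i<n. cnj (V $$ (i, k)) * V $$ (i, l)) = (mat_adjoint V * V) $$ (k, l)"
        unfolding index_mult_mat_sum[OF mat_adjoint_carrier[OF V(1)] V(1) k l]
        by (rule sum.cong) (use V k in auto)
      then show "(\<Sum>i<n. cnj (V $$ (i, k)) * V $$ (i, l)) * (\<gamma> l / complex_of_real (e l + \<mu>))
          = (if l = k then \<gamma> l / complex_of_real (e l + \<mu>) else 0)"
        using k l by (simp add: unitaryD[OF V])
    qed simp
    finally show ?thesis using k by (simp add: sum.delta')
  qed
  have ip: "(\<Sum>k<n. Re (\<alpha> k * cnj (\<beta> k))) = ?SB"
  proof -
    have "(\<Sum>k<n. \<alpha> k * cnj (\<beta> k)) = (\<Sum>k<n. eigencoef n V v k * cnj (eigencoef n V y k))"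
      unfolding \<alpha>_def \<beta>_def eigencoef_parseval[OF U] eigencoef_parseval[OF V] ..
    also have "\<dots> = (\<Sum>k<n. complex_of_real ((cmod (eigencoef n V v k))\<^sup>2 / (e k + \<mu>)))"
      by (rule sum.cong) (auto simp: Vy \<gamma>_def complex_norm_square simp del: of_real_power of_real_add)
    finally have "Re (\<Sum>k<n. \<alpha> k * cnj (\<beta> k)) = Re (complex_of_real ?SB)" by simp
    then show ?thesis by simp
  qed
  note nrm = eigencoef_norm[OF U V, of y]
  have "(\<Sum>k<n. d k * (cmod (\<beta> k))\<^sup>2) \<le> (\<Sum>k<n. e k * (cmod (eigencoef n V y k))\<^sup>2)"
    using le y unfolding loewner_le_diagonalised_iff[OF U(1) V(1)] \<beta>_def by blast
  then have "(\<Sum>k<n. (d k + \<mu>) * (cmod (\<beta> k))\<^sup>2) \<le> (\<Sum>k<n. (e k + \<mu>) * (cmod (eigencoef n V y k))\<^sup>2)"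
    using nrm by (simp add: distrib_right sum.distrib \<beta>_def flip: sum_distrib_left)
  also have "\<dots> = ?SB"
  proof (rule sum.cong)
    fix k assume "k \<in> {..<n}"
    then have "k < n" by simp
    then have "eigencoef n V y k = eigencoef n V v k / complex_of_real (e k + \<mu>)" "e k + \<mu> > 0"
      using Vy pos by (auto simp: \<gamma>_def)
    then show "(e k + \<mu>) * (cmod (eigencoef n V y k))\<^sup>2 = (cmod (eigencoef n V v k))\<^sup>2 / (e k + \<mu>)"
      by (simp add: norm_divide power_divide power2_eq_square del: of_real_add)
  qed simp
  finally have quad: "(\<Sum>k<n. (d k + \<mu>) * (cmod (\<beta> k))\<^sup>2) \<le> ?SB" .
  have "2 * Re (\<alpha> k * cnj (\<beta> k)) - (d k + \<mu>) * (cmod (\<beta> k))\<^sup>2 \<le> (cmod (\<alpha> k))\<^sup>2 / (d k + \<mu>)" if k: "k < n" for k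
  proof -
    let ?s = "d k + \<mu>"
    have s: "?s > 0" using pos k by auto
    have "0 \<le> (cmod (\<alpha> k - of_real ?s * \<beta> k))\<^sup>2" by simp
    also have "\<dots> = (cmod (\<alpha> k))\<^sup>2 - ?s * (2 * Re (\<alpha> k * cnj (\<beta> k))) + ?s\<^sup>2 * (cmod (\<beta> k))\<^sup>2"
      unfolding cmod_power2 by (simp add: power2_eq_square algebra_simps del: of_real_add)
    finally show ?thesis using s by (simp add: field_simps power2_eq_square)
  qed
  then have "(\<Sum>k<n. 2 * Re (\<alpha> k * cnj (\<beta> k)) - (d k + \<mu>) * (cmod (\<beta> k))\<^sup>2) \<le> ?SA"
    unfolding \<alpha>_def by (intro sum_mono) auto
  then show ?thesis
    using ip quad by (simp add: sum_subtractf flip: sum_distrib_left)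
qed

section \<open>Rank-one perturbations with interlacing eigenvalues\<close>

lemma lagrange_interpolation:
  fixes p :: "real poly"
  assumes deg: "degree p < n" and inj: "inj_on x {..<n}"
  shows "poly p z = (\<Sum>i<n. poly p (x i) * (\<Prod>j\<in>{..<n}-{i}. (z - x j) / (x i - x j)))"
proof -
  define L where "L i = (\<Prod>j\<in>{..<n}-{i}. Polynomial.smult (1 / (x i - x j)) [:- x j, 1:])" for i
  define q where "q = p - (\<Sum>i<n. Polynomial.smult (poly p (x i)) (L i))"
  have polyL: "poly (L i) z = (\<Prod>j\<in>{..<n}-{i}. (z - x j) / (x i - x j))" for i z
    by (simp add: L_def poly_prod diff_divide_distrib)
  have degL: "degree (L i) < n" if "i < n" for i
  proof -
    have "degree (L i) \<le> sum (degree \<circ> (\<lambda>j. Polynomial.smult (1 / (x i - x j)) [:- x j, 1:])) ({..<n}-{i})"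
      unfolding L_def by (rule degree_prod_sum_le) simp
    also have "\<dots> \<le> (\<Sum>j\<in>{..<n}-{i}. 1)"
      by (rule sum_mono) simp
    also have "\<dots> < n" using that by (simp add: card_Diff_subset)
    finally show ?thesis .
  qed
  have "degree (\<Sum>i<n. Polynomial.smult (poly p (x i)) (L i)) < n"
    by (rule degree_sum_less) (use deg degL in \<open>auto intro: le_less_trans[OF Polynomial.degree_smult_le]\<close>)
  then have degq: "degree q < n" unfolding q_def using deg by (metis degree_diff_less)
  have "poly q (x k) = 0" if k: "k < n" for k
  proof -
    have "poly (L i) (x k) = (if i = k then 1 else 0)" if i: "i < n" for i
    proof (cases "i = k")
      case True
      then show ?thesis using inj i by (auto simp: polyL inj_on_def split: if_splits intro!: prod.neutral)
    next
      case False
      then show ?thesis using k i by (auto simp: polyL intro!: prod_zero bexI[of _ k])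
    qed
    then show ?thesis using k by (simp add: q_def poly_sum if_distrib[of "\<lambda>y. _ * y"] cong: if_cong)
  qed
  then have "x ` {..<n} \<subseteq> {y. poly q y = 0}" by auto
  moreover have "card (x ` {..<n}) = n" using inj by (simp add: card_image)
  ultimately have "q = 0"
    using degq poly_roots_degree[of q] card_mono[OF poly_roots_finite, of q "x ` {..<n}"] by fastforce
  then have "p = (\<Sum>i<n. Polynomial.smult (poly p (x i)) (L i))" by (simp add: q_def)
  then have "poly p z = poly (\<Sum>i<n. Polynomial.smult (poly p (x i)) (L i)) z" by (rule arg_cong)
  then show ?thesis by (simp add: poly_sum polyL)
qed

text \<open>The points alternate as x 0 < y 0 < x 1 < y 1 < ... . The \<open>x i\<close> become the
  spectrum of a diagonal matrix and the \<open>y i\<close> that of a larger matrix differing from it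
  by rank one.\<close>

locale interlacing =
  fixes M :: nat and x y :: "nat \<Rightarrow> real"
  assumes xy: "\<And>i. i < M \<Longrightarrow> x i < y i"
    and yx: "\<And>i j. i < j \<Longrightarrow> j < M \<Longrightarrow> y i < x j"
begin

lemma x_less: "i < j \<Longrightarrow> j < M \<Longrightarrow> x i < x j"
  using xy[of i] yx[of i j] by simp

lemma y_less: "i < j \<Longrightarrow> j < M \<Longrightarrow> y i < y j"
  using xy[of j] yx[of i j] by simp

lemma inj_x: "inj_on x {..<M}"
  by (rule inj_onI) (metis lessThan_iff linorder_neqE_nat order_less_irrefl x_less)

lemma inj_y: "inj_on y {..<M}"
  by (rule inj_onI) (metis lessThan_iff linorder_neqE_nat order_less_irrefl y_less)

lemma x_neq_y: "i < M \<Longrightarrow> k < M \<Longrightarrow> y k - x i \<noteq> 0"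
  using xy[of i] yx[of i k] xy[of k] yx[of k i]
  by (cases i k rule: linorder_cases) (auto dest: x_less y_less)

lemma x_neq: "i < M \<Longrightarrow> j < M \<Longrightarrow> i \<noteq> j \<Longrightarrow> x i - x j \<noteq> 0"
  using inj_x by (auto simp: inj_on_def)

lemma y_neq: "i < M \<Longrightarrow> j < M \<Longrightarrow> i \<noteq> j \<Longrightarrow> y i - y j \<noteq> 0"
  using inj_y by (auto simp: inj_on_def)

text \<open>\<open>X\<close> and \<open>Y\<close> are the characteristic polynomials of the two
  matrices, and \<open>X' i\<close>, \<open>Y' i\<close> the values of their derivatives at the
  roots \<open>x i\<close>, \<open>y i\<close>.\<close>

definition X where "X z = (\<Prod>j<M. z - x j)"
definition Y where "Y z = (\<Prod>j<M. z - y j)"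
definition X' where "X' i = (\<Prod>j\<in>{..<M}-{i}. x i - x j)"
definition Y' where "Y' i = (\<Prod>j\<in>{..<M}-{i}. y i - y j)"

lemma X'_nz: "i < M \<Longrightarrow> X' i \<noteq> 0" using x_neq by (auto simp: X'_def)
lemma Y'_nz: "i < M \<Longrightarrow> Y' i \<noteq> 0" using y_neq by (auto simp: Y'_def)
lemma X_nz: "k < M \<Longrightarrow> X (y k) \<noteq> 0" using x_neq_y by (auto simp: X_def)
lemma Y_nz: "k < M \<Longrightarrow> Y (x k) \<noteq> 0" using x_neq_y by (fastforce simp: Y_def)

text \<open>For \<open>j\<close> different from \<open>i\<close> the points \<open>x j\<close> and
  \<open>y j\<close> lie on the same side of \<open>x i\<close>, so the factors pair up to positive
  quotients. The sign comes from the unpaired factor \<open>x i - y i\<close>. The next lemma pairs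
  in the same way around \<open>y i\<close>.\<close>

lemma v_pos: assumes i: "i < M" shows "- Y (x i) / X' i > 0"
proof -
  have eq: "Y (x i) = (x i - y i) * (\<Prod>j\<in>{..<M}-{i}. x i - y j)"
    unfolding Y_def using i by (subst prod.remove[of _ i]) auto
  have "- Y (x i) / X' i = (y i - x i) * (\<Prod>j\<in>{..<M}-{i}. (x i - y j) / (x i - x j))"
    unfolding X'_def prod_dividef eq by (simp add: left_diff_distrib diff_divide_distrib)
  moreover have "(\<Prod>j\<in>{..<M}-{i}. (x i - y j) / (x i - x j)) > 0"
  proof (rule prod_pos)
    fix j assume "j \<in> {..<M}-{i}"
    then consider "j < i" | "i < j" "j < M" by fastforce
    then show "(x i - y j) / (x i - x j) > 0"
      using yx[of j i] x_less[of j i] i yx[of i j] x_less[of i j] xy[of i] xy[of j]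
      by cases (auto intro!: divide_pos_pos divide_neg_neg)
  qed
  ultimately show ?thesis using xy[OF i] by simp
qed

lemma n_pos: assumes i: "i < M" shows "X (y i) / Y' i > 0"
proof -
  have "X (y i) = (y i - x i) * (\<Prod>j\<in>{..<M}-{i}. y i - x j)"
    unfolding X_def using i by (subst prod.remove[of _ i]) auto
  then have "X (y i) / Y' i = (y i - x i) * (\<Prod>j\<in>{..<M}-{i}. (y i - x j) / (y i - y j))"
    by (simp add: Y'_def prod_dividef)
  moreover have "(\<Prod>j\<in>{..<M}-{i}. (y i - x j) / (y i - y j)) > 0"
  proof (rule prod_pos)
    fix j assume "j \<in> {..<M}-{i}"
    then consider "j < i" | "i < j" "j < M" by fastforce
    then show "(y i - x j) / (y i - y j) > 0"
      using yx[of j i] y_less[of j i] i yx[of i j] y_less[of i j] xy[of i] xy[of j]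
      by cases (auto intro!: divide_pos_pos divide_neg_neg)
  qed
  ultimately show ?thesis using xy[OF i] by simp
qed

text \<open>Lagrange interpolation at the nodes \<open>x\<close>, divided by \<open>X\<close>, is
  the partial fraction decomposition of p/X, here evaluated at \<open>y k\<close>.\<close>

lemma lagrange_X:
  assumes "degree p < M" "k < M"
  shows "(\<Sum>i<M. poly p (x i) / (X' i * (y k - x i))) = poly p (y k) / X (y k)"
proof -
  have "poly p (y k) = (\<Sum>i<M. poly p (x i) * (\<Prod>j\<in>{..<M}-{i}. (y k - x j) / (x i - x j)))"
    by (rule lagrange_interpolation[OF assms(1) inj_x])
  also have "\<dots> = (\<Sum>i<M. X (y k) * (poly p (x i) / (X' i * (y k - x i))))"
  proof (rule sum.cong)
    fix i assume "i \<in> {..<M}"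
    then have i: "i < M" by simp
    have "X (y k) = (y k - x i) * (\<Prod>j\<in>{..<M}-{i}. y k - x j)"
      unfolding X_def using i by (subst prod.remove[of _ i]) auto
    then show "poly p (x i) * (\<Prod>j\<in>{..<M}-{i}. (y k - x j) / (x i - x j)) = X (y k) * (poly p (x i) / (X' i * (y k - x i)))"
      using x_neq_y[OF i assms(2)] by (simp add: X'_def prod_dividef)
  qed simp
  also have "\<dots> = X (y k) * (\<Sum>i<M. poly p (x i) / (X' i * (y k - x i)))"
    by (simp add: sum_distrib_left)
  finally show ?thesis using X_nz[OF assms(2)] by simp
qed

text \<open>The vector \<open>v\<close> is chosen such that \<open>diag x + v v\<^sup>T\<close> has the eigenvalues \<open>y\<close>. The \<open>k\<close>-th column of
  the matrix \<open>V\<close> below is the eigenvector \<open>(y\<^sub>k - diag x)\<^sup>-\<^sup>1 v\<close>, normalised by the factor \<open>nn k\<close>.\<close>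

definition v where "v i = sqrt (- Y (x i) / X' i)"
definition nn where "nn i = sqrt (X (y i) / Y' i)"

lemma v2: "i < M \<Longrightarrow> (v i)\<^sup>2 = - Y (x i) / X' i"
  using v_pos[of i] by (simp add: v_def)
lemma nn2: "i < M \<Longrightarrow> (nn i)\<^sup>2 = X (y i) / Y' i"
  using n_pos[of i] by (simp add: nn_def)
lemma v_gt0: "i < M \<Longrightarrow> v i > 0" using v_pos by (simp add: v_def)
lemma nn_gt0: "i < M \<Longrightarrow> nn i > 0" using n_pos by (simp add: nn_def)

text \<open>This is the equation that makes \<open>y k\<close> an eigenvalue of diag x + v v^T. It
  follows from the partial fractions of Y - X: both polynomials are monic, so the degree drops below
  \<open>M\<close>, and the values are \<open>Y (x i)\<close> at \<open>x i\<close> and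
  \<open>- X (y k)\<close> at \<open>y k\<close>.\<close>

lemma secular:
  assumes k: "k < M"
  shows "(\<Sum>i<M. (v i)\<^sup>2 / (y k - x i)) = 1"
proof -
  define p where "p = (\<Prod>j<M. [:- y j, 1:]) - (\<Prod>j<M. [:- x j, 1:])"
  have M: "M > 0" using k by simp
  have deg: "degree (\<Prod>j<M. [:- w j, 1:]) = M" for w :: "nat \<Rightarrow> real"
    by (subst degree_prod_eq_sum_degree) auto
  have lc: "lead_coeff (\<Prod>j<M. [:- w j, 1:]) = 1" for w :: "nat \<Rightarrow> real"
    by (simp add: lead_coeff_prod)
  have "degree p \<le> M" unfolding p_def by (rule degree_diff_le) (simp_all add: deg)
  moreover have "coeff p M = 0" unfolding p_def using lc[of x] lc[of y] by (simp add: deg)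
  ultimately have "degree p < M"
    using M by (metis leading_coeff_0_iff degree_0 le_neq_implies_less)
  from lagrange_X[OF this k]
  have "(\<Sum>i<M. poly p (x i) / (X' i * (y k - x i))) = poly p (y k) / X (y k)" .
  moreover have "poly p (x i) = Y (x i)" if "i < M" for i
    using that by (auto simp: p_def poly_prod Y_def prod_zero intro!: prod_zero)
  moreover have "poly p (y k) = - X (y k)"
    using k by (auto simp: p_def poly_prod X_def intro!: prod_zero)
  ultimately have "(\<Sum>i<M. Y (x i) / (X' i * (y k - x i))) = - 1"
    using X_nz[OF k] by simp
  moreover have "(\<Sum>i<M. (v i)\<^sup>2 / (y k - x i)) = - (\<Sum>i<M. Y (x i) / (X' i * (y k - x i)))"
    by (simp add: v2 sum_negf)
  ultimately show ?thesis by simp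
qed

text \<open>Orthogonality of the eigenvectors, again by partial fractions: the polynomial Y(z)/(z -
  y k) vanishes at all \<open>y l\<close> with \<open>l\<close> different from \<open>k\<close> and
  equals \<open>Y' k\<close> at \<open>y k\<close>.\<close>

lemma gram:
  assumes k: "k < M" and l: "l < M"
  shows "(\<Sum>i<M. (v i)\<^sup>2 / ((y k - x i) * (y l - x i))) = (if k = l then 1 / (nn k)\<^sup>2 else 0)"
proof -
  define p where "p = (\<Prod>j\<in>{..<M}-{k}. [:- y j, 1:])"
  have "degree p \<le> sum (degree \<circ> (\<lambda>j. [:- y j, 1:])) ({..<M}-{k})"
    unfolding p_def by (rule degree_prod_sum_le) simp
  also have "\<dots> < M" using k by (simp add: card_Diff_subset)
  finally have "degree p < M" .
  from lagrange_X[OF this l]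
  have 1: "(\<Sum>i<M. poly p (x i) / (X' i * (y l - x i))) = poly p (y l) / X (y l)" .
  have 2: "poly p (x i) / (X' i * (y l - x i)) = (v i)\<^sup>2 / ((y k - x i) * (y l - x i))" if i: "i < M" for i
  proof -
    have eq: "Y (x i) = (x i - y k) * poly p (x i)"
      unfolding Y_def p_def poly_prod using k by (subst prod.remove[of _ k]) auto
    have "(v i)\<^sup>2 = (y k - x i) * (poly p (x i) / X' i)"
      unfolding v2[OF i] eq by (simp add: left_diff_distrib diff_divide_distrib)
    then show ?thesis using x_neq_y[OF i k] by simp
  qed
  have "poly p (y l) = (if k = l then Y' k else 0)"
    using l by (auto simp: p_def poly_prod Y'_def intro!: prod_zero)
  then show ?thesis using 1 2 by (auto simp: nn2[OF k] nn2[OF l])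
qed

definition V where "V = mat M M (\<lambda>(i, k). complex_of_real (v i * nn k / (y k - x i)))"

lemma V_carrier: "V \<in> carrier_mat M M" by (simp add: V_def)

lemma V_unitary: "unitary V"
proof (rule unitaryI[OF V_carrier], rule eq_matI)
  fix k l assume "k < dim_row (1\<^sub>m M :: complex mat)" "l < dim_col (1\<^sub>m M :: complex mat)"
  then have kl: "k < M" "l < M" by auto
  have "(mat_adjoint V * V) $$ (k, l) = (\<Sum>i<M. complex_of_real (nn k * nn l * ((v i)\<^sup>2 / ((y k - x i) * (y l - x i)))))"
    unfolding index_mult_mat_sum[OF mat_adjoint_carrier[OF V_carrier] V_carrier kl]
    by (rule sum.cong) (use kl in \<open>auto simp: V_def power2_eq_square\<close>)
  also have "\<dots> = complex_of_real (nn k * nn l * (\<Sum>i<M. (v i)\<^sup>2 / ((y k - x i) * (y l - x i))))"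
    by (simp add: sum_distrib_left)
  also have "\<dots> = 1\<^sub>m M $$ (k, l)"
    unfolding gram[OF kl] using kl nn_gt0[of k] by (cases "k = l") (auto simp: power2_eq_square)
  finally show "(mat_adjoint V * V) $$ (k, l) = 1\<^sub>m M $$ (k, l)" .
qed (use V_carrier in auto)

text \<open>The second matrix is \<open>B\<close> = diag x + v v^T, whose quadratic form at
  \<open>w\<close> exceeds that of diag x by the squared modulus of the sum of the
  \<open>v j * w $ j\<close>.\<close>

lemma rank_one:
  "loewner_le (diagonalised M (1\<^sub>m M) x) (diagonalised M V y)"
proof -
  define B where "B = mat M M (\<lambda>(i, j). complex_of_real ((if i = j then x i else 0) + v i * v j))"
  have B: "B \<in> carrier_mat M M" by (simp add: B_def)
  have "B * V = V * mat_diag M (\<lambda>k. complex_of_real (y k))"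
  proof (rule eq_matI)
    fix i k assume "i < dim_row (V * mat_diag M (\<lambda>k. complex_of_real (y k)))" "k < dim_col (V * mat_diag M (\<lambda>k. complex_of_real (y k)))"
    then have ik: "i < M" "k < M"
      using V_carrier carrier_matD[OF mat_diag_dim[of M "\<lambda>k. complex_of_real (y k)"]] by auto
    have "(B * V) $$ (i, k) = complex_of_real (\<Sum>j<M. ((if i = j then x i else 0) + v i * v j) * (v j * nn k / (y k - x j)))"
      unfolding index_mult_mat_sum[OF B V_carrier ik] of_real_sum
      by (rule sum.cong) (use ik in \<open>auto simp: B_def V_def\<close>)
    also have "(\<Sum>j<M. ((if i = j then x i else 0) + v i * v j) * (v j * nn k / (y k - x j)))
        = (\<Sum>j<M. (if i = j then x i * (v i * nn k / (y k - x i)) else 0) + v i * nn k * ((v j)\<^sup>2 / (y k - x j)))"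
      by (rule sum.cong) (auto simp: power2_eq_square algebra_simps)
    also have "\<dots> = x i * (v i * nn k / (y k - x i)) + v i * nn k * (\<Sum>j<M. (v j)\<^sup>2 / (y k - x j))"
      using ik by (simp add: sum.distrib sum_distrib_left)
    also have "\<dots> = v i * nn k / (y k - x i) * y k"
      unfolding secular[OF ik(2)] using x_neq_y[OF ik] by (simp add: field_simps)
    finally show "(B * V) $$ (i, k) = (V * mat_diag M (\<lambda>k. complex_of_real (y k))) $$ (i, k)"
      using ik by (simp add: mat_diag_mult_right[OF V_carrier]) (simp add: V_def)
  qed (use B V_carrier carrier_matD[OF mat_diag_dim[of M "\<lambda>k. complex_of_real (y k)"]] in auto)
  then have "B * V * mat_adjoint V = diagonalised M V y" by (simp add: diagonalised_def)
  moreover have "B * V * mat_adjoint V = B * (V * mat_adjoint V)"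
    using B V_carrier by (intro assoc_mult_mat[of _ M M _ M _ M]) auto
  ultimately have BV: "diagonalised M V y = B"
    using B by (simp add: unitaryD[OF V_carrier V_unitary])
  show ?thesis
    unfolding loewner_le_diagonalised_iff[OF one_carrier_mat V_carrier]
  proof
    fix w :: "complex vec" assume w: "w \<in> carrier_vec M"
    have "complex_of_real (\<Sum>k<M. y k * (cmod (eigencoef M V w k))\<^sup>2) = (B *\<^sub>v w) \<bullet>c w"
      using diagonalised_quadratic[OF V_carrier w, of y] by (simp add: BV)
    also have "\<dots> = (\<Sum>i<M. (\<Sum>j<M. B $$ (i, j) * w $ j) * cnj (w $ i))"
      using B w by (simp add: cscalar_prod_sum[OF mult_mat_vec_carrier[OF B w] w] mult_mat_vec_index_sum[OF B w] del: index_mult_mat_vec)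
    also have "\<dots> = (\<Sum>i<M. complex_of_real (x i) * (w $ i * cnj (w $ i))) + (\<Sum>i<M. \<Sum>j<M. (v j * w $ j) * cnj (v i * w $ i))"
      unfolding sum.distrib[symmetric]
    proof (rule sum.cong)
      fix i assume "i \<in> {..<M}"
      then have i: "i < M" by simp
      have "(\<Sum>j<M. B $$ (i, j) * w $ j) = (\<Sum>j<M. (if i = j then complex_of_real (x i) * w $ i else 0) + v i * (v j * w $ j))"
        by (rule sum.cong) (use i in \<open>auto simp: B_def algebra_simps\<close>)
      also have "\<dots> = x i * w $ i + v i * (\<Sum>j<M. v j * w $ j)"
        using i by (simp add: sum.distrib sum_distrib_left)
      finally show "(\<Sum>j<M. B $$ (i, j) * w $ j) * cnj (w $ i) =
          complex_of_real (x i) * (w $ i * cnj (w $ i)) + (\<Sum>j<M. (v j * w $ j) * cnj (v i * w $ i))"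
        by (simp add: sum_distrib_left sum_distrib_right algebra_simps)
    qed simp
    also have "(\<Sum>i<M. \<Sum>j<M. (v j * w $ j) * cnj (v i * w $ i)) = complex_of_real ((cmod (\<Sum>j<M. v j * w $ j))\<^sup>2)"
      unfolding complex_norm_square cnj_sum sum_product by (subst sum.swap) simp
    also have "(\<Sum>i<M. complex_of_real (x i) * (w $ i * cnj (w $ i))) = complex_of_real (\<Sum>i<M. x i * (cmod (eigencoef M (1\<^sub>m M) w i))\<^sup>2)"
      unfolding of_real_sum of_real_mult complex_norm_square
    proof (rule sum.cong)
      fix i assume "i \<in> {..<M}"
      then have "eigencoef M (1\<^sub>m M) w i = (\<Sum>j<M. if j = i then w $ j else 0)"
        unfolding eigencoef_def by (intro sum.cong) auto
      then show "complex_of_real (x i) * (w $ i * cnj (w $ i)) =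
          complex_of_real (x i) * (eigencoef M (1\<^sub>m M) w i * cnj (eigencoef M (1\<^sub>m M) w i))"
        using \<open>i \<in> {..<M}\<close> by (simp add: sum.delta')
    qed simp
    finally have "(\<Sum>k<M. y k * (cmod (eigencoef M V w k))\<^sup>2)
        = (\<Sum>i<M. x i * (cmod (eigencoef M (1\<^sub>m M) w i))\<^sup>2) + (cmod (\<Sum>j<M. v j * w $ j))\<^sup>2"
      by (simp only: of_real_add[symmetric] of_real_eq_iff)
    then show "(\<Sum>k<M. x k * (cmod (eigencoef M (1\<^sub>m M) w k))\<^sup>2) \<le> (\<Sum>k<M. y k * (cmod (eigencoef M V w k))\<^sup>2)"
      by simp
  qed
qed

text \<open>The left side is the divided difference of f q^2 over all 2M points, since
  \<open>X' i * Y (x i)\<close> is the product of the differences from \<open>x i\<close>. The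
  operator inequality is tested at one vector, and the minus sign in the formula for
  \<open>(v i)\<^sup>2\<close> moves the sum over the \<open>x i\<close> to the other side.\<close>

lemma divided_difference_nonneg:
  assumes f: "operator_monotone_on I f"
    and I: "\<And>i. i < M \<Longrightarrow> x i \<in> I" "\<And>i. i < M \<Longrightarrow> y i \<in> I"
    and deg: "degree q < M"
  shows "(\<Sum>i<M. f (x i) * (poly q (x i))\<^sup>2 / (X' i * Y (x i))) + (\<Sum>k<M. f (y k) * (poly q (y k))\<^sup>2 / (X (y k) * Y' k)) \<ge> 0"
proof -
  \<comment> \<open>The coordinates are chosen so that \<open>lagrange_X\<close> evaluates the
    coefficients along the columns of \<open>V\<close>: these become multiples of
    \<open>poly q (y k)\<close> as well.\<close>
  define w where "w = vec M (\<lambda>i. complex_of_real (poly q (x i) / (v i * X' i)))"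
  have w: "w \<in> carrier_vec M" by (simp add: w_def)
  have u1: "unitary (1\<^sub>m M :: complex mat)" by (rule unitaryI[of _ M]) (auto intro!: eq_matI)
  have 1: "eigencoef M (1\<^sub>m M) w i = complex_of_real (poly q (x i) / (v i * X' i))" if i: "i < M" for i
  proof -
    have "eigencoef M (1\<^sub>m M) w i = (\<Sum>j<M. if j = i then w $ j else 0)"
      unfolding eigencoef_def using i by (intro sum.cong) auto
    then show ?thesis using i by (simp add: sum.delta' w_def)
  qed
  have 2: "eigencoef M V w k = complex_of_real (nn k * poly q (y k) / X (y k))" if k: "k < M" for k
  proof -
    have "eigencoef M V w k = (\<Sum>i<M. complex_of_real (nn k * (poly q (x i) / (X' i * (y k - x i)))))"
      unfolding eigencoef_def
    proof (rule sum.cong)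
      fix i assume "i \<in> {..<M}"
      then have i: "i < M" by simp
      then show "cnj (V $$ (i, k)) * w $ i = complex_of_real (nn k * (poly q (x i) / (X' i * (y k - x i))))"
        using k v_gt0[OF i] X'_nz[OF i] x_neq_y[OF i k] by (simp add: V_def w_def field_simps)
    qed simp
    also have "\<dots> = complex_of_real (nn k * (\<Sum>i<M. poly q (x i) / (X' i * (y k - x i))))"
      by (simp add: sum_distrib_left)
    finally show ?thesis by (simp add: lagrange_X[OF deg k])
  qed
  have "(\<Sum>i<M. f (x i) * (cmod (eigencoef M (1\<^sub>m M) w i))\<^sup>2) \<le> (\<Sum>k<M. f (y k) * (cmod (eigencoef M V w k))\<^sup>2)"
    by (rule operator_monotone_onD[OF f one_carrier_mat u1 V_carrier V_unitary I rank_one w])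
  moreover have "(\<Sum>i<M. f (x i) * (cmod (eigencoef M (1\<^sub>m M) w i))\<^sup>2) = - (\<Sum>i<M. f (x i) * (poly q (x i))\<^sup>2 / (X' i * Y (x i)))"
    unfolding sum_negf[symmetric]
  proof (rule sum.cong)
    fix i assume "i \<in> {..<M}"
    then have i: "i < M" by simp
    show "f (x i) * (cmod (eigencoef M (1\<^sub>m M) w i))\<^sup>2 = - (f (x i) * (poly q (x i))\<^sup>2 / (X' i * Y (x i)))"
      unfolding 1[OF i] using X'_nz[OF i] Y_nz[OF i]
      by (simp add: power_divide power_mult_distrib v2[OF i] norm_divide norm_mult del: of_real_divide) (simp add: field_simps power2_eq_square)
  qed simp
  moreover have "(\<Sum>k<M. f (y k) * (cmod (eigencoef M V w k))\<^sup>2) = (\<Sum>k<M. f (y k) * (poly q (y k))\<^sup>2 / (X (y k) * Y' k))"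
  proof (rule sum.cong)
    fix k assume "k \<in> {..<M}"
    then have k: "k < M" by simp
    show "f (y k) * (cmod (eigencoef M V w k))\<^sup>2 = f (y k) * (poly q (y k))\<^sup>2 / (X (y k) * Y' k)"
      unfolding 2[OF k] using Y'_nz[OF k] X_nz[OF k]
      by (simp add: power_divide power_mult_distrib nn2[OF k] norm_divide norm_mult del: of_real_divide) (simp add: field_simps power2_eq_square)
  qed simp
  ultimately show ?thesis by simp
qed

end

text \<open>After sorting, the even positions serve as spectrum of the smaller matrix and the odd
  positions as spectrum of the larger one, which forces an even number of points.\<close>

lemma divided_difference_square_nonneg:
  assumes f: "operator_monotone_on I f" and T: "finite T" "T \<subseteq> I" "card T = 2 * M"
    and deg: "degree q < M"
  shows "(\<Sum>t\<in>T. f t * (poly q t)\<^sup>2 / (\<Prod>s\<in>T-{t}. t - s)) \<ge> 0"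
proof -
  define ts where "ts = sorted_list_of_set T"
  have ts: "length ts = 2 * M" "set ts = T" "sorted_wrt (<) ts"
    using T by (auto simp: ts_def)
  define x where "x i = ts ! (2 * i)" for i
  define y where "y i = ts ! (2 * i + 1)" for i
  have less: "ts ! i < ts ! j" if "i < j" "j < 2 * M" for i j
    using sorted_wrt_nth_less[OF ts(3) that(1)] that(2) ts(1) by simp
  interpret interlacing M x y
    by unfold_locales (auto simp: x_def y_def intro!: less)
  have T_eq: "T = x ` {..<M} \<union> y ` {..<M}"
  proof (intro equalityI subsetI)
    fix t assume "t \<in> T"
    then obtain i where i: "i < 2 * M" "t = ts ! i"
      using ts by (metis in_set_conv_nth)
    show "t \<in> x ` {..<M} \<union> y ` {..<M}"
    proof (cases "even i")
      case True
      then obtain j where "i = 2 * j" by auto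
      then show ?thesis using i by (auto simp: x_def)
    next
      case False
      then obtain j where "i = 2 * j + 1" by (auto elim: oddE)
      then show ?thesis using i by (auto simp: y_def)
    qed
  next
    fix t assume "t \<in> x ` {..<M} \<union> y ` {..<M}"
    then show "t \<in> T" using ts(1) by (auto simp: x_def y_def ts(2)[symmetric])
  qed
  have disj: "x ` {..<M} \<inter> y ` {..<M} = {}"
    using x_neq_y by fastforce
  have "(\<Prod>s\<in>T-{x i}. x i - s) = X' i * Y (x i)" if i: "i < M" for i
  proof -
    have "T - {x i} = x ` ({..<M}-{i}) \<union> y ` {..<M}"
      using disj i inj_x by (auto simp: T_eq inj_on_def)
    moreover have "x ` ({..<M}-{i}) \<inter> y ` {..<M} = {}" using disj by auto
    moreover have "inj_on x ({..<M}-{i})" using inj_x by (rule inj_on_subset) auto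
    ultimately show ?thesis
      by (simp add: prod.union_disjoint prod.reindex inj_y X'_def Y_def)
  qed
  moreover have "(\<Prod>s\<in>T-{y k}. y k - s) = X (y k) * Y' k" if k: "k < M" for k
  proof -
    have "T - {y k} = x ` {..<M} \<union> y ` ({..<M}-{k})"
      using disj k inj_y by (auto simp: T_eq inj_on_def)
    moreover have "x ` {..<M} \<inter> y ` ({..<M}-{k}) = {}" using disj by auto
    moreover have "inj_on y ({..<M}-{k})" using inj_y by (rule inj_on_subset) auto
    ultimately show ?thesis
      by (simp add: prod.union_disjoint prod.reindex inj_x Y'_def X_def)
  qed
  ultimately have "(\<Sum>t\<in>T. f t * (poly q t)\<^sup>2 / (\<Prod>s\<in>T-{t}. t - s))
    = (\<Sum>i<M. f (x i) * (poly q (x i))\<^sup>2 / (X' i * Y (x i))) + (\<Sum>k<M. f (y k) * (poly q (y k))\<^sup>2 / (X (y k) * Y' k))"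
    unfolding sum.union_disjoint[OF finite_imageI[OF finite_lessThan] finite_imageI[OF finite_lessThan] disj, folded T_eq]
    by (simp add: sum.reindex inj_x inj_y)
  moreover have "x i \<in> I" "y i \<in> I" if "i < M" for i
    using that T(2) by (auto simp: T_eq)
  ultimately show ?thesis
    using divided_difference_nonneg[OF f _ _ deg] by simp
qed

text \<open>Add the points \<open>0\<close> and \<open>S\<close>, let the square vanish at \<open>S\<close>, divide by \<open>S\<close>, and let \<open>S \<rightarrow> \<infinity>\<close>.\<close>

lemma divided_difference_square_nonpos:
  assumes f: "operator_monotone_on {0..} f" "f 0 \<ge> 0"
    and T: "finite T" "T \<subseteq> {0<..}" "card T = 2 * M" and deg: "degree q < M"
  shows "(\<Sum>t\<in>T. f t * (poly q t)\<^sup>2 / (t * (\<Prod>s\<in>T-{t}. t - s))) \<le> 0" (is "(\<Sum>t\<in>T. ?A t) \<le> 0")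
proof -
  have large: "0 \<le> (\<Sum>t\<in>T. ?A t * (t - S))" if S: "S > 0" "\<And>t. t \<in> T \<Longrightarrow> t < S" for S
  proof -
    define Q where "Q = q * [:- S, 1:]"
    have notin: "0 \<notin> T" "S \<notin> T" "0 \<noteq> S" using T S by auto
    have "card (insert 0 (insert S T)) = 2 * (M + 1)" using T notin by simp
    moreover have "degree Q < M + 1"
      using degree_mult_le[of q "[:- S, 1:]"] deg by (simp add: Q_def)
    ultimately have "0 \<le> (\<Sum>t\<in>insert 0 (insert S T). f t * (poly Q t)\<^sup>2 / (\<Prod>s\<in>insert 0 (insert S T)-{t}. t - s))"
      using T S(1) by (intro divided_difference_square_nonneg[OF f(1)]) auto
    also have "\<dots> = f 0 * (poly Q 0)\<^sup>2 / (\<Prod>s\<in>insert S T. 0 - s)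
        + (\<Sum>t\<in>T. f t * (poly Q t)\<^sup>2 / (\<Prod>s\<in>insert 0 (insert S T)-{t}. t - s))"
    proof -
      have "insert 0 (insert S T) - {0} = insert S T" using notin by auto
      moreover have "poly Q S = 0" by (simp add: Q_def)
      ultimately show ?thesis using T notin by simp
    qed
    also have "\<dots> \<le> (\<Sum>t\<in>T. f t * (poly Q t)\<^sup>2 / (\<Prod>s\<in>insert 0 (insert S T)-{t}. t - s))"
    proof -
      have "(\<Prod>s\<in>T. 0 - s) = (\<Prod>s\<in>T. s)"
        using prod_uminus[of "\<lambda>s. s" T] T(3) by simp
      moreover have "(\<Prod>s\<in>T. s) > 0" using T by (intro prod_pos) auto
      ultimately have "(\<Prod>s\<in>insert S T. 0 - s) < 0" using T notin S by (simp add: mult_neg_pos)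
      then have "f 0 * (poly Q 0)\<^sup>2 / (\<Prod>s\<in>insert S T. 0 - s) \<le> 0"
        using f(2) by (intro divide_nonneg_neg) auto
      then show ?thesis by simp
    qed
    also have "\<dots> = (\<Sum>t\<in>T. ?A t * (t - S))"
    proof (rule sum.cong)
      fix t assume t: "t \<in> T"
      have "insert 0 (insert S T) - {t} = insert 0 (insert S (T-{t}))" using notin t by auto
      then have "(\<Prod>s\<in>insert 0 (insert S T)-{t}. t - s) = t * ((t - S) * (\<Prod>s\<in>T-{t}. t - s))"
        using T notin by simp
      moreover have "poly Q t = poly q t * (t - S)" by (simp add: Q_def algebra_simps)
      moreover have "t - S \<noteq> 0" using S t by force
      ultimately show "f t * (poly Q t)\<^sup>2 / (\<Prod>s\<in>insert 0 (insert S T)-{t}. t - s) = ?A t * (t - S)"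
        by (simp add: power2_eq_square)
    qed simp
    finally show ?thesis .
  qed
  show ?thesis
  proof (rule ccontr)
    define \<alpha> where "\<alpha> = (\<Sum>t\<in>T. ?A t)"
    define \<beta> where "\<beta> = (\<Sum>t\<in>T. ?A t * t)"
    assume "\<not> ?thesis"
    then have \<alpha>: "\<alpha> > 0" by (simp add: \<alpha>_def)
    \<comment> \<open>The first summand puts \<open>S\<close> beyond all points of \<open>T\<close>;
      the second makes S times \<alpha> outweigh \<beta>.\<close>
    define S where "S = (\<Sum>t\<in>T. t) + \<bar>\<beta>\<bar> / \<alpha> + 1"
    have "(\<Sum>t\<in>T. t) \<ge> 0" using T by (intro sum_nonneg) auto
    then have "S > 0" using \<alpha> by (simp add: S_def add_nonneg_pos)
    moreover have "t < S" if "t \<in> T" for t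
    proof -
      have "t \<le> (\<Sum>t\<in>T. t)" using T that by (intro member_le_sum) auto
      moreover have "\<bar>\<beta>\<bar> / \<alpha> \<ge> 0" using \<alpha> by simp
      ultimately show ?thesis by (simp add: S_def)
    qed
    ultimately have "0 \<le> (\<Sum>t\<in>T. ?A t * (t - S))" by (rule large)
    also have "\<dots> = \<beta> - S * \<alpha>"
      unfolding \<alpha>_def \<beta>_def right_diff_distrib sum_subtractf sum_distrib_left by (simp only: mult.commute)
    also have "S * \<alpha> = ((\<Sum>t\<in>T. t) + 1) * \<alpha> + \<bar>\<beta>\<bar>"
      using \<alpha> by (simp add: S_def field_simps)
    finally have "((\<Sum>t\<in>T. t) + 1) * \<alpha> \<le> 0" by linarith
    moreover have "((\<Sum>t\<in>T. t) + 1) * \<alpha> > 0"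
      using \<alpha> \<open>(\<Sum>t\<in>T. t) \<ge> 0\<close> by (intro mult_pos_pos) auto
    ultimately show False by simp
  qed
qed

text \<open>Sums of terms q(x)^2 and x q(x)^2. The bound \<open>n\<close> applies to every summand
  and not just to the sum, because the divided differences accept only squares of polynomials of
  degree below \<open>M\<close>.\<close>

inductive_set half_line_squares :: "nat \<Rightarrow> real poly set" for n :: nat where
  square: "2 * degree q \<le> n \<Longrightarrow> q\<^sup>2 \<in> half_line_squares n"
| shifted: "2 * degree q + 1 \<le> n \<Longrightarrow> pCons 0 (q\<^sup>2) \<in> half_line_squares n"
| add: "p \<in> half_line_squares n \<Longrightarrow> r \<in> half_line_squares n \<Longrightarrow> p + r \<in> half_line_squares n"

text \<open>The product of two shifted squares is x^2 q^2 s^2, again a square. Hence the cone is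
  closed under products, and a polynomial can be decomposed factor by factor.\<close>

lemma half_line_squares_mult:
  assumes "p \<in> half_line_squares a" "r \<in> half_line_squares b"
  shows "p * r \<in> half_line_squares (a + b)"
proof -
  have sq: "q\<^sup>2 * r \<in> half_line_squares (a + b)" if q: "2 * degree q \<le> a" for q
    using assms(2)
  proof induction
    case (square s)
    then show ?case using half_line_squares.square[of "q * s" "a + b"] q degree_mult_le[of q s]
      by (simp add: power_mult_distrib)
  next
    case (shifted s)
    then show ?case using half_line_squares.shifted[of "q * s" "a + b"] q degree_mult_le[of q s]
      by (simp add: power_mult_distrib)
  qed (auto simp: distrib_left intro: half_line_squares.add)
  have sh: "pCons 0 (q\<^sup>2) * r \<in> half_line_squares (a + b)" if q: "2 * degree q + 1 \<le> a" for q
    using assms(2)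
  proof induction
    case (square s)
    then show ?case using half_line_squares.shifted[of "q * s" "a + b"] q degree_mult_le[of q s]
      by (simp add: power_mult_distrib)
  next
    case (shifted s)
    have "degree (pCons 0 (q * s)) \<le> Suc (degree (q * s))" by (rule degree_pCons_le)
    then show ?case
      using half_line_squares.square[of "pCons 0 (q * s)" "a + b"] q shifted degree_mult_le[of q s]
      by (simp add: power2_eq_square mult_ac)
  next
    case (add p r)
    then show ?case unfolding distrib_left by (intro half_line_squares.add)
  qed
  show ?thesis using assms(1)
  proof induction
    case (add p r')
    then show ?case unfolding distrib_right by (intro half_line_squares.add)
  qed (rule sq sh, assumption)+
qed

lemma half_line_squares_const: "c \<ge> 0 \<Longrightarrow> [:c:] \<in> half_line_squares n"
  using half_line_squares.square[of "[:sqrt c:]" n] by (simp add: power2_eq_square)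

lemma half_line_squares_mono:
  assumes "p \<in> half_line_squares n" "n \<le> m" shows "p \<in> half_line_squares m"
  using half_line_squares_mult[OF assms(1) half_line_squares_const[of 1 "m - n"]] assms(2) by simp

lemma map_poly_of_real_mult:
  "map_poly complex_of_real (p * q) = map_poly complex_of_real p * map_poly complex_of_real q"
  by (intro poly_eqI) (simp add: coeff_mult coeff_map_poly)

lemma poly_nonneg_limit:
  fixes p :: "real poly"
  assumes "\<And>x. x > a \<Longrightarrow> poly p x \<ge> 0"
  shows "poly p a \<ge> 0"
proof -
  have "(poly p \<longlongrightarrow> poly p a) (at_right a)"
    by (rule tendsto_poly[OF tendsto_ident_at])
  then show ?thesis
    by (rule tendsto_lowerbound) (use assms in \<open>auto simp: eventually_at_right_less intro: eventually_mono[OF eventually_at_right_less]\<close>)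
qed

text \<open>Induction on the degree, splitting off one factor that belongs to the cone: x - r = -r +
  x for a root r <= 0, (x - r)^2 for a root r > 0, which must be a multiple root, and (x - a)^2 +
  b^2 for a nonreal root a + i b.\<close>

lemma nonneg_half_line_imp_squares:
  fixes p :: "real poly"
  assumes "\<And>x. x \<ge> 0 \<Longrightarrow> poly p x \<ge> 0"
  shows "p \<in> half_line_squares (degree p)"
  using assms
proof (induction "degree p" arbitrary: p rule: less_induct)
  case less
  show ?case
  proof (cases "degree p = 0")
    case True
    then obtain c where "p = [:c:]" by (metis degree_eq_zeroE)
    then show ?thesis using less(2)[of 0] half_line_squares_const by simp
  next
    case False
    then have p0: "p \<noteq> 0" by auto
    have "\<not> constant (poly (map_poly complex_of_real p))"
      using False by (simp add: constant_degree)
    from fundamental_theorem_of_algebra[OF this]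
    obtain \<zeta> where \<zeta>: "poly (map_poly complex_of_real p) \<zeta> = 0" by auto
    have IH: "p \<in> half_line_squares (degree p)"
      if dec: "p = d * q" and d: "d \<in> half_line_squares (degree d)" "degree d > 0"
        and q: "\<And>x. x \<ge> 0 \<Longrightarrow> poly q x \<ge> 0" for d q
    proof -
      have "degree p = degree d + degree q" using p0 by (simp add: dec degree_mult_eq)
      then show ?thesis
        using less(1)[of q] q half_line_squares_mult[OF d(1), of q "degree q"] d(2) by (simp add: dec)
    qed
    show ?thesis
    proof (cases "Im \<zeta> = 0")
      case True
      define r where "r = Re \<zeta>"
      have "\<zeta> = complex_of_real r" using True by (simp add: r_def complex_eq_iff)
      then have "complex_of_real (poly p r) = 0" using \<zeta> by (simp flip: of_real_hom.poly_map_poly)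
      then have "poly p r = 0" by simp
      then obtain q where q: "p = [:- r, 1:] * q" by (auto simp: poly_eq_0_iff_dvd elim: dvdE)
      have pq: "poly p x = (x - r) * poly q x" for x by (simp add: q algebra_simps)
      show ?thesis
      proof (cases "r \<le> 0")
        case True
        have "[:- r, 1:] = [:- r:] + pCons 0 (1\<^sup>2)" by simp
        also have "\<dots> \<in> half_line_squares 1"
          by (intro half_line_squares.add half_line_squares_const half_line_squares.shifted) (use True in auto)
        finally have d: "[:- r, 1:] \<in> half_line_squares (degree [:- r, 1:])" by simp
        have pos: "poly q x \<ge> 0" if "x > 0" for x
          using less(2)[of x] that True by (simp add: pq zero_le_mult_iff)
        then have "poly q x \<ge> 0" if "x \<ge> 0" for x
          using that poly_nonneg_limit[of 0 q] by (cases "x = 0") auto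
        from IH[OF q d _ this] show ?thesis by simp
      next
        case False
        then have r: "r > 0" by simp
        have pos: "poly q x \<ge> 0" if "x > r" for x
          using less(2)[of x] that r by (simp add: pq zero_le_mult_iff)
        have neg: "poly q x \<le> 0" if "0 \<le> x" "x < r" for x
          using less(2)[of x] that by (simp add: pq zero_le_mult_iff)
        \<comment> \<open>The quotient is nonnegative to the right of \<open>r\<close> and
          nonpositive to the left, so it vanishes at \<open>r\<close> and the root is at least
          double.\<close>
        have "poly q r \<ge> 0" by (rule poly_nonneg_limit) (rule pos)
        moreover have "poly q r \<le> 0"
        proof -
          have "(poly q \<longlongrightarrow> poly q r) (at_left r)"
            by (rule tendsto_poly[OF tendsto_ident_at])
          moreover have "\<forall>\<^sub>F x in at_left r. poly q x \<le> 0"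
            using eventually_at_left_real[OF r] by eventually_elim (auto intro: neg)
          ultimately show ?thesis by (rule tendsto_upperbound) simp
        qed
        ultimately have "poly q r = 0" by simp
        then obtain s where s: "q = [:- r, 1:] * s" by (auto simp: poly_eq_0_iff_dvd elim: dvdE)
        have qs: "poly q x = (x - r) * poly s x" for x by (simp add: s algebra_simps)
        have ps: "p = [:- r, 1:]\<^sup>2 * s" by (simp only: q s power2_eq_square mult.assoc)
        have spos: "poly s x \<ge> 0" if "x \<ge> 0" "x \<noteq> r" for x
        proof -
          have "(x - r)\<^sup>2 * poly s x \<ge> 0"
            using less(2)[OF that(1)] by (simp add: pq qs power2_eq_square mult.assoc)
          moreover have "(x - r)\<^sup>2 > 0" using that by simp
          ultimately show ?thesis by (simp add: zero_le_mult_iff)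
        qed
        have "poly s r \<ge> 0"
        proof (rule poly_nonneg_limit)
          show "poly s x \<ge> 0" if "x > r" for x using spos[of x] that r by simp
        qed
        with spos have spos': "poly s x \<ge> 0" if "x \<ge> 0" for x using that by (cases "x = r") auto
        have sq: "[:- r, 1:]\<^sup>2 \<in> half_line_squares (degree ([:- r, 1:]\<^sup>2))"
          by (rule half_line_squares.square) (simp add: degree_power_eq)
        show ?thesis by (rule IH[OF ps sq _ spos']) (simp_all add: degree_power_eq)
      qed
    next
      case False
      define a b where "a = Re \<zeta>" and "b = Im \<zeta>"
      define d where "d = [:- a, 1:]\<^sup>2 + [:b:]\<^sup>2"
      have d_eq: "d = [:a\<^sup>2 + b\<^sup>2, - 2 * a, 1:]" by (simp add: d_def power2_eq_square)
      have degd: "degree d = 2" by (simp add: d_eq)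
      have dpos: "poly d x > 0" for x
        using False by (simp add: d_def b_def add_nonneg_pos)
      define q where "q = p div d"
      define r where "r = p mod d"
      have pqr: "p = q * d + r" by (simp add: q_def r_def)
      have "degree r < 2 \<or> r = 0" using degree_mod_less[of d p] degd d_eq by (auto simp: r_def)
      then have "degree r \<le> 1" by auto
      then have "r = [:coeff r 0, coeff r 1:]"
        by (intro poly_eqI) (auto simp: coeff_pCons coeff_eq_0 split: nat.splits)
      then obtain u w where r: "r = [:u, w:]" by blast
      have "poly (map_poly complex_of_real d) \<zeta> = 0"
        by (simp add: d_eq map_poly_pCons complex_eq_iff a_def b_def power2_eq_square algebra_simps)
      then have "poly (map_poly complex_of_real r) \<zeta> = 0"
        using \<zeta> unfolding pqr by (simp add: map_poly_of_real_mult hom_distribs)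
      \<comment> \<open>A real polynomial of degree at most one with a nonreal root is zero, so
        \<open>d\<close> divides \<open>p\<close>.\<close>
      then have "w = 0 \<and> u = 0"
        using False by (auto simp: r of_real_hom.map_poly_pCons_hom complex_eq_iff)
      then have pd: "p = d * q" using pqr r by simp
      have "d \<in> half_line_squares 2"
        unfolding d_def by (intro half_line_squares.add half_line_squares.square) auto
      moreover have "poly q x \<ge> 0" if "x \<ge> 0" for x
        using less(2)[OF that] dpos[of x] by (simp add: pd zero_le_mult_iff)
      ultimately show ?thesis using IH[OF pd] by (simp add: degd)
    qed
  qed
qed

section \<open>The dual cone\<close>

text \<open>The parameter l = 0 contributes the constant function 1. The identity needs no test of
  its own: it is the limit of \<open>l * (t / (t + l))\<close> for l tending to infinity.\<close>

definition loewner_dual :: "(real \<Rightarrow> real) \<Rightarrow> bool" where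
  "loewner_dual f \<longleftrightarrow> (\<forall>T c. finite T \<longrightarrow> T \<subseteq> {0<..} \<longrightarrow>
     (\<forall>l\<ge>0. 0 \<le> (\<Sum>t\<in>T. c t * (t / (t + l)))) \<longrightarrow> 0 \<le> (\<Sum>t\<in>T. c t * f t))"

lemma loewner_dualD:
  assumes "loewner_dual f" "finite T" "T \<subseteq> {0<..}"
    and "\<And>l. l \<ge> 0 \<Longrightarrow> 0 \<le> (\<Sum>t\<in>T. c t * (t / (t + l)))"
  shows "0 \<le> (\<Sum>t\<in>T. c t * f t)"
  using assms unfolding loewner_dual_def by blast

text \<open>Over the common denominator, the hypothesis on \<open>c\<close> says that the numerator
  \<open>P\<close> is nonnegative on the half-line, so \<open>P\<close> is a sum of squares and
  shifted squares in \<open>l\<close>. The functional \<open>\<Lambda>\<close> sends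
  \<open>P\<close> to the desired sum and is nonnegative on both kinds of summands. They are
  evaluated at -t: for a shifted square the factor -t cancels the \<open>t\<close> in the
  denominator and reverses the sign, which is why one kind needs a nonnegative and the other a
  nonpositive divided difference.\<close>

lemma operator_monotone_imp_dual_even:
  assumes f: "operator_monotone_on {0..} f" "f 0 \<ge> 0"
    and T: "finite T" "T \<subseteq> {0<..}" "card T = 2 * M"
    and c: "\<And>l. l \<ge> 0 \<Longrightarrow> 0 \<le> (\<Sum>t\<in>T. c t * (t / (t + l)))"
  shows "0 \<le> (\<Sum>t\<in>T. c t * f t)"
proof (cases "M = 0")
  case True
  then show ?thesis using T by simp
next
  case False
  define P where "P = (\<Sum>t\<in>T. Polynomial.smult (c t * t) (\<Prod>s\<in>T-{t}. [:s, 1:]))"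
  \<comment> \<open>At -t only the summand of \<open>P\<close> with index \<open>t\<close> survives,
    with value \<open>c t * t\<close> times the product in the denominator. Hence
    \<open>\<Lambda> P\<close> is the sum of the \<open>c t * f t\<close>.\<close>
  define \<Lambda> where "\<Lambda> p = (\<Sum>t\<in>T. f t * poly p (- t) / (t * (\<Prod>s\<in>T-{t}. s - t)))" for p
  have polyP: "poly P l = (\<Sum>t\<in>T. c t * t * (\<Prod>s\<in>T-{t}. s + l))" for l
    by (simp add: P_def poly_sum poly_prod)
  have "poly P l \<ge> 0" if l: "l \<ge> 0" for l
  proof -
    have "poly P l = (\<Sum>t\<in>T. (\<Prod>s\<in>T. s + l) * (c t * (t / (t + l))))"
      unfolding polyP
    proof (rule sum.cong)
      fix t assume t: "t \<in> T"
      then have "t + l > 0" using T l by (auto intro: add_pos_nonneg)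
      then show "c t * t * (\<Prod>s\<in>T-{t}. s + l) = (\<Prod>s\<in>T. s + l) * (c t * (t / (t + l)))"
        using prod.remove[OF T(1) t, of "\<lambda>s. s + l"] by simp
    qed simp
    also have "\<dots> = (\<Prod>s\<in>T. s + l) * (\<Sum>t\<in>T. c t * (t / (t + l)))"
      by (simp add: sum_distrib_left)
    also have "\<dots> \<ge> 0"
      using T l by (intro mult_nonneg_nonneg prod_nonneg c) (auto intro!: add_nonneg_nonneg)
    finally show ?thesis .
  qed
  then have "P \<in> half_line_squares (degree P)" by (rule nonneg_half_line_imp_squares)
  moreover have "degree P \<le> 2 * M - 1"
    unfolding P_def
  proof (rule degree_sum_le[OF T(1)])
    fix t assume t: "t \<in> T"
    have "degree (\<Prod>s\<in>T-{t}. [:s, 1:]) \<le> sum (degree \<circ> (\<lambda>s. [:s, 1:])) (T-{t})"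
      by (rule degree_prod_sum_le) (use T in simp)
    also have "\<dots> = 2 * M - 1" using T t by simp
    finally show "degree (Polynomial.smult (c t * t) (\<Prod>s\<in>T-{t}. [:s, 1:])) \<le> 2 * M - 1"
      using Polynomial.degree_smult_le le_trans by blast
  qed
  \<comment> \<open>With the bound 2M - 1, squares and shifted squares alike come from polynomials
    of degree below \<open>M\<close>.\<close>
  ultimately have P: "P \<in> half_line_squares (2 * M - 1)" by (rule half_line_squares_mono)
  have flip: "(\<Prod>s\<in>T-{t}. s - t) = - (\<Prod>s\<in>T-{t}. t - s)" if t: "t \<in> T" for t
  proof -
    have "(\<Prod>s\<in>T-{t}. s - t) = (\<Prod>s\<in>T-{t}. - (t - s))" by simp
    also have "\<dots> = (- 1) ^ card (T-{t}) * (\<Prod>s\<in>T-{t}. t - s)" by (rule prod_uminus)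
    also have "odd (card (T-{t}))" using T t False by simp
    then have "(- 1 :: real) ^ card (T-{t}) = - 1" by simp
    finally show ?thesis by simp
  qed
  have "\<Lambda> P \<ge> 0"
    using P
  proof induction
    case (square q)
    have "degree (q \<circ>\<^sub>p [:0, - 1:]) < M"
      using square False by (simp add: degree_pcompose)
    from divided_difference_square_nonpos[OF f T this]
    have "(\<Sum>t\<in>T. f t * (poly q (- t))\<^sup>2 / (t * (\<Prod>s\<in>T-{t}. t - s))) \<le> 0"
      by (simp add: poly_pcompose)
    moreover have "\<Lambda> (q\<^sup>2) = - (\<Sum>t\<in>T. f t * (poly q (- t))\<^sup>2 / (t * (\<Prod>s\<in>T-{t}. t - s)))"
      unfolding \<Lambda>_def sum_negf[symmetric] by (rule sum.cong) (auto simp: flip)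
    ultimately show ?case by simp
  next
    case (shifted q)
    have "degree (q \<circ>\<^sub>p [:0, - 1:]) < M"
      using shifted False by (simp add: degree_pcompose)
    moreover have "T \<subseteq> {0..}" using T by auto
    ultimately have "(\<Sum>t\<in>T. f t * (poly q (- t))\<^sup>2 / (\<Prod>s\<in>T-{t}. t - s)) \<ge> 0"
      using divided_difference_square_nonneg[OF f(1) T(1) _ T(3), of "q \<circ>\<^sub>p [:0, - 1:]"]
      by (simp add: poly_pcompose)
    moreover have "\<Lambda> (pCons 0 (q\<^sup>2)) = (\<Sum>t\<in>T. f t * (poly q (- t))\<^sup>2 / (\<Prod>s\<in>T-{t}. t - s))"
      unfolding \<Lambda>_def by (rule sum.cong) (use T in \<open>auto simp: flip\<close>)
    ultimately show ?case by simp
  next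
    case (add p r)
    then show ?case by (simp add: \<Lambda>_def add_divide_distrib distrib_left sum.distrib)
  qed
  also have "\<Lambda> P = (\<Sum>t\<in>T. c t * f t)"
    unfolding \<Lambda>_def
  proof (rule sum.cong)
    fix t assume t: "t \<in> T"
    have "poly P (- t) = c t * t * (\<Prod>s\<in>T-{t}. s - t)
        + (\<Sum>u\<in>T-{t}. c u * u * (\<Prod>s\<in>T-{u}. s + - t))"
      unfolding polyP by (subst sum.remove[OF T(1) t]) simp
    also have "(\<Sum>u\<in>T-{t}. c u * u * (\<Prod>s\<in>T-{u}. s + - t)) = 0"
      by (rule sum.neutral) (use T t in \<open>auto intro!: prod_zero bexI[of _ t]\<close>)
    finally have "poly P (- t) = c t * t * (\<Prod>s\<in>T-{t}. s - t)" by simp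
    moreover have "t \<noteq> 0" "(\<Prod>s\<in>T-{t}. s - t) \<noteq> 0" using T t by auto
    ultimately show "f t * poly P (- t) / (t * (\<Prod>s\<in>T-{t}. s - t)) = c t * f t" by simp
  qed simp
  finally show ?thesis .
qed

theorem operator_monotone_imp_dual:
  assumes f: "operator_monotone_on {0..} f" "f 0 \<ge> 0"
  shows "loewner_dual f"
  unfolding loewner_dual_def
proof (intro allI impI)
  fix T and c :: "real \<Rightarrow> real"
  assume T: "finite T" "T \<subseteq> {0<..}" and c: "\<forall>l\<ge>0. 0 \<le> (\<Sum>t\<in>T. c t * (t / (t + l)))"
  show "0 \<le> (\<Sum>t\<in>T. c t * f t)"
  proof (cases "even (card T)")
    case True
    then obtain M where "card T = 2 * M" by auto
    then show ?thesis using operator_monotone_imp_dual_even[OF f T] c by auto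
  next
    case False
    \<comment> \<open>An odd number of points is made even by one more point that carries the weight
      zero.\<close>
    obtain s where s: "s \<in> {0<..}" "s \<notin> T"
      using T(1) infinite_Ioi[of "0::real"] by (metis subsetI finite_subset)
    define c' where "c' = c(s := 0)"
    have cs: "(\<Sum>t\<in>insert s T. c' t * u t) = (\<Sum>t\<in>T. c t * u t)" for u :: "real \<Rightarrow> real"
    proof -
      have "(\<Sum>t\<in>T. c' t * u t) = (\<Sum>t\<in>T. c t * u t)"
        using s by (intro sum.cong) (auto simp: c'_def)
      then show ?thesis using T s by (simp add: c'_def)
    qed
    have "even (card (insert s T))" using False T s by simp
    then obtain M where "card (insert s T) = 2 * M" by auto
    then have "0 \<le> (\<Sum>t\<in>insert s T. c' t * f t)"
    proof (rule operator_monotone_imp_dual_even[OF f, rotated 2])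
      show "finite (insert s T)" "insert s T \<subseteq> {0<..}" using T s by auto
      show "0 \<le> (\<Sum>t\<in>insert s T. c' t * (t / (t + l)))" if "l \<ge> 0" for l
        unfolding cs using c that by blast
    qed
    then show ?thesis by (simp only: cs)
  qed
qed

section \<open>Approximation by Stieltjes sums\<close>

text \<open>A discrete Stieltjes integral, given by the list of its pairs (weight, node). Adding an
  atom is then just \<open>Cons\<close>, whether or not the node already occurs, and the polymorphic
  type lets the same list act on real and on complex arguments.\<close>

definition pick_sum :: "(real \<times> real) list \<Rightarrow> 'a :: real_normed_field \<Rightarrow> 'a" where
  "pick_sum ws z = (\<Sum>(w, l)\<leftarrow>ws. of_real w * (z / (z + of_real l)))"

definition nonneg_weights :: "(real \<times> real) list \<Rightarrow> bool" where
  "nonneg_weights ws \<longleftrightarrow> (\<forall>(w, l) \<in> set ws. 0 \<le> w \<and> 0 \<le> l)"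

lemma pick_sum_Nil [simp]: "pick_sum [] z = 0"
  by (simp add: pick_sum_def)

lemma pick_sum_Cons [simp]: "pick_sum ((w, l) # ws) z = of_real w * (z / (z + of_real l)) + pick_sum ws z"
  by (simp add: pick_sum_def)

lemma nonneg_weights_Nil [simp]: "nonneg_weights []"
  by (simp add: nonneg_weights_def)

lemma nonneg_weights_Cons [simp]: "nonneg_weights ((w, l) # ws) \<longleftrightarrow> 0 \<le> w \<and> 0 \<le> l \<and> nonneg_weights ws"
  by (auto simp: nonneg_weights_def)

lemma pick_sum_scale: "pick_sum (map (\<lambda>(w, l). (s * w, l)) ws) z = of_real s * pick_sum ws z"
  by (induction ws) (auto simp: algebra_simps)

lemma nonneg_weights_scale: "s \<ge> 0 \<Longrightarrow> nonneg_weights ws \<Longrightarrow> nonneg_weights (map (\<lambda>(w, l). (s * w, l)) ws)"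
  by (auto simp: nonneg_weights_def)

lemma pick_sum_of_real: "pick_sum ws (of_real t) = of_real (pick_sum ws t)"
  by (induction ws) (auto simp flip: of_real_add of_real_mult of_real_divide)

lemma pick_sum_nonneg: "nonneg_weights ws \<Longrightarrow> t > 0 \<Longrightarrow> pick_sum ws (t :: real) \<ge> 0"
  by (induction ws) (auto intro!: add_nonneg_nonneg mult_nonneg_nonneg divide_nonneg_nonneg)

text \<open>A near-minimiser of the squared distance from \<open>f\<close> to the cone of all \<^const>\<open>pick_sum\<close>s
  yields an almost admissible dual functional; since \<open>f\<close> satisfies the dual inequalities,
  the distance must vanish.\<close>

theorem loewner_dual_approx:
  assumes dual: "loewner_dual f" and T: "finite T" "T \<subseteq> {0<..}" and \<epsilon>: "\<epsilon> > 0"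
  obtains ws where "nonneg_weights ws" "\<And>t. t \<in> T \<Longrightarrow> \<bar>pick_sum ws t - f t\<bar> < \<epsilon>"
proof -
  define E where "E ws = (\<Sum>t\<in>T. (pick_sum ws t - f t)\<^sup>2)" for ws
  define d where "d = Inf (E ` Collect nonneg_weights)"
  have E0: "E ws \<ge> 0" for ws by (simp add: E_def sum_nonneg)
  have bdd: "bdd_below (E ` Collect nonneg_weights)" using E0 by (auto intro!: bdd_belowI)
  have ne: "E ` Collect nonneg_weights \<noteq> {}" using nonneg_weights_Nil by blast
  have dE: "d \<le> E ws" if "nonneg_weights ws" for ws
    unfolding d_def using bdd that by (intro cInf_lower) auto
  have near: "\<exists>ws. nonneg_weights ws \<and> E ws < d + \<eta>" if "\<eta> > 0" for \<eta>
    using cInf_lessD[OF ne, of "d + \<eta>"] that by (auto simp: d_def)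
  have "d \<le> 0"
  proof (rule ccontr)
    assume "\<not> d \<le> 0"
    then have d: "d > 0" by simp
    have Tne: "T \<noteq> {}"
    proof
      assume "T = {}"
      then show False using dE[of "[]"] d by (simp add: E_def)
    qed
    \<comment> \<open>The kernels \<open>(1 + l) * (t / (t + l))\<close> lie between
      \<open>min 1 t\<close> and \<open>max 1 t\<close> for every \<open>l\<close>; \<open>m\<close>
      and \<open>U\<close> are the resulting uniform bounds for their sums and sums of squares.
      \<open>R\<close> bounds the squares of the near-minimiser, \<kappa> is the correction that
      makes the functional admissible, and \<open>C\<close> collects all errors of order
      \<sigma>.\<close>
    define U where "U = (\<Sum>t\<in>T. (max 1 t)\<^sup>2)"
    define m where "m = (\<Sum>t\<in>T. min 1 t)"
    define R where "R = 2 * (d + 1) + 2 * (\<Sum>t\<in>T. (f t)\<^sup>2)"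
    define \<kappa> where "\<kappa> = (1 + U) / (2 * m)"
    define C where "C = (1 + R) / 2 + \<kappa> * \<bar>\<Sum>t\<in>T. f t\<bar>"
    have m: "m > 0" unfolding m_def using T Tne by (intro sum_pos) auto
    have U: "U \<ge> 0" by (simp add: U_def sum_nonneg)
    have R: "R \<ge> 0" using d by (simp add: R_def sum_nonneg)
    have \<kappa>: "\<kappa> \<ge> 0" using m U by (simp add: \<kappa>_def)
    have C: "C \<ge> 0" using R \<kappa> by (simp add: C_def)
    define \<sigma> where "\<sigma> = min 1 (d / (2 * (C + 1)))"
    have \<sigma>: "0 < \<sigma>" "\<sigma> \<le> 1" "\<sigma> * C < d"
    proof -
      show "0 < \<sigma>" using d C by (simp add: \<sigma>_def)
      show "\<sigma> \<le> 1" by (simp add: \<sigma>_def)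
      have "\<sigma> * C \<le> d / (2 * (C + 1)) * C" using C by (intro mult_right_mono) (auto simp: \<sigma>_def)
      also have "\<dots> < d" using d C mult_nonneg_nonneg[of C d] by (simp add: field_simps add_nonneg_pos)
      finally show "\<sigma> * C < d" .
    qed
    obtain ws where ws: "nonneg_weights ws" "E ws < d + \<sigma>\<^sup>2" using near[of "\<sigma>\<^sup>2"] \<sigma> by auto
    define r where "r t = pick_sum ws t" for t :: real
    define c where "c t = r t - f t" for t
    have Ec: "E ws = (\<Sum>t\<in>T. (c t)\<^sup>2)" by (simp add: E_def c_def r_def)
    \<comment> \<open>Adding \<sigma> times a normalised kernel stays in the cone and cannot bring
      the distance below \<open>d\<close>. As \<open>ws\<close> is optimal up to the square of
      \<sigma>, the derivative in this direction is at least a negative multiple of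
      \<sigma>.\<close>
    have grad: "(\<Sum>t\<in>T. c t * ((1 + l) * (t / (t + l)))) \<ge> - (\<sigma> * (1 + U) / 2)" if l: "l \<ge> 0" for l
    proof -
      define u where "u t = (1 + l) * (t / (t + l))" for t
      have u: "0 \<le> u t" "u t \<le> max 1 t" if "t \<in> T" for t
      proof -
        have t: "t > 0" using that T by auto
        then show "0 \<le> u t" using l by (simp add: u_def)
        have "(1 + l) * t \<le> max 1 t * (t + l)"
        proof (cases "t \<le> 1")
          case True
          then show ?thesis using l mult_left_mono[OF True l] by (simp add: max_def algebra_simps)
        next
          case False
          then show ?thesis using t by (simp add: max_def algebra_simps)
        qed
        then show "u t \<le> max 1 t" using t l by (simp add: u_def pos_divide_le_eq)
      qed
      have "(\<Sum>t\<in>T. (u t)\<^sup>2) \<le> U" unfolding U_def using u by (intro sum_mono power_mono) auto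
      have "d \<le> E ((\<sigma> * (1 + l), l) # ws)" using ws(1) l \<sigma> by (intro dE) auto
      also have "\<dots> = (\<Sum>t\<in>T. (c t + \<sigma> * u t)\<^sup>2)"
        by (simp add: E_def c_def r_def u_def algebra_simps)
      also have "\<dots> = E ws + 2 * \<sigma> * (\<Sum>t\<in>T. c t * u t) + \<sigma>\<^sup>2 * (\<Sum>t\<in>T. (u t)\<^sup>2)"
        by (simp add: Ec power2_sum power_mult_distrib sum.distrib sum_distrib_left mult_ac)
      also have "\<dots> \<le> d + \<sigma>\<^sup>2 + 2 * \<sigma> * (\<Sum>t\<in>T. c t * u t) + \<sigma>\<^sup>2 * U"
        using ws(2) \<open>(\<Sum>t\<in>T. (u t)\<^sup>2) \<le> U\<close> \<sigma>(1) by (intro add_mono mult_left_mono) auto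
      finally have "0 \<le> \<sigma> * (\<sigma> * (1 + U) + 2 * (\<Sum>t\<in>T. c t * u t))"
        by (simp add: algebra_simps power2_eq_square)
      then have "0 \<le> \<sigma> * (1 + U) + 2 * (\<Sum>t\<in>T. c t * u t)"
        using \<sigma> by (simp add: zero_le_mult_iff)
      then show ?thesis by (simp add: u_def)
    qed
    \<comment> \<open>The same first-order argument in the opposite direction: scaling all weights
      by \<open>1 - \<sigma>\<close> also stays in the cone.\<close>
    have cr: "(\<Sum>t\<in>T. c t * r t) \<le> \<sigma> * (1 + R) / 2"
    proof -
      have "(\<Sum>t\<in>T. (r t)\<^sup>2) \<le> (\<Sum>t\<in>T. 2 * (c t)\<^sup>2 + 2 * (f t)\<^sup>2)"
      proof (rule sum_mono)
        fix t
        have "2 * (c t)\<^sup>2 + 2 * (f t)\<^sup>2 - (r t)\<^sup>2 = (c t - f t)\<^sup>2"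
          by (simp add: c_def power2_eq_square algebra_simps)
        then show "(r t)\<^sup>2 \<le> 2 * (c t)\<^sup>2 + 2 * (f t)\<^sup>2"
          by (metis diff_ge_0_iff_ge zero_le_power2)
      qed
      also have "\<dots> = 2 * E ws + 2 * (\<Sum>t\<in>T. (f t)\<^sup>2)"
        by (simp add: Ec sum.distrib sum_distrib_left)
      also have "\<dots> \<le> R"
        using ws(2) \<sigma> power_le_one[of \<sigma> 2] by (simp add: R_def)
      finally have rR: "(\<Sum>t\<in>T. (r t)\<^sup>2) \<le> R" .
      have "d \<le> E (map (\<lambda>(w, l). ((1 - \<sigma>) * w, l)) ws)"
        using ws(1) \<sigma> by (intro dE nonneg_weights_scale) auto
      also have "\<dots> = (\<Sum>t\<in>T. (c t - \<sigma> * r t)\<^sup>2)"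
        unfolding E_def pick_sum_scale c_def r_def by (simp add: algebra_simps)
      also have "\<dots> = E ws - 2 * \<sigma> * (\<Sum>t\<in>T. c t * r t) + \<sigma>\<^sup>2 * (\<Sum>t\<in>T. (r t)\<^sup>2)"
        by (simp add: Ec power2_diff power_mult_distrib sum.distrib sum_subtractf sum_distrib_left mult_ac)
      also have "\<dots> \<le> d + \<sigma>\<^sup>2 - 2 * \<sigma> * (\<Sum>t\<in>T. c t * r t) + \<sigma>\<^sup>2 * R"
        using ws(2) rR \<sigma>(1) by (intro add_mono diff_mono mult_left_mono) auto
      finally have "0 \<le> \<sigma> * (\<sigma> * (1 + R) - 2 * (\<Sum>t\<in>T. c t * r t))"
        by (simp add: algebra_simps power2_eq_square)
      then have "0 \<le> \<sigma> * (1 + R) - 2 * (\<Sum>t\<in>T. c t * r t)"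
        using \<sigma> by (simp add: zero_le_mult_iff)
      then show ?thesis by simp
    qed
    have "0 \<le> (\<Sum>t\<in>T. (c t + \<kappa> * \<sigma>) * (t / (t + l)))" if l: "l \<ge> 0" for l
    proof -
      have "m \<le> (\<Sum>t\<in>T. (1 + l) * (t / (t + l)))"
        unfolding m_def
      proof (rule sum_mono)
        fix t assume "t \<in> T"
        then have "t > 0" using T by auto
        then show "min 1 t \<le> (1 + l) * (t / (t + l))"
          using l mult_left_mono[of 1 t l] by (auto simp: field_simps min_def)
      qed
      then have "\<kappa> * \<sigma> * m \<le> \<kappa> * \<sigma> * (\<Sum>t\<in>T. (1 + l) * (t / (t + l)))"
        using \<kappa> \<sigma> by (intro mult_left_mono) auto
      moreover have "\<kappa> * \<sigma> * m = \<sigma> * (1 + U) / 2" using m by (simp add: \<kappa>_def)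
      ultimately have "0 \<le> (\<Sum>t\<in>T. c t * ((1 + l) * (t / (t + l)))) + \<kappa> * \<sigma> * (\<Sum>t\<in>T. (1 + l) * (t / (t + l)))"
        using grad[OF l] by linarith
      also have "\<dots> = (1 + l) * (\<Sum>t\<in>T. (c t + \<kappa> * \<sigma>) * (t / (t + l)))"
        unfolding sum_distrib_left sum.distrib[symmetric] by (rule sum.cong) (auto simp: algebra_simps add_divide_distrib)
      finally show ?thesis using l by (simp add: zero_le_mult_iff)
    qed
    then have "0 \<le> (\<Sum>t\<in>T. (c t + \<kappa> * \<sigma>) * f t)"
      by (rule loewner_dualD[OF dual T])
    \<comment> \<open>Since f = r - c, the functional at \<open>f\<close> is about -E and hence at
      most -d up to multiples of \<sigma>, against its nonnegativity.\<close>
    also have "\<dots> = (\<Sum>t\<in>T. c t * r t) - E ws + \<sigma> * (\<kappa> * (\<Sum>t\<in>T. f t))"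
      unfolding Ec sum_distrib_left sum.distrib[symmetric] sum_subtractf[symmetric]
      by (rule sum.cong) (auto simp: c_def power2_eq_square algebra_simps)
    also have "\<dots> \<le> \<sigma> * (1 + R) / 2 - d + \<sigma> * (\<kappa> * \<bar>\<Sum>t\<in>T. f t\<bar>)"
      using cr dE[OF ws(1)] \<kappa> \<sigma> by (intro add_mono diff_mono mult_left_mono) auto
    also have "\<dots> = \<sigma> * C - d" by (simp add: C_def algebra_simps add_divide_distrib)
    finally show False using \<sigma>(3) by simp
  qed
  then obtain ws where ws: "nonneg_weights ws" "E ws < \<epsilon>\<^sup>2"
    using near[of "\<epsilon>\<^sup>2"] \<epsilon> by force
  have "\<bar>pick_sum ws t - f t\<bar> < \<epsilon>" if "t \<in> T" for t
  proof -
    have "(pick_sum ws t - f t)\<^sup>2 \<le> E ws"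
      unfolding E_def using T that by (intro member_le_sum) auto
    then have "\<bar>pick_sum ws t - f t\<bar>\<^sup>2 < \<epsilon>\<^sup>2" using ws by simp
    then show ?thesis using \<epsilon> by (simp add: power2_less_imp_less)
  qed
  then show ?thesis using that ws by blast
qed

section \<open>Monotonicity and continuity of functions in the dual cone\<close>

lemma loewner_dual_nonneg:
  assumes "loewner_dual f" "t > 0" shows "f t \<ge> 0"
proof -
  have "0 \<le> (\<Sum>s\<in>{t}. 1 * f s)"
    by (rule loewner_dualD[OF assms(1)]) (use assms(2) in auto)
  then show ?thesis by simp
qed

lemma loewner_dual_two_points:
  assumes "loewner_dual f" "s > 0" "t > 0" "s \<noteq> t"
    and "\<And>l. l \<ge> 0 \<Longrightarrow> 0 \<le> a * (s / (s + l)) + b * (t / (t + l))"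
  shows "0 \<le> a * f s + b * f t"
proof -
  define c where "c x = (if x = s then a else b)" for x
  have "0 \<le> (\<Sum>x\<in>{s, t}. c x * f x)"
    by (rule loewner_dualD[OF assms(1)]) (use assms in \<open>auto simp: c_def\<close>)
  then show ?thesis using assms(4) by (simp add: c_def)
qed

lemma loewner_dual_mono:
  assumes "loewner_dual f" "0 < s" "s \<le> t"
  shows "f s \<le> f t"
proof (cases "s = t")
  case False
  have "0 \<le> (- 1) * f s + 1 * f t"
  proof (rule loewner_dual_two_points[OF assms(1)])
    fix l :: real assume l: "l \<ge> 0"
    have "l / (t + l) \<le> l / (s + l)" using assms l by (intro divide_left_mono) auto
    moreover have "x / (x + l) = 1 - l / (x + l)" if "x > 0" for x using that l by (simp add: field_simps)
    ultimately show "0 \<le> - 1 * (s / (s + l)) + 1 * (t / (t + l))" using assms by simp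
  qed (use assms False in auto)
  then show ?thesis by simp
qed simp

lemma loewner_dual_decreasing_quotient:
  assumes "loewner_dual f" "0 < s" "s \<le> t"
  shows "s * f t \<le> t * f s"
proof (cases "s = t")
  case False
  have "0 \<le> t * f s + (- s) * f t"
  proof (rule loewner_dual_two_points[OF assms(1)])
    fix l :: real assume l: "l \<ge> 0"
    have "s * t / (t + l) \<le> s * t / (s + l)" using assms l by (intro divide_left_mono) auto
    then show "0 \<le> t * (s / (s + l)) + - s * (t / (t + l))" by (simp add: mult_ac)
  qed (use assms False in auto)
  then show ?thesis by simp
qed simp

text \<open>As \<open>f\<close> increases and f(t)/t decreases, \<open>f t\<close> is squeezed
  between \<open>min 1 (t / s) * f s\<close> and \<open>max 1 (t / s) * f s\<close>.\<close>

lemma loewner_dual_continuous: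
  assumes "loewner_dual f" shows "continuous_on {0<..} f"
proof -
  have "isCont f s" if s: "s > 0" for s
  proof -
    have bounds: "min 1 (t / s) * f s \<le> f t \<and> f t \<le> max 1 (t / s) * f s" if t: "t > 0" for t
    proof (cases "t \<le> s")
      case True
      have "t * f s \<le> s * f t" "f t \<le> f s"
        using loewner_dual_decreasing_quotient[OF assms t True] loewner_dual_mono[OF assms t True] by auto
      then show ?thesis using True s by (simp add: min_def max_def field_simps)
    next
      case False
      have "s * f t \<le> t * f s" "f s \<le> f t"
        using loewner_dual_decreasing_quotient[OF assms s, of t] loewner_dual_mono[OF assms s, of t] False by auto
      then show ?thesis using False s by (auto simp: min_def max_def field_simps)
    qed
    have ev: "\<forall>\<^sub>F t in at s. t > 0"
      using s order_tendstoD(1)[OF tendsto_ident_at, of 0 s UNIV] by simp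
    have "(f \<longlongrightarrow> f s) (at s)"
    proof (rule tendsto_sandwich)
      show "\<forall>\<^sub>F t in at s. min 1 (t / s) * f s \<le> f t" "\<forall>\<^sub>F t in at s. f t \<le> max 1 (t / s) * f s"
        using ev bounds by (auto elim!: eventually_mono)
      have "((\<lambda>t. min 1 (t / s) * f s) \<longlongrightarrow> min 1 (s / s) * f s) (at s)"
           "((\<lambda>t. max 1 (t / s) * f s) \<longlongrightarrow> max 1 (s / s) * f s) (at s)"
        using s by (intro tendsto_intros; simp)+
      then show "((\<lambda>t. min 1 (t / s) * f s) \<longlongrightarrow> f s) (at s)" "((\<lambda>t. max 1 (t / s) * f s) \<longlongrightarrow> f s) (at s)"
        using s by simp_all
    qed
    then show ?thesis by (simp add: isCont_def)
  qed
  then show ?thesis by (intro continuous_at_imp_continuous_on) auto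
qed

text \<open>Each kernel is 1 - l/(t + l), a constant minus a multiple of a resolvent. The shift
  \<delta> keeps the denominators positive also for \<open>l = 0\<close> and eigenvalue 0.\<close>

lemma pick_sum_operator_monotone:
  assumes U: "U \<in> carrier_mat n n" "unitary U" and V: "V \<in> carrier_mat n n" "unitary V"
    and le: "loewner_le (diagonalised n U d) (diagonalised n V e)"
    and pos: "\<And>k. k < n \<Longrightarrow> d k \<ge> 0" "\<And>k. k < n \<Longrightarrow> e k \<ge> 0" and \<delta>: "\<delta> > 0"
    and v: "v \<in> carrier_vec n" and ws: "nonneg_weights ws"
  shows "(\<Sum>k<n. pick_sum ws (d k + \<delta>) * (cmod (eigencoef n U v k))\<^sup>2)
    \<le> (\<Sum>k<n. pick_sum ws (e k + \<delta>) * (cmod (eigencoef n V v k))\<^sup>2)"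
  using ws
proof (induction ws)
  case (Cons p ws)
  obtain w l where p: "p = (w, l)" by force
  with Cons have wl: "w \<ge> 0" "l \<ge> 0" by auto
  have frac: "(\<Sum>k<n. (g k + \<delta>) / (g k + \<delta> + l) * (cmod (eigencoef n W v k))\<^sup>2)
      = (\<Sum>k<n. (cmod (eigencoef n W v k))\<^sup>2) - l * (\<Sum>k<n. (cmod (eigencoef n W v k))\<^sup>2 / (g k + (\<delta> + l)))"
    if "\<And>k. k < n \<Longrightarrow> g k \<ge> 0" for g :: "nat \<Rightarrow> real" and W
  proof -
    have "(g k + \<delta>) / (g k + \<delta> + l) = 1 - l / (g k + (\<delta> + l))" if "k < n" for k
      using \<delta> wl \<open>\<And>k. k < n \<Longrightarrow> g k \<ge> 0\<close>[OF that] by (simp add: field_simps add_pos_nonneg)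
    then show ?thesis by (simp add: left_diff_distrib sum_subtractf sum_distrib_left)
  qed
  have "(\<Sum>k<n. (cmod (eigencoef n V v k))\<^sup>2 / (e k + (\<delta> + l))) \<le> (\<Sum>k<n. (cmod (eigencoef n U v k))\<^sup>2 / (d k + (\<delta> + l)))"
    by (rule resolvent_antitone[OF U V le]) (use pos \<delta> wl v in \<open>auto intro: add_nonneg_pos\<close>)
  from mult_left_mono[OF this wl(2)]
  have "(\<Sum>k<n. (d k + \<delta>) / (d k + \<delta> + l) * (cmod (eigencoef n U v k))\<^sup>2)
      \<le> (\<Sum>k<n. (e k + \<delta>) / (e k + \<delta> + l) * (cmod (eigencoef n V v k))\<^sup>2)"
    using frac[of d U, OF pos(1)] frac[of e V, OF pos(2)] eigencoef_norm[OF U V, of v]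
    by linarith
  then have "w * (\<Sum>k<n. (d k + \<delta>) / (d k + \<delta> + l) * (cmod (eigencoef n U v k))\<^sup>2)
      \<le> w * (\<Sum>k<n. (e k + \<delta>) / (e k + \<delta> + l) * (cmod (eigencoef n V v k))\<^sup>2)"
    using wl by (intro mult_left_mono)
  with Cons p show ?case
    by (simp add: distrib_right sum.distrib sum_distrib_left mult.assoc)
qed simp

text \<open>For given matrices only the finitely many shifted eigenvalues matter, so approximation
  at finitely many points suffices. The shift keeps these points inside the open half-line.\<close>

lemma loewner_dual_shifted_monotone:
  assumes f: "loewner_dual f"
    and U: "U \<in> carrier_mat n n" "unitary U" and V: "V \<in> carrier_mat n n" "unitary V"
    and le: "loewner_le (diagonalised n U d) (diagonalised n V e)"
    and pos: "\<And>k. k < n \<Longrightarrow> d k \<ge> 0" "\<And>k. k < n \<Longrightarrow> e k \<ge> 0" and \<delta>: "\<delta> > 0"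
    and v: "v \<in> carrier_vec n"
  shows "(\<Sum>k<n. f (d k + \<delta>) * (cmod (eigencoef n U v k))\<^sup>2)
    \<le> (\<Sum>k<n. f (e k + \<delta>) * (cmod (eigencoef n V v k))\<^sup>2)" (is "?L \<le> ?R")
proof (rule field_le_epsilon)
  define a where "a k = (cmod (eigencoef n U v k))\<^sup>2" for k
  define b where "b k = (cmod (eigencoef n V v k))\<^sup>2" for k
  define N where "N = (\<Sum>k<n. a k) + (\<Sum>k<n. b k) + 1"
  have N: "N > 0" by (simp add: N_def a_def b_def add_nonneg_pos sum_nonneg)
  fix \<epsilon> :: real assume \<epsilon>: "\<epsilon> > 0"
  define \<eta> where "\<eta> = \<epsilon> / N"
  have \<eta>: "\<eta> > 0" using \<epsilon> N by (simp add: \<eta>_def)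
  define T where "T = (\<lambda>k. d k + \<delta>) ` {..<n} \<union> (\<lambda>k. e k + \<delta>) ` {..<n}"
  have "finite T" "T \<subseteq> {0<..}" using pos \<delta> by (auto simp: T_def intro: add_nonneg_pos)
  then obtain ws where ws: "nonneg_weights ws" and ap: "\<And>t. t \<in> T \<Longrightarrow> \<bar>pick_sum ws t - f t\<bar> < \<eta>"
    using loewner_dual_approx[OF f _ _ \<eta>] by metis
  have "?L \<le> (\<Sum>k<n. (pick_sum ws (d k + \<delta>) + \<eta>) * a k)"
    unfolding a_def
  proof (intro sum_mono mult_right_mono)
    fix k assume "k \<in> {..<n}"
    then show "f (d k + \<delta>) \<le> pick_sum ws (d k + \<delta>) + \<eta>" using ap[of "d k + \<delta>"] by (auto simp: T_def)
  qed simp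
  also have "\<dots> = (\<Sum>k<n. pick_sum ws (d k + \<delta>) * a k) + \<eta> * (\<Sum>k<n. a k)"
    by (simp add: distrib_right sum.distrib sum_distrib_left)
  also have "(\<Sum>k<n. pick_sum ws (d k + \<delta>) * a k) \<le> (\<Sum>k<n. pick_sum ws (e k + \<delta>) * b k)"
    unfolding a_def b_def by (rule pick_sum_operator_monotone[OF U V le pos \<delta> v ws])
  also have "(\<Sum>k<n. pick_sum ws (e k + \<delta>) * b k) \<le> (\<Sum>k<n. (f (e k + \<delta>) + \<eta>) * b k)"
    unfolding b_def
  proof (intro sum_mono mult_right_mono)
    fix k assume "k \<in> {..<n}"
    then show "pick_sum ws (e k + \<delta>) \<le> f (e k + \<delta>) + \<eta>" using ap[of "e k + \<delta>"] by (auto simp: T_def)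
  qed simp
  also have "\<dots> = ?R + \<eta> * (\<Sum>k<n. b k)"
    by (simp add: distrib_right sum.distrib sum_distrib_left b_def)
  finally have "?L \<le> ?R + \<eta> * ((\<Sum>k<n. a k) + (\<Sum>k<n. b k))" by (simp add: distrib_left)
  also have "\<eta> * ((\<Sum>k<n. a k) + (\<Sum>k<n. b k)) \<le> \<eta> * N"
    using \<eta> by (intro mult_left_mono) (auto simp: N_def)
  also have "\<eta> * N = \<epsilon>" using N by (simp add: \<eta>_def)
  finally show "?L \<le> ?R + \<epsilon>" by simp
qed

text \<open>The value at 0 is the infimum, which by monotonicity is the right limit. Continuity of
  the extension then allows the shift to tend to 0.\<close>

theorem loewner_dual_imp_operator_monotone:
  assumes f: "loewner_dual f"
  obtains f' where "operator_monotone_on {0..} f'" "\<And>t. t > 0 \<Longrightarrow> f' t = f t"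
proof -
  define L where "L = Inf (f ` {0<..})"
  define f' where "f' t = (if t > 0 then f t else L)" for t
  have bdd: "bdd_below (f ` {0<..})" using loewner_dual_nonneg[OF f] by (auto intro!: bdd_belowI[of _ 0])
  have Lle: "L \<le> f t" if "t > 0" for t unfolding L_def using bdd that by (intro cInf_lower) auto
  have cont_pos: "continuous (at t within {0..}) f'" if t: "t > 0" for t
  proof -
    have "isCont f t" using loewner_dual_continuous[OF f] t by (simp add: continuous_on_eq_continuous_at)
    moreover have "\<forall>\<^sub>F s in nhds t. f' s = f s"
      using eventually_nhds_in_open[of "{0<..}" t] t by (auto elim!: eventually_mono simp: f'_def)
    ultimately have "isCont f' t" by (subst isCont_cong)
    then show ?thesis by (rule continuous_at_imp_continuous_at_within)
  qed
  have cont_0: "continuous (at 0 within {0..}) f'"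
    unfolding continuous_within_eps_delta
  proof (intro allI impI)
    fix e :: real assume e: "e > 0"
    have "\<exists>y\<in>f ` {0<..}. y < L + e" using e bdd by (intro cInf_lessD) (auto simp: L_def)
    then obtain s where s: "s > 0" "f s < L + e" by auto
    have "dist (f' t) (f' 0) < e" if "t \<in> {0..}" "dist t 0 < s" for t
    proof (cases "t > 0")
      case True
      then have "f t \<le> f s" using that by (intro loewner_dual_mono[OF f]) auto
      then show ?thesis using True s Lle[OF True] by (simp add: f'_def dist_real_def)
    qed (use e in \<open>simp add: f'_def\<close>)
    then show "\<exists>d>0. \<forall>t\<in>{0..}. dist t 0 < d \<longrightarrow> dist (f' t) (f' 0) < e" using s(1) by blast
  qed
  have cont: "continuous_on {0..} f'"
    unfolding continuous_on_eq_continuous_within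
  proof
    fix t :: real assume "t \<in> {0..}"
    then show "continuous (at t within {0..}) f'" using cont_0 cont_pos by (cases "t = 0") auto
  qed
  have lim: "((\<lambda>\<delta>. f' (t + \<delta>)) \<longlongrightarrow> f' t) (at_right 0)" if t: "t \<ge> 0" for t
  proof -
    have "continuous_on {0..} (\<lambda>\<delta>. f' (t + \<delta>))"
      by (rule continuous_on_compose2[OF cont]) (use t in \<open>auto intro!: continuous_intros\<close>)
    then have "((\<lambda>\<delta>. f' (t + \<delta>)) \<longlongrightarrow> f' (t + 0)) (at 0 within {0..})"
      unfolding continuous_on_def by blast
    then show ?thesis by (auto intro: tendsto_within_subset)
  qed
  have "operator_monotone_on {0..} f'"
  proof (rule operator_monotone_onI[OF cont])
    fix n U V d e and v :: "complex vec"
    assume U: "U \<in> carrier_mat n n" "unitary U" and V: "V \<in> carrier_mat n n" "unitary V"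
      and d: "\<And>k. k < n \<Longrightarrow> d k \<in> {0..}" and e: "\<And>k. k < n \<Longrightarrow> e k \<in> {0..}"
      and le: "loewner_le (diagonalised n U d) (diagonalised n V e)" and v: "v \<in> carrier_vec n"
    have lims: "((\<lambda>\<delta>. \<Sum>k<n. f' (g k + \<delta>) * (cmod (eigencoef n W v k))\<^sup>2) \<longlongrightarrow> (\<Sum>k<n. f' (g k) * (cmod (eigencoef n W v k))\<^sup>2)) (at_right 0)"
      if "\<And>k. k < n \<Longrightarrow> g k \<in> {0..}" for g W
      by (intro tendsto_sum tendsto_mult tendsto_const lim) (use that in auto)
    have "\<forall>\<^sub>F \<delta> in at_right 0. (\<Sum>k<n. f' (d k + \<delta>) * (cmod (eigencoef n U v k))\<^sup>2)
        \<le> (\<Sum>k<n. f' (e k + \<delta>) * (cmod (eigencoef n V v k))\<^sup>2)"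
      using eventually_at_right_less
    proof eventually_elim
      case (elim \<delta>)
      have "f' (d k + \<delta>) = f (d k + \<delta>)" "f' (e k + \<delta>) = f (e k + \<delta>)" if "k < n" for k
        using elim d[OF that] e[OF that] by (auto simp: f'_def)
      then show ?case
        using loewner_dual_shifted_monotone[OF f U V le _ _ elim v] d e by simp
    qed
    then show "(\<Sum>k<n. f' (d k) * (cmod (eigencoef n U v k))\<^sup>2) \<le> (\<Sum>k<n. f' (e k) * (cmod (eigencoef n V v k))\<^sup>2)"
      by (intro tendsto_le[OF _ lims[OF e] lims[OF d]]) auto
  qed
  then show ?thesis using that[of f'] by (simp add: f'_def)
qed

section \<open>Analytic continuation to the slit plane\<close>

abbreviation slit_plane :: "complex set" where
  "slit_plane \<equiv> - \<real>\<^sub>\<le>\<^sub>0"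

lemma open_slit_plane: "open slit_plane"
  by (simp add: open_Compl)

lemma connected_slit_plane: "connected slit_plane"
proof -
  have "\<real>\<^sub>\<le>\<^sub>0 = complex_of_real ` {..0}" by (auto simp: nonpos_Reals_def)
  then show ?thesis
    using starlike_imp_connected[OF starlike_slotted_complex_plane_left[of 0]] by simp
qed

lemma slit_plane_Im: "Im z \<noteq> 0 \<Longrightarrow> z \<in> slit_plane"
  by (auto simp: complex_nonpos_Reals_iff)

lemma slit_plane_of_real: "complex_of_real t \<in> slit_plane \<longleftrightarrow> t > 0"
  by (auto simp: complex_nonpos_Reals_iff)

lemma slit_plane_cases:
  assumes "z \<in> slit_plane"
  obtains "Im z > 0" | "Im z < 0" | t where "t > 0" "z = complex_of_real t"
proof (cases "Im z = 0")
  case True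
  then have "z = complex_of_real (Re z)" by (simp add: complex_eq_iff)
  then show ?thesis using assms that(3) slit_plane_of_real by metis
next
  case False
  then show ?thesis using that by linarith
qed

lemma slit_plane_identity:
  assumes "\<phi> holomorphic_on slit_plane" "\<psi> holomorphic_on slit_plane"
    and "0 < s" "s < t" "\<And>x. s < x \<Longrightarrow> x < t \<Longrightarrow> \<phi> (of_real x) = \<psi> (of_real x)" "z \<in> slit_plane"
  shows "\<phi> z = \<psi> z"
proof -
  define m where "m = (s + t) / 2"
  have m: "s < m" "m < t" using assms by (auto simp: m_def)
  have "complex_of_real m islimpt complex_of_real ` {s<..<t}"
    unfolding islimpt_approachable
  proof (intro allI impI)
    fix e :: real assume e: "e > 0"
    define x where "x = m + min (e / 2) ((t - m) / 2)"
    have "s < x" "x < t" "x \<noteq> m" "\<bar>x - m\<bar> < e" using e m by (auto simp: x_def min_def field_simps)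
    then show "\<exists>x'\<in>complex_of_real ` {s<..<t}. x' \<noteq> of_real m \<and> dist x' (of_real m) < e"
      by (intro bexI[of _ "of_real x"]) (auto simp: dist_norm simp flip: of_real_diff)
  qed
  note limpt = this
  have "\<phi> z - \<psi> z = 0"
  proof (rule analytic_continuation[OF _ open_slit_plane connected_slit_plane _ _ limpt, of "\<lambda>z. \<phi> z - \<psi> z"])
    show "(\<lambda>z. \<phi> z - \<psi> z) holomorphic_on slit_plane" using assms by (intro holomorphic_on_diff)
    show "complex_of_real ` {s<..<t} \<subseteq> slit_plane" using assms(3) slit_plane_of_real by force
    have "m > 0" using assms(3) m by simp
    then show "complex_of_real m \<in> slit_plane" by (simp only: slit_plane_of_real)
    show "\<phi> w - \<psi> w = 0" if "w \<in> complex_of_real ` {s<..<t}" for w using that assms(5) by auto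
  qed (rule assms)
  then show ?thesis by simp
qed

lemma slit_plane_reflection:
  assumes "\<phi> holomorphic_on slit_plane" "\<And>t. t > 0 \<Longrightarrow> \<phi> (of_real t) \<in> \<real>" "z \<in> slit_plane"
  shows "\<phi> (cnj z) = cnj (\<phi> z)"
proof -
  have img: "cnj ` slit_plane = slit_plane"
  proof (intro equalityI subsetI)
    fix z assume "z \<in> slit_plane"
    then have "cnj z \<in> slit_plane" "z = cnj (cnj z)" by (auto simp: complex_nonpos_Reals_iff)
    then show "z \<in> cnj ` slit_plane" by blast
  qed (auto simp: complex_nonpos_Reals_iff)
  have hol: "(cnj \<circ> \<phi> \<circ> cnj) holomorphic_on slit_plane"
    using assms(1) holomorphic_on_compose_cnj_cnj[of \<phi> slit_plane] open_slit_plane by (simp add: img)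
  have real: "(cnj \<circ> \<phi> \<circ> cnj) (of_real t) = \<phi> (of_real t)" if "t > 0" for t
    using assms(2)[OF that] by (simp add: Reals_cnj_iff)
  have "(cnj \<circ> \<phi> \<circ> cnj) z = \<phi> z"
  proof (rule slit_plane_identity[OF hol assms(1) _ _ _ assms(3)])
    show "(cnj \<circ> \<phi> \<circ> cnj) (of_real x) = \<phi> (of_real x)" if "1 < x" "x < 2" for x
      using that by (intro real) simp
  qed simp_all
  then show ?thesis by (metis comp_apply complex_cnj_cnj)
qed

text \<open>The factor \<open>1 + l\<close> is the reciprocal of the kernel at 1, so the estimate
  compares a kernel at \<open>z\<close> with the same kernel at 1, uniformly in \<open>l\<close>.
  For small \<open>l\<close> the distance of \<open>K\<close> to the slit is used; for large
  \<open>l\<close> the denominator grows like \<open>l\<close>.\<close>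

lemma pick_kernel_bound:
  assumes "compact K" "K \<subseteq> slit_plane"
  obtains C where "\<And>z l. z \<in> K \<Longrightarrow> l \<ge> 0 \<Longrightarrow> cmod (z / (z + of_real l)) * (1 + l) \<le> C"
proof (cases "K = {}")
  case True
  then show ?thesis using that by auto
next
  case False
  define d where "d = setdist K (\<real>\<^sub>\<le>\<^sub>0)"
  have ne: "(\<real>\<^sub>\<le>\<^sub>0 :: complex set) \<noteq> {}" using nonpos_Reals_zero_I by (metis empty_iff)
  have "K \<inter> \<real>\<^sub>\<le>\<^sub>0 = {}" using assms(2) by blast
  then have d: "d > 0"
    unfolding d_def setdist_gt_0_compact_closed[OF assms(1) closed_nonpos_Reals_complex] using False ne by simp
  obtain M where M: "M > 0" "\<And>z. z \<in> K \<Longrightarrow> cmod z \<le> M"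
    using compact_imp_bounded[OF assms(1)] by (auto simp: bounded_pos)
  have "cmod (z / (z + of_real l)) * (1 + l) \<le> max (M / d * (2 + 2 * M)) (M * 4)" if z: "z \<in> K" and l: "l \<ge> 0" for z l
  proof -
    have "complex_of_real (- l) \<in> \<real>\<^sub>\<le>\<^sub>0" using l by (subst nonpos_Reals_of_real_iff) simp
    then have "d \<le> dist z (of_real (- l))" unfolding d_def by (rule setdist_le_dist[OF z])
    then have dl: "d \<le> cmod (z + of_real l)" by (simp add: dist_norm)
    show ?thesis
    proof (cases "l \<le> 2 * M + 1")
      case True
      have "cmod (z / (z + of_real l)) * (1 + l) = cmod z / cmod (z + of_real l) * (1 + l)"
        by (simp add: norm_divide)
      also have "\<dots> \<le> M / d * (2 + 2 * M)"
        using True l M z d dl by (intro mult_mono frac_le) auto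
      finally show ?thesis by simp
    next
      case False
      have "cmod (z + of_real l) \<ge> l - cmod z"
        using norm_triangle_ineq4[of "z + of_real l" z] l by simp
      then have "cmod (z + of_real l) \<ge> (1 + l) / 4" using M(2)[OF z] False M(1) by (simp add: field_simps)
      have "cmod (z / (z + of_real l)) * (1 + l) = cmod z / cmod (z + of_real l) * (1 + l)"
        by (simp add: norm_divide)
      also have "\<dots> \<le> M / ((1 + l) / 4) * (1 + l)"
        using \<open>cmod (z + of_real l) \<ge> (1 + l) / 4\<close> l M z by (intro mult_right_mono frac_le) auto
      also have "\<dots> = M * 4" using l by (simp add: field_simps)
      finally show ?thesis by simp
    qed
  qed
  then show ?thesis using that by blast
qed

lemma pick_sum_bound:
  assumes "nonneg_weights ws" "\<And>l. l \<ge> 0 \<Longrightarrow> cmod (z / (z + of_real l)) * (1 + l) \<le> C"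
  shows "cmod (pick_sum ws z) \<le> C * pick_sum ws 1"
  using assms(1)
proof (induction ws)
  case (Cons p ws)
  obtain w l where p: "p = (w, l)" by force
  with Cons have wl: "w \<ge> 0" "l \<ge> 0" by auto
  have "cmod (z / (z + of_real l)) \<le> C * (1 / (1 + l))"
    using assms(2)[OF wl(2)] wl by (simp add: field_simps)
  then have "w * cmod (z / (z + of_real l)) \<le> w * (C * (1 / (1 + l)))" using wl(1) by (rule mult_left_mono)
  moreover have "cmod (pick_sum (p # ws) z) \<le> w * cmod (z / (z + of_real l)) + cmod (pick_sum ws z)"
    unfolding p pick_sum_Cons using wl by (intro norm_triangle_le) (simp add: norm_mult del: times_divide_eq_right)
  ultimately show ?case using Cons p by (simp add: algebra_simps)
qed simp

lemma pick_sum_holomorphic: "nonneg_weights ws \<Longrightarrow> pick_sum ws holomorphic_on slit_plane"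
proof (induction ws)
  case (Cons p ws)
  obtain w l where p: "p = (w, l)" by force
  with Cons have wl: "w \<ge> 0" "l \<ge> 0" by auto
  have "z + of_real l \<noteq> 0" if "z \<in> slit_plane" for z :: complex
    using that wl by (auto simp: complex_nonpos_Reals_iff complex_eq_iff)
  then have "(\<lambda>z. of_real w * (z / (z + of_real l)) + pick_sum ws z) holomorphic_on slit_plane"
    using Cons p by (intro holomorphic_intros) auto
  then show ?case by (simp add: p)
next
  case Nil
  have "pick_sum [] = (\<lambda>z :: complex. 0)" by (rule ext) simp
  then show ?case by simp
qed

lemma pick_sum_Im_nonneg: "nonneg_weights ws \<Longrightarrow> Im z > 0 \<Longrightarrow> Im (pick_sum ws z) \<ge> 0"
proof (induction ws)
  case (Cons p ws)
  obtain w l where p: "p = (w, l)" by force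
  with Cons have wl: "w \<ge> 0" "l \<ge> 0" by auto
  have "Im (z / (z + of_real l)) = (Im z * l) / ((Re z + l)\<^sup>2 + (Im z)\<^sup>2)"
    by (simp add: Im_divide algebra_simps)
  also have "\<dots> \<ge> 0" using Cons wl by simp
  finally have "Im (of_real w * (z / (z + of_real l))) \<ge> 0"
    using wl by (simp del: times_divide_eq_right)
  then show ?case using Cons p by (simp del: times_divide_eq_right)
qed simp

text \<open>The approximants match \<open>f\<close> ever more closely on finite sets that exhaust
  the positive rationals. Their limit agrees with \<open>f\<close> at the rationals, and elsewhere
  on the half-line because both are continuous.\<close>

theorem loewner_dual_continuation:
  assumes f: "loewner_dual f"
  obtains \<phi> where "\<phi> holomorphic_on slit_plane" "\<And>t. t > 0 \<Longrightarrow> \<phi> (of_real t) = of_real (f t)"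
    "\<And>z. Im z > 0 \<Longrightarrow> Im (\<phi> z) \<ge> 0"
proof -
  \<comment> \<open>The point 1 always belongs to the set: the values there bound the whole family
    on compact sets by \<open>pick_sum_bound\<close>.\<close>
  define T where "T n = insert 1 ((\<lambda>i. real_of_rat (nat_to_rat_surj i)) ` {..n} \<inter> {0<..})" for n
  have T: "finite (T n)" "T n \<subseteq> {0<..}" for n by (auto simp: T_def)
  have ex: "\<exists>ws. nonneg_weights ws \<and> (\<forall>t\<in>T n. \<bar>pick_sum ws t - f t\<bar> < inverse (Suc n))" for n
  proof -
    have pos: "inverse (real (Suc n)) > 0" by simp
    obtain ws where "nonneg_weights ws" "\<And>t. t \<in> T n \<Longrightarrow> \<bar>pick_sum ws t - f t\<bar> < inverse (real (Suc n))"
      by (rule loewner_dual_approx[OF f T(1)[of n] T(2)[of n] pos]) (rule that)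
    then show ?thesis by blast
  qed
  have "\<exists>W. \<forall>n. nonneg_weights (W n) \<and> (\<forall>t\<in>T n. \<bar>pick_sum (W n) t - f t\<bar> < inverse (Suc n))"
    by (intro choice allI ex)
  then obtain ws where W: "\<forall>n. nonneg_weights (ws n) \<and> (\<forall>t\<in>T n. \<bar>pick_sum (ws n) t - f t\<bar> < inverse (Suc n))" ..
  then have ws: "\<And>n. nonneg_weights (ws n)" by simp
  have ap: "\<And>n t. t \<in> T n \<Longrightarrow> \<bar>pick_sum (ws n) t - f t\<bar> < inverse (Suc n)"
    using W by simp
  define H where "H = (pick_sum ` {ws. nonneg_weights ws \<and> pick_sum ws 1 \<le> f 1 + 1} :: (complex \<Rightarrow> complex) set)"
  have H1: "pick_sum (ws n) \<in> H" for n
  proof -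
    have "\<bar>pick_sum (ws n) 1 - f 1\<bar> < inverse (Suc n)" by (rule ap) (simp add: T_def)
    moreover have "inverse (real (Suc n)) \<le> 1" by (simp add: field_simps)
    ultimately have "pick_sum (ws n) 1 \<le> f 1 + 1" by linarith
    then show ?thesis unfolding H_def using ws by (intro imageI CollectI conjI)
  qed
  obtain g r where g: "g holomorphic_on slit_plane" and r: "strict_mono (r :: nat \<Rightarrow> nat)"
    and lim: "\<And>x. x \<in> slit_plane \<Longrightarrow> (\<lambda>n. pick_sum (ws (r n)) x) \<longlonglongrightarrow> g x"
  proof (rule Montel[OF open_slit_plane, of H "\<lambda>n. pick_sum (ws n)"])
    show "h holomorphic_on slit_plane" if "h \<in> H" for h
      using that pick_sum_holomorphic by (auto simp: H_def)
    show "\<exists>B. \<forall>h\<in>H. \<forall>z\<in>K. cmod (h z) \<le> B" if K: "compact K" "K \<subseteq> slit_plane" for K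
    proof -
      obtain C where C: "\<And>z l. z \<in> K \<Longrightarrow> l \<ge> 0 \<Longrightarrow> cmod (z / (z + of_real l)) * (1 + l) \<le> C"
        using pick_kernel_bound[OF K] by blast
      have "cmod (h z) \<le> \<bar>C\<bar> * (f 1 + 1)" if h: "h \<in> H" and z: "z \<in> K" for h z
      proof -
        obtain v where v: "h = pick_sum v" "nonneg_weights v" "pick_sum v 1 \<le> f 1 + 1"
          using h by (auto simp: H_def)
        have "cmod (h z) \<le> C * pick_sum v 1" unfolding v(1) using C[OF z] v(2) by (intro pick_sum_bound) auto
        also have "\<dots> \<le> \<bar>C\<bar> * (f 1 + 1)"
          using v pick_sum_nonneg[OF v(2), of 1] by (intro mult_mono) auto
        finally show ?thesis .
      qed
      then show ?thesis by blast
    qed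
    show "range (\<lambda>n. pick_sum (ws n)) \<subseteq> H" using H1 by auto
  qed (use that in blast)
  have g_rat: "g (of_real q) = of_real (f q)" if q: "q > 0" "q \<in> \<rat>" for q
  proof -
    obtain i where i: "q = real_of_rat (nat_to_rat_surj i)"
      using q(2) surj_nat_to_rat_surj by (metis Rats_cases surjE)
    have "(\<lambda>n. pick_sum (ws n) q - f q) \<longlonglongrightarrow> 0"
    proof (rule Lim_null_comparison[OF _ LIMSEQ_inverse_real_of_nat])
      show "\<forall>\<^sub>F n in sequentially. norm (pick_sum (ws n) q - f q) \<le> inverse (real (Suc n))"
        using eventually_ge_at_top[of i]
      proof eventually_elim
        case (elim n)
        then have "q \<in> T n" using i q by (auto simp: T_def)
        then show ?case using ap[of q n] by simp
      qed
    qed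
    then have "(\<lambda>n. pick_sum (ws n) q) \<longlonglongrightarrow> f q" by (rule LIM_zero_cancel)
    then have "(\<lambda>n. complex_of_real (pick_sum (ws n) q)) \<longlonglongrightarrow> of_real (f q)" by (rule tendsto_of_real)
    from LIMSEQ_subseq_LIMSEQ[OF this r]
    have "(\<lambda>n. pick_sum (ws (r n)) (complex_of_real q)) \<longlonglongrightarrow> of_real (f q)"
      by (simp add: o_def pick_sum_of_real)
    moreover have "(\<lambda>n. pick_sum (ws (r n)) (complex_of_real q)) \<longlonglongrightarrow> g (of_real q)"
      using q(1) by (intro lim) (simp only: slit_plane_of_real)
    ultimately show ?thesis by (rule LIMSEQ_unique[symmetric])
  qed
  have g_real: "g (of_real t) = of_real (f t)" if t: "t > 0" for t
  proof (rule ccontr)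
    define D where "D s = g (of_real s) - of_real (f s)" for s
    assume "g (of_real t) \<noteq> of_real (f t)"
    then have "D t \<noteq> 0" by (simp add: D_def)
    have "of_real ` {0<..} \<subseteq> slit_plane" using slit_plane_of_real by blast
    then have "continuous_on {0<..} (\<lambda>s. g (of_real s))"
      by (intro continuous_on_compose2[OF holomorphic_on_imp_continuous_on[OF g]] continuous_intros)
    then have "continuous_on {0<..} D"
      unfolding D_def by (intro continuous_on_diff continuous_on_of_real loewner_dual_continuous[OF f])
    then have "isCont D t" using t by (simp add: continuous_on_eq_continuous_at)
    then have "(D \<longlongrightarrow> D t) (nhds t)" by (simp add: isCont_def tendsto_at_iff_tendsto_nhds)
    then have "\<forall>\<^sub>F s in nhds t. D s \<noteq> 0" using \<open>D t \<noteq> 0\<close> by (rule tendsto_imp_eventually_ne)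
    moreover have "\<forall>\<^sub>F s in nhds t. s \<in> {0<..}" using t by (intro eventually_nhds_in_open) auto
    ultimately have "\<forall>\<^sub>F s in nhds t. D s \<noteq> 0 \<and> s > 0" by eventually_elim simp
    then obtain e where e: "e > 0" "\<And>s. dist s t < e \<Longrightarrow> D s \<noteq> 0 \<and> s > 0"
      by (auto simp: eventually_nhds_metric)
    obtain q where q: "q \<in> \<rat>" "t - e < q" "q < t" using Rats_dense_in_real[of "t - e" t] e by auto
    then have "D q \<noteq> 0 \<and> q > 0" using e(2)[of q] by (simp add: dist_real_def)
    then show False using g_rat[OF _ q(1)] by (simp add: D_def)
  qed
  have "Im (g z) \<ge> 0" if "Im z > 0" for z
  proof -
    have "(\<lambda>n. Im (pick_sum (ws (r n)) z)) \<longlonglongrightarrow> Im (g z)"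
      using that by (intro tendsto_Im lim slit_plane_Im) auto
    then show ?thesis
      by (rule LIMSEQ_le_const) (use pick_sum_Im_nonneg[OF ws that] in auto)
  qed
  then show ?thesis using that g g_real by blast
qed

section \<open>Quotients and arguments of Pick functions\<close>

text \<open>If the imaginary part vanished somewhere, the open image of the half-plane would contain
  points below the real axis.\<close>

lemma pick_Im_pos:
  assumes \<phi>: "\<phi> holomorphic_on slit_plane" "\<And>z. Im z > 0 \<Longrightarrow> Im (\<phi> z) \<ge> 0"
    and nc: "\<not> \<phi> constant_on slit_plane" and z: "Im z > 0"
  shows "Im (\<phi> z) > 0"
proof (rule ccontr)
  let ?U = "{z. Im z > 0}"
  assume "\<not> Im (\<phi> z) > 0"
  then have z0: "Im (\<phi> z) = 0" using \<phi>(2)[OF z] by simp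
  have "open (\<phi> ` ?U)"
  proof (rule open_mapping_thm[OF \<phi>(1) open_slit_plane connected_slit_plane _ _ nc])
    show "open ?U" by (rule open_halfspace_Im_gt)
    show "?U \<subseteq> slit_plane" using slit_plane_Im by fastforce
  qed
  moreover have "\<phi> z \<in> \<phi> ` ?U" using z by simp
  ultimately obtain e where e: "e > 0" "ball (\<phi> z) e \<subseteq> \<phi> ` ?U"
    by (meson open_contains_ball)
  have "\<phi> z - \<i> * of_real (e / 2) \<in> ball (\<phi> z) e"
    using e(1) by (simp add: dist_norm norm_mult)
  from subsetD[OF e(2) this]
  obtain w where w: "\<phi> z - \<i> * of_real (e / 2) = \<phi> w" "w \<in> ?U" by (rule imageE)
  have "Im (\<phi> w) < 0" unfolding w(1)[symmetric] using z0 e(1) by simp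
  moreover have "Im w > 0" using w(2) by simp
  ultimately show False using \<phi>(2)[of w] by simp
qed

lemma pick_constant_on_interval:
  assumes \<phi>: "\<phi> holomorphic_on slit_plane" "\<And>t. t > 0 \<Longrightarrow> \<phi> (of_real t) = of_real (f t)"
    and "0 < s" "s < t" "\<And>x. s < x \<Longrightarrow> x < t \<Longrightarrow> f x = c"
  shows "\<And>z. z \<in> slit_plane \<Longrightarrow> \<phi> z = of_real c" "\<And>x. x > 0 \<Longrightarrow> f x = c"
proof -
  show *: "\<phi> z = of_real c" if "z \<in> slit_plane" for z
    by (rule slit_plane_identity[OF \<phi>(1) holomorphic_on_const assms(3,4) _ that]) (use assms in simp)
  show "f x = c" if "x > 0" for x
  proof -
    have "of_real x \<in> slit_plane" using that by (simp only: slit_plane_of_real)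
    then show ?thesis using *[of "of_real x"] \<phi>(2)[OF that] by simp
  qed
qed

text \<open>Equal values at two points force, by monotonicity, a constant on the interval between
  them, and the identity theorem spreads it to the whole half-line.\<close>

lemma loewner_dual_strict_mono:
  assumes f: "loewner_dual f" and nc: "\<not> f constant_on {0<..}" and st: "0 < s" "s < t"
  shows "f s < f t"
proof (rule ccontr)
  assume "\<not> f s < f t"
  then have eq: "f s = f t" using loewner_dual_mono[OF f, of s t] st by simp
  obtain \<phi> where \<phi>: "\<phi> holomorphic_on slit_plane" "\<And>t. t > 0 \<Longrightarrow> \<phi> (of_real t) = of_real (f t)"
    using loewner_dual_continuation[OF f] by metis
  have "f x = f s" if "s < x" "x < t" for x
    using loewner_dual_mono[OF f, of s x] loewner_dual_mono[OF f, of x t] that st eq by simp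
  note const = this
  have "f x = f s" if "x > 0" for x
    by (rule pick_constant_on_interval(2)[OF \<phi> st const that])
  then have "f constant_on {0<..}" unfolding constant_on_def by (intro exI[of _ "f s"]) simp
  then show False using nc by contradiction
qed

text \<open>Meant for the removable singularity of a difference quotient, where no formula controls
  the value. By openness a nonpositive value c at \<open>a\<close> would make the smaller real
  number c - e/2 a value too, necessarily at a point other than \<open>a\<close>.\<close>

lemma avoids_nonpos_at_point:
  assumes Q: "Q holomorphic_on S" and S: "open S" "connected S" "a \<in> S"
    and avoid: "\<And>z. z \<in> S \<Longrightarrow> z \<noteq> a \<Longrightarrow> Q z \<notin> \<real>\<^sub>\<le>\<^sub>0"
  shows "Q a \<notin> \<real>\<^sub>\<le>\<^sub>0"
proof
  assume "Q a \<in> \<real>\<^sub>\<le>\<^sub>0"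
  then obtain c where c: "Q a = of_real c" "c \<le> 0" by (auto elim: nonpos_Reals_cases)
  have "\<not> Q constant_on S"
  proof
    assume "Q constant_on S"
    then obtain k where k: "\<And>x. x \<in> S \<Longrightarrow> Q x = k" unfolding constant_on_def by blast
    have "S \<noteq> {a}" using S(1) not_open_singleton[of a] by auto
    then obtain b where "b \<in> S" "b \<noteq> a" using S(3) by blast
    then show False using avoid[of b] \<open>Q a \<in> \<real>\<^sub>\<le>\<^sub>0\<close> S(3) k[of a] k[of b] by simp
  qed
  then have "open (Q ` S)" by (rule open_mapping_thm[OF Q S(1,2) S(1) subset_refl])
  then obtain e where e: "e > 0" "ball (Q a) e \<subseteq> Q ` S"
    using S(3) by (meson imageI open_contains_ball)
  have "complex_of_real (c - e / 2) \<in> ball (Q a) e"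
    using e(1) by (simp add: c dist_norm flip: of_real_diff)
  from subsetD[OF e(2) this]
  obtain z where "of_real (c - e / 2) = Q z" and z1: "z \<in> S" by (rule imageE)
  then have z: "z \<in> S" "Q z = of_real (c - e / 2)" by simp_all
  then have "z \<noteq> a" using c e(1) by auto
  moreover have "Q z \<in> \<real>\<^sub>\<le>\<^sub>0" unfolding z(2) using c e(1) by (subst nonpos_Reals_of_real_iff) simp
  ultimately show False using avoid[OF z(1)] by blast
qed

text \<open>The inverse quotient \<open>Q\<close> never takes a value r <= 0: otherwise Im \<psi> =
  r Im z would have the wrong sign off the real axis, and \<open>pos\<close> excludes it on the
  axis. For \<open>a = 0\<close> the base point lies outside the slit plane and there is no
  singularity to remove, so \<open>c\<close> is tied to \<open>p a\<close> only for
  \<open>a > 0\<close>.\<close>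

lemma pick_quotient:
  assumes \<psi>: "\<psi> holomorphic_on slit_plane" "\<And>t. t > 0 \<Longrightarrow> \<psi> (of_real t) = of_real (p t)"
    and up: "\<And>z. Im z > 0 \<Longrightarrow> Im (\<psi> z) > 0"
    and a: "a \<ge> 0" "a > 0 \<Longrightarrow> c = p a"
    and pos: "\<And>t. t > 0 \<Longrightarrow> t \<noteq> a \<Longrightarrow> (t - a) / (p t - c) > 0"
  obtains \<Phi> where "\<Phi> holomorphic_on slit_plane" "\<And>z. z \<in> slit_plane \<Longrightarrow> \<Phi> z \<in> slit_plane"
    "\<And>t. t > 0 \<Longrightarrow> \<Phi> (of_real t) \<in> \<real>"
    "\<And>z. z \<in> slit_plane \<Longrightarrow> z \<noteq> of_real a \<Longrightarrow> \<Phi> z = (z - of_real a) / (\<psi> z - of_real c)"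
proof -
  define Q where "Q z = (if z = of_real a then deriv \<psi> (of_real a) else (\<psi> z - of_real c) / (z - of_real a))" for z
  have low: "Im (\<psi> z) < 0" if "Im z < 0" for z
  proof -
    have "cnj z \<in> slit_plane" using that by (intro slit_plane_Im) simp
    moreover have "\<psi> (of_real t) \<in> \<real>" if "t > 0" for t using \<psi>(2)[OF that] by simp
    ultimately have "\<psi> (cnj (cnj z)) = cnj (\<psi> (cnj z))" by (intro slit_plane_reflection[OF \<psi>(1)])
    then show ?thesis using up[of "cnj z"] that by simp
  qed
  have Qhol: "Q holomorphic_on slit_plane"
  proof (cases "a > 0")
    case True
    have "(\<lambda>z. if z = of_real a then deriv \<psi> (of_real a) else (\<psi> z - \<psi> (of_real a)) / (z - of_real a)) holomorphic_on slit_plane"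
      by (rule pole_lemma_open[OF \<psi>(1) open_slit_plane])
    then show ?thesis unfolding Q_def using True a \<psi>(2)[OF True] by (simp cong: if_cong)
  next
    case False
    then have "a = 0" using a by simp
    have "(\<lambda>z. (\<psi> z - of_real c) / z) holomorphic_on slit_plane"
      by (intro holomorphic_intros \<psi>(1)) auto
    then show ?thesis
      by (rule holomorphic_transform) (auto simp: Q_def \<open>a = 0\<close>)
  qed
  have Qavoid: "Q z \<notin> \<real>\<^sub>\<le>\<^sub>0" if z: "z \<in> slit_plane" "z \<noteq> of_real a" for z
  proof
    assume "Q z \<in> \<real>\<^sub>\<le>\<^sub>0"
    then obtain r where r: "Q z = of_real r" "r \<le> 0" by (auto elim: nonpos_Reals_cases)
    have "\<psi> z - of_real c = Q z * (z - of_real a)" using z by (simp add: Q_def)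
    then have eq: "\<psi> z - of_real c = of_real r * (z - of_real a)" by (simp add: r)
    then have im: "Im (\<psi> z) = r * Im z" by (simp add: complex_eq_iff)
    show False using z(1)
    proof (cases rule: slit_plane_cases)
      case 1
      then show False using up[of z] im r(2) by (simp add: mult_nonpos_nonneg leD)
    next
      case 2
      then show False using low[of z] im r(2) by (simp add: mult_nonpos_nonpos leD)
    next
      case (3 t)
      then have "of_real (p t - c) = complex_of_real (r * (t - a))" using eq \<psi>(2) by simp
      then have "p t - c = r * (t - a)" by (simp only: of_real_eq_iff)
      moreover have "t \<noteq> a" using 3 z by auto
      ultimately have "(t - a) / (p t - c) = 1 / r" by simp
      then show False using pos[of t] 3 \<open>t \<noteq> a\<close> r(2) by simp
    qed
  qed
  have Qavoid': "Q z \<notin> \<real>\<^sub>\<le>\<^sub>0" if z: "z \<in> slit_plane" for z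
  proof (cases "z = of_real a")
    case True
    show ?thesis unfolding True
      by (rule avoids_nonpos_at_point[OF Qhol open_slit_plane connected_slit_plane]) (use z True Qavoid in auto)
  qed (use Qavoid z in blast)
  define \<Phi> where "\<Phi> z = inverse (Q z)" for z
  have nz: "Q z \<noteq> 0" if "z \<in> slit_plane" for z using Qavoid'[OF that] by auto
  have hol: "\<Phi> holomorphic_on slit_plane"
    unfolding \<Phi>_def by (intro holomorphic_on_inverse Qhol nz)
  have sub: "\<Phi> z \<in> slit_plane" if "z \<in> slit_plane" for z
    using Qavoid'[OF that] unfolding \<Phi>_def by (simp add: nonpos_Reals_inverse_iff)
  have form: "\<Phi> z = (z - of_real a) / (\<psi> z - of_real c)" if "z \<noteq> of_real a" for z
    using that by (simp add: \<Phi>_def Q_def)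
  have real': "\<Phi> (of_real t) \<in> \<real>" if "t > 0" "t \<noteq> a" for t
  proof -
    have "\<Phi> (of_real t) = of_real ((t - a) / (p t - c))"
      using that \<psi>(2)[of t] form[of "of_real t"] by simp
    then show ?thesis by simp
  qed
  have "\<Phi> (of_real t) \<in> \<real>" if t: "t > 0" for t
  proof (cases "t = a")
    case True
    have "of_real a \<in> slit_plane" using t True by (simp only: slit_plane_of_real)
    then have "isCont \<Phi> (of_real a)"
      using continuous_on_eq_continuous_at[OF open_slit_plane] holomorphic_on_imp_continuous_on[OF hol] by blast
    \<comment> \<open>At the removable point, reality is inherited from neighbouring real points,
      where the formula holds.\<close>
    then have lim: "(\<lambda>n. \<Phi> (of_real (a + inverse (Suc n)))) \<longlonglongrightarrow> \<Phi> (of_real a)"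
      by (rule isCont_tendsto_compose) (rule tendsto_of_real[OF LIMSEQ_inverse_real_of_nat_add])
    have mem: "\<Phi> (of_real (a + inverse (Suc n))) \<in> \<real>" for n
    proof (rule real')
      have i: "inverse (real (Suc n)) > 0" by simp
      show "a + inverse (real (Suc n)) > 0" using a(1) i by linarith
      show "a + inverse (real (Suc n)) \<noteq> a" using i by linarith
    qed
    have "\<Phi> (of_real a) \<in> \<real>"
      by (rule closed_sequentially[OF closed_complex_Reals _ lim]) (rule mem)
    then show ?thesis using True by simp
  qed (use real' t in blast)
  then show ?thesis using that hol sub form by blast
qed

section \<open>Arguments of points in the upper half-plane\<close>

lemma Arg_upper: "Im z > 0 \<Longrightarrow> 0 < Arg z" "Im z > 0 \<Longrightarrow> Arg z < pi"
  using Arg_lt_pi by blast+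

lemma Arg_divide_upper:
  assumes "Im z > 0" "Im w > 0"
  shows "Arg (z / w) = Arg z - Arg w"
proof -
  have az: "0 < Arg z" "Arg z < pi" "0 < Arg w" "Arg w < pi" using assms Arg_upper by blast+
  show ?thesis
  proof (rule Arg_unique'[of "cmod z / cmod w"])
    have "z \<noteq> 0" "w \<noteq> 0" using assms by auto
    then show "cmod z / cmod w > 0" by simp
    show "Arg z - Arg w \<in> {- pi<..pi}" using az by auto
    have "z = rcis (cmod z) (Arg z)" "w = rcis (cmod w) (Arg w)" by (simp_all add: rcis_cmod_Arg)
    then have "z / w = rcis (cmod z) (Arg z) / rcis (cmod w) (Arg w)" by simp
    also have "\<dots> = rcis (cmod z / cmod w) (Arg z - Arg w)" by (rule rcis_divide)
    finally show "z / w = rcis (cmod z / cmod w) (Arg z - Arg w)" .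
  qed
qed

text \<open>Rewrites a lower bound on the argument as a linear inequality, which survives addition;
  the next two lemmas rely on that.\<close>

lemma le_Arg_iff:
  assumes z: "Im z > 0" and \<alpha>: "0 \<le> \<alpha>" "\<alpha> \<le> pi"
  shows "\<alpha> \<le> Arg z \<longleftrightarrow> Im (z * cis (- \<alpha>)) \<ge> 0"
proof -
  have az: "0 < Arg z" "Arg z < pi" using z Arg_upper by blast+
  have "z \<noteq> 0" using z by auto
  have "z * cis (- \<alpha>) = rcis (cmod z) (Arg z) * cis (- \<alpha>)" by (simp add: rcis_cmod_Arg)
  also have "\<dots> = rcis (cmod z) (Arg z - \<alpha>)" by (simp add: rcis_def cis_mult mult.assoc)
  finally have "Im (z * cis (- \<alpha>)) = cmod z * sin (Arg z - \<alpha>)" by simp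
  moreover have "sin (Arg z - \<alpha>) \<ge> 0" if "\<alpha> \<le> Arg z" using that az \<alpha> by (intro sin_ge_zero) auto
  moreover have "sin (Arg z - \<alpha>) < 0" if "Arg z < \<alpha>"
  proof -
    have "sin (\<alpha> - Arg z) > 0" using that az \<alpha> by (intro sin_gt_zero) auto
    then show ?thesis using sin_minus[of "\<alpha> - Arg z"] by simp
  qed
  moreover have "cmod z > 0" using \<open>z \<noteq> 0\<close> by simp
  ultimately show ?thesis by (cases "\<alpha> \<le> Arg z") (auto simp: zero_le_mult_iff)
qed

lemma Arg_add_ge_min:
  assumes "Im z > 0" "Im w > 0"
  shows "Arg (z + w) \<ge> min (Arg z) (Arg w)"
proof -
  have az: "0 < Arg z" "Arg z < pi" "0 < Arg w" "Arg w < pi" using assms Arg_upper by blast+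
  define \<alpha> where "\<alpha> = min (Arg z) (Arg w)"
  have \<alpha>: "0 \<le> \<alpha>" "\<alpha> \<le> pi" using az by (auto simp: \<alpha>_def)
  have "Im (z * cis (- \<alpha>)) \<ge> 0" "Im (w * cis (- \<alpha>)) \<ge> 0"
    using le_Arg_iff[OF assms(1) \<alpha>] le_Arg_iff[OF assms(2) \<alpha>] by (auto simp: \<alpha>_def)
  then have "Im ((z + w) * cis (- \<alpha>)) \<ge> 0" by (simp add: distrib_right)
  then show ?thesis using le_Arg_iff[of "z + w", OF _ \<alpha>] assms by (simp add: \<alpha>_def)
qed

lemma Arg_diff_real_ge:
  assumes "Im z > 0" "a \<ge> 0"
  shows "Arg (z - of_real a) \<ge> Arg z"
proof -
  have az: "0 < Arg z" "Arg z < pi" using assms Arg_upper by blast+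
  have "Im (z * cis (- Arg z)) \<ge> 0" using le_Arg_iff[OF assms(1), of "Arg z"] az by simp
  moreover have "sin (Arg z) \<ge> 0" using az by (intro sin_ge_zero) auto
  then have "Im (- of_real a * cis (- Arg z)) \<ge> 0" using assms by simp
  ultimately have "Im ((z - of_real a) * cis (- Arg z)) \<ge> 0" by (simp add: left_diff_distrib)
  then show ?thesis using le_Arg_iff[of "z - of_real a" "Arg z"] az assms by simp
qed

section \<open>A maximum principle in sectors\<close>

text \<open>In the coordinate \<open>w = Ln z\<close> the sector is a strip. The function \<open>exp (-i (H z - \<kappa>/\<theta> w))\<close>
  has modulus \<open>exp (Im H z - \<kappa>/\<theta> Im w) \<le> 1\<close> on both edges, and the factor \<open>exp (-\<delta> w\<^sup>2)\<close>
  takes care of the unbounded ends.\<close>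

lemma phragmen_lindeloef_sector:
  assumes H: "H holomorphic_on slit_plane" and real: "\<And>t. t > 0 \<Longrightarrow> Im (H (of_real t)) = 0"
    and \<theta>: "0 < \<theta>" "\<theta> < pi" and bd: "\<And>z. Im z > 0 \<Longrightarrow> Im (H z) \<le> M"
    and ray: "\<And>z. Im z > 0 \<Longrightarrow> Arg z = \<theta> \<Longrightarrow> Im (H z) \<le> \<kappa>" and \<kappa>: "\<kappa> \<ge> 0"
    and z: "Im z > 0" "Arg z \<le> \<theta>"
  shows "Im (H z) \<le> \<kappa> / \<theta> * Arg z"
proof -
  define w where "w = Ln z"
  have z0: "z \<noteq> 0" using z by auto
  have w: "exp w = z" "Im w = Arg z" using z0 by (auto simp: w_def Arg_eq_Im_Ln)
  have az: "0 < Arg z" "Arg z < pi" using z Arg_upper by auto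
  have bound: "Im (H z) - \<kappa> / \<theta> * Arg z \<le> \<delta> * (\<theta>\<^sup>2 + (Re w)\<^sup>2)" if \<delta>: "\<delta> > 0" for \<delta>
  proof -
    define K where "K u = exp (- \<i> * (H (exp u) - of_real (\<kappa> / \<theta>) * u) - of_real \<delta> * u\<^sup>2)" for u
    have nK: "cmod (K u) = exp (Im (H (exp u)) - \<kappa> / \<theta> * Im u - \<delta> * ((Re u)\<^sup>2 - (Im u)\<^sup>2))" for u
      by (simp add: K_def Re_power2 algebra_simps)
    \<comment> \<open>Large enough that on the short sides the term \<delta> R^2 absorbs the global
      bound \<open>M\<close>, and that \<open>w\<close> lies in the rectangle.\<close>
    define R where "R = \<bar>Re w\<bar> + max M 0 / \<delta> + 1"
    have R: "R \<ge> 1" "\<bar>Re w\<bar> \<le> R" "M \<le> \<delta> * R\<^sup>2"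
    proof -
      have pos: "max M 0 / \<delta> \<ge> 0" using \<delta> by simp
      show "R \<ge> 1" "\<bar>Re w\<bar> \<le> R" using pos by (auto simp: R_def)
      have "M \<le> \<delta> * (max M 0 / \<delta>)" using \<delta> by simp
      also have "\<dots> \<le> \<delta> * R" using \<delta> by (intro mult_left_mono) (auto simp: R_def)
      also have "R \<le> R\<^sup>2" using \<open>R \<ge> 1\<close> by (simp add: power2_eq_square)
      then have "\<delta> * R \<le> \<delta> * R\<^sup>2" using \<delta> by (intro mult_left_mono) auto
      finally show "M \<le> \<delta> * R\<^sup>2" .
    qed
    define S where "S = cbox (Complex (- R) 0) (Complex R \<theta>)"
    have inS: "u \<in> S \<longleftrightarrow> \<bar>Re u\<bar> \<le> R \<and> 0 \<le> Im u \<and> Im u \<le> \<theta>" for u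
      by (auto simp: S_def in_cbox_complex_iff)
    have exp_cases: "(Im u = 0 \<and> exp u = of_real (exp (Re u))) \<or> (Im (exp u) > 0 \<and> Arg (exp u) = Im u)" if "u \<in> S" for u
    proof (cases "Im u = 0")
      case True
      then have "u = of_real (Re u)" by (simp add: complex_eq_iff)
      then show ?thesis using True by (metis exp_of_real)
    next
      case False
      then have im: "0 < Im u" "Im u \<le> \<theta>" using that by (auto simp: inS)
      then have "sin (Im u) > 0" using \<theta> by (intro sin_gt_zero) auto
      then have "Im (exp u) > 0" by (simp add: Im_exp)
      moreover have "Arg (exp u) = Im u" using im \<theta> by (intro Arg_exp) auto
      ultimately show ?thesis by simp
    qed
    have sub: "exp u \<in> slit_plane" if "u \<in> S" for u
      using exp_cases[OF that]
    proof
      assume "Im u = 0 \<and> exp u = of_real (exp (Re u))"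
      then show ?thesis using slit_plane_of_real[of "exp (Re u)"] by simp
    next
      assume "Im (exp u) > 0 \<and> Arg (exp u) = Im u"
      then show ?thesis by (intro slit_plane_Im) simp
    qed
    have KS: "K holomorphic_on S"
    proof -
      have "(H \<circ> exp) holomorphic_on S"
        by (rule holomorphic_on_compose_gen[OF holomorphic_on_exp H]) (use sub in blast)
      then have "(\<lambda>u. H (exp u)) holomorphic_on S" by (simp add: o_def)
      then show ?thesis unfolding K_def by (intro holomorphic_intros)
    qed
    \<comment> \<open>The bound is not 1, because the real part of u^2 is (Re u)^2 - (Im u)^2; the
      second term costs at most \<delta> \<theta>^2.\<close>
    have "cmod (K w) \<le> exp (\<delta> * \<theta>\<^sup>2)"
    proof (rule maximum_modulus_frontier[of K S])
      show "K holomorphic_on interior S" using KS interior_subset by (rule holomorphic_on_subset)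
      show "continuous_on (closure S) K"
        using holomorphic_on_imp_continuous_on[OF KS] by (simp add: S_def)
      show "bounded S" by (simp add: S_def bounded_cbox)
      show "w \<in> S" using R z az by (simp add: inS w)
      fix u assume "u \<in> frontier S"
      then have "u \<in> S" "u \<notin> box (Complex (- R) 0) (Complex R \<theta>)" by (auto simp: S_def frontier_cbox)
      then have u: "\<bar>Re u\<bar> \<le> R" "0 \<le> Im u" "Im u \<le> \<theta>" and side: "\<bar>Re u\<bar> = R \<or> Im u = 0 \<or> Im u = \<theta>"
        by (auto simp: inS in_box_complex_iff)
      have sq: "(Im u)\<^sup>2 \<le> \<theta>\<^sup>2" using u by (intro power_mono) auto
      have lin: "\<kappa> / \<theta> * Im u \<ge> 0" using u \<kappa> \<theta> by simp
      have "Im (H (exp u)) - \<kappa> / \<theta> * Im u - \<delta> * (Re u)\<^sup>2 \<le> 0"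
        using exp_cases[OF \<open>u \<in> S\<close>]
      proof
        assume "Im u = 0 \<and> exp u = of_real (exp (Re u))"
        then have "Im (H (exp u)) = 0" using real[of "exp (Re u)"] by simp
        moreover have "\<delta> * (Re u)\<^sup>2 \<ge> 0" using \<delta> by simp
        ultimately show ?thesis using lin by linarith
      next
        assume e: "Im (exp u) > 0 \<and> Arg (exp u) = Im u"
        then have "Im u \<noteq> 0" using Arg_upper(1)[of "exp u"] by auto
        with side consider "\<bar>Re u\<bar> = R" | "Im u = \<theta>" by blast
        then show ?thesis
        proof cases
          case 1
          then have "(Re u)\<^sup>2 = R\<^sup>2" by (metis power2_abs)
          then show ?thesis using bd[of "exp u"] e R(3) lin by simp
        next
          case 2
          then have "Im (H (exp u)) \<le> \<kappa>" using ray[of "exp u"] e by simp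
          moreover have "\<delta> * (Re u)\<^sup>2 \<ge> 0" using \<delta> by simp
          ultimately show ?thesis using 2 \<theta> by simp
        qed
      qed
      moreover have "\<delta> * (Im u)\<^sup>2 \<le> \<delta> * \<theta>\<^sup>2" using sq \<delta> by (intro mult_left_mono) auto
      ultimately show "cmod (K u) \<le> exp (\<delta> * \<theta>\<^sup>2)"
        unfolding nK by (simp add: right_diff_distrib)
    qed
    then have "Im (H z) - \<kappa> / \<theta> * Arg z - \<delta> * ((Re w)\<^sup>2 - (Arg z)\<^sup>2) \<le> \<delta> * \<theta>\<^sup>2"
      unfolding nK w by simp
    moreover have "\<delta> * (Arg z)\<^sup>2 \<ge> 0" using \<delta> by simp
    ultimately show ?thesis by (simp add: algebra_simps)
  qed
  have "Im (H z) - \<kappa> / \<theta> * Arg z \<le> 0"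
  proof (rule field_le_epsilon)
    fix e :: real assume e: "e > 0"
    define N where "N = \<theta>\<^sup>2 + (Re w)\<^sup>2"
    have N: "N > 0" using \<theta> by (simp add: N_def add_pos_nonneg)
    then show "Im (H z) - \<kappa> / \<theta> * Arg z \<le> 0 + e"
      using bound[of "e / N"] e by (simp add: N_def[symmetric])
  qed
  then show ?thesis by simp
qed

section \<open>From Pick functions to operator monotone functions\<close>

lemma Im_contour_integral_nonneg:
  assumes "(f has_contour_integral I) (linepath a b)"
    and "\<And>x. 0 \<le> x \<Longrightarrow> x \<le> 1 \<Longrightarrow> Im (f (linepath a b x) * (b - a)) \<ge> 0"
  shows "Im I \<ge> 0"
proof -
  have "((\<lambda>x. f (linepath a b x) * (b - a)) has_integral I) {0..1}"
    using assms(1) by (simp add: has_contour_integral_linepath)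
  then have "((\<lambda>x. Im (f (linepath a b x) * (b - a))) has_integral Im I) {0..1}"
    using has_integral_linear[OF _ bounded_linear_Im] by (force simp: o_def)
  then show ?thesis by (rule has_integral_nonneg) (use assms(2) in auto)
qed

text \<open>A contour integral over the rectangle with vertices \<open>\<plusminus>iR, R \<plusminus> iR\<close>. The kernel
  \<open>2 t / (w\<^sup>2 - t) = \<surd>t (1 / (w - \<surd>t) - 1 / (w + \<surd>t))\<close> has its only pole in the right half-plane
  at \<open>\<surd>t\<close>, and at \<open>w = i y\<close> it equals \<open>-2 t / (t + y\<^sup>2)\<close>.\<close>

lemma half_plane_dual:
  fixes k :: "complex \<Rightarrow> complex" and k0 :: real
  assumes cont: "continuous_on {w. Re w \<ge> 0} k" and hol: "k holomorphic_on {w. Re w > 0}"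
    and bd: "\<And>w. Re w \<ge> 0 \<Longrightarrow> cmod (k w) \<le> C"
    and sgn: "\<And>y. Im (k (\<i> * of_real y)) / y \<ge> 0"
    and k0: "k 0 = of_real k0"
    and lim: "((\<lambda>w. (k w - k 0) / w) \<longlongrightarrow> 0) (at 0 within {w. Re w \<ge> 0})"
    and T: "finite T" "T \<subseteq> {0<..}" and c: "\<And>l. l \<ge> 0 \<Longrightarrow> 0 \<le> (\<Sum>t\<in>T. c t * (t / (t + l)))"
    and kr: "\<And>t. t \<in> T \<Longrightarrow> k (of_real (sqrt t)) = of_real (r t)"
  shows "0 \<le> (\<Sum>t\<in>T. c t * (r t - k0))"
proof -
  define P where "P = {w. Re w \<ge> 0}"
  \<comment> \<open>Dividing by \<open>w\<close> turns the residue at sqrt t into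
    \<open>r t - k0\<close> and makes the sign on the imaginary axis that of Im (k(iy))/y. The value
    0 at the origin is the limit granted by \<open>lim\<close>.\<close>
  define q where "q w = (if w = 0 then 0 else (k w - k 0) / w)" for w
  define E where "E w = (\<Sum>t\<in>T. of_real (c t) * (of_real (2 * t) / (w\<^sup>2 - of_real t)))" for w :: complex
  define A where "A = (\<Sum>t\<in>T. \<bar>c t\<bar> * (4 * t))"
  have C: "C \<ge> 0" using order_trans[OF norm_ge_zero bd[of 0]] by simp
  have A: "A \<ge> 0" using T by (auto simp: A_def intro!: sum_nonneg)
  have qcont: "continuous_on P q"
    unfolding continuous_on_def
  proof
    fix w assume w: "w \<in> P"
    show "(q \<longlongrightarrow> q w) (at w within P)"
    proof (cases "w = 0")
      case True
      have "((\<lambda>w. (k w - k 0) / w) \<longlongrightarrow> 0) (at 0 within P) \<longleftrightarrow> (q \<longlongrightarrow> 0) (at 0 within P)"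
        by (rule filterlim_cong) (auto simp: q_def eventually_at_filter)
      then show ?thesis using lim True by (simp add: q_def P_def)
    next
      case False
      have "((\<lambda>w. (k w - k 0) / w) \<longlongrightarrow> (k w - k 0) / w) (at w within P)"
        using cont w False unfolding P_def continuous_on_def by (intro tendsto_intros) auto
      moreover have "\<forall>\<^sub>F u in at w within P. (k u - k 0) / u = q u"
        using False eventually_neq_at_within[of 0 w P] by (auto elim!: eventually_mono simp: q_def)
      ultimately show ?thesis using False by (auto simp: q_def elim: Lim_transform_eventually)
    qed
  qed
  have qdiff: "q field_differentiable at w" if w: "Re w > 0" for w
  proof -
    have hp: "open {w. Re w > 0}" by (rule open_halfspace_Re_gt)
    have "(\<lambda>w. (k w - k 0) / w) holomorphic_on {w. Re w > 0}"
      by (intro holomorphic_intros hol) auto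
    then have "q holomorphic_on {w. Re w > 0}"
      by (rule holomorphic_transform) (auto simp: q_def)
    then show ?thesis using hp w by (auto simp: holomorphic_on_open field_differentiable_def)
  qed
  have qbd: "cmod (q w) \<le> 2 * C / R" if "w \<in> P" "cmod w \<ge> R" "R > 0" for w R
  proof -
    have "w \<noteq> 0" using that by auto
    have "cmod (k w - k 0) \<le> C + C" using that(1) bd[of w] bd[of 0] norm_triangle_ineq4[of "k w" "k 0"] by (simp add: P_def)
    then have "cmod (k w - k 0) / cmod w \<le> (2 * C) / R" using that C by (intro frac_le) auto
    then show ?thesis using \<open>w \<noteq> 0\<close> by (simp add: q_def norm_divide)
  qed
  have Ebd: "cmod (E w) \<le> A / R\<^sup>2" if R: "R > 0" "\<And>t. t \<in> T \<Longrightarrow> 2 * t \<le> R\<^sup>2" and w: "cmod w \<ge> R" for w R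
  proof -
    have "cmod (E w) \<le> (\<Sum>t\<in>T. \<bar>c t\<bar> * (4 * t) / R\<^sup>2)"
      unfolding E_def
    proof (rule sum_norm_le)
      fix t assume t: "t \<in> T"
      then have t0: "t > 0" using T by auto
      have "R\<^sup>2 \<le> (cmod w)\<^sup>2" using w R by (intro power_mono) auto
      moreover have "cmod (w\<^sup>2) - cmod (of_real t) \<le> cmod (w\<^sup>2 - of_real t)" by (rule norm_triangle_ineq2)
      ultimately have ge: "R\<^sup>2 / 2 \<le> cmod (w\<^sup>2 - of_real t)" using R(2)[OF t] t0 by (simp add: norm_power)
      have "cmod (of_real (2 * t) / (w\<^sup>2 - of_real t)) = 2 * t / cmod (w\<^sup>2 - of_real t)"
        using t0 by (simp add: norm_divide norm_mult)
      also have "\<dots> \<le> 2 * t / (R\<^sup>2 / 2)" using ge R t0 by (intro divide_left_mono) (auto intro!: mult_pos_pos elim: order_less_le_trans[rotated])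
      finally have "\<bar>c t\<bar> * cmod (of_real (2 * t) / (w\<^sup>2 - of_real t)) \<le> \<bar>c t\<bar> * (2 * t / (R\<^sup>2 / 2))"
        by (rule mult_left_mono) simp
      then show "cmod (of_real (c t) * (of_real (2 * t) / (w\<^sup>2 - of_real t))) \<le> \<bar>c t\<bar> * (4 * t) / R\<^sup>2"
        unfolding norm_mult[of "of_real (c t)"] by simp
    qed
    then show ?thesis by (simp add: A_def sum_divide_distrib)
  qed
  \<comment> \<open>Away from the imaginary axis \<open>q\<close> is of order 1/R and
    \<open>E\<close> of order 1/R^2, so each of the three other sides, of length at most 2R,
    contributes at most \<open>4 * C * A / R\<^sup>2\<close>.\<close>
  have main: "- (12 * (C * A) / R\<^sup>2) \<le> 2 * pi * (\<Sum>t\<in>T. c t * (r t - k0))"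
    if R: "R \<ge> 1" "\<And>t. t \<in> T \<Longrightarrow> 2 * t \<le> R\<^sup>2" "\<And>t. t \<in> T \<Longrightarrow> sqrt t < R" for R
  proof -
    define a1 where "a1 = Complex 0 (- R)"
    define a2 where "a2 = Complex R (- R)"
    define a3 where "a3 = Complex R R"
    define a4 where "a4 = Complex 0 R"
    define S where "S = cbox a1 a3"
    have rp: "rectpath a1 a3 = linepath a1 a2 +++ linepath a2 a3 +++ linepath a3 a4 +++ linepath a4 a1"
      by (simp add: rectpath_def Let_def a1_def a2_def a3_def a4_def)
    have S: "convex S" "S \<subseteq> P" "interior S = box a1 a3"
      by (auto simp: S_def P_def in_cbox_complex_iff a1_def interior_cbox)
    have img: "path_image (rectpath a1 a3) = S - box a1 a3"
      unfolding S_def using R by (intro path_image_rectpath_cbox_minus_box) (auto simp: a1_def a3_def)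
    have pt: "((\<lambda>w. q w * (of_real (2 * t) / (w\<^sup>2 - of_real t))) has_contour_integral (2 * pi * \<i> * of_real (r t - k0))) (rectpath a1 a3)"
      if t: "t \<in> T" for t
    proof -
      define s where "s = complex_of_real (sqrt t)"
      have t0: "t > 0" using t T by auto
      have s2: "s\<^sup>2 = of_real t" using t0 by (simp add: s_def flip: of_real_power)
      have s0: "s \<noteq> 0" using t0 by (simp add: s_def)
      have sbox: "s \<in> box a1 a3" using t0 R(1) R(3)[OF t] by (simp add: s_def in_box_complex_iff a1_def a3_def)
      have qi: "q field_differentiable at x" if "x \<in> interior S - {}" for x
        using that by (intro qdiff) (auto simp: S in_box_complex_iff a1_def)
      \<comment> \<open>The contour runs through 0, where \<open>q\<close> is merely continuous.
        Hence forms of Cauchy's theorems are used that ask for differentiability only in the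
        interior.\<close>
      have "((\<lambda>w. q w / (w - s)) has_contour_integral (2 * pi * \<i> * winding_number (rectpath a1 a3) s * q s)) (rectpath a1 a3)"
        by (rule Cauchy_integral_formula_weak[OF S(1) finite.emptyI continuous_on_subset[OF qcont S(2)] qi])
          (use sbox in \<open>auto simp: S(3) img\<close>)
      then have I1: "((\<lambda>w. q w / (w - s)) has_contour_integral (2 * pi * \<i> * q s)) (rectpath a1 a3)"
        by (simp add: winding_number_rectpath[OF sbox])
      have ns: "w + s \<noteq> 0" if "w \<in> P" for w
      proof -
        have "Re (w + s) > 0" using that t0 by (simp add: P_def s_def add_nonneg_pos)
        then show ?thesis by (metis less_irrefl zero_complex.sel(1))
      qed
      have cont': "continuous_on S (\<lambda>w. q w / (w + s))"
        using S(2) ns by (intro continuous_intros continuous_on_subset[OF qcont S(2)]) auto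
      have diff': "(\<lambda>w. q w / (w + s)) field_differentiable at x" if "x \<in> interior S - {}" for x
      proof -
        have "x \<in> P" using that S by (auto simp: in_box_complex_iff a1_def P_def)
        then show ?thesis using ns[of x] qi[OF that]
          by (intro field_differentiable_divide field_differentiable_add field_differentiable_ident field_differentiable_const) auto
      qed
      have I2: "((\<lambda>w. q w / (w + s)) has_contour_integral 0) (rectpath a1 a3)"
        by (rule Cauchy_theorem_convex[OF cont' S(1) finite.emptyI diff']) (auto simp: img)
      have "((\<lambda>w. s * (q w / (w - s) - q w / (w + s))) has_contour_integral (s * (2 * pi * \<i> * q s - 0))) (rectpath a1 a3)"
        by (intro has_contour_integral_lmul has_contour_integral_diff I1 I2)
      moreover have "s * (2 * pi * \<i> * q s - 0) = 2 * pi * \<i> * of_real (r t - k0)"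
        using s0 kr[OF t] k0 by (simp add: q_def s_def[symmetric])
      moreover have "s * (q w / (w - s) - q w / (w + s)) = q w * (of_real (2 * t) / (w\<^sup>2 - of_real t))"
        if w: "w \<in> path_image (rectpath a1 a3)" for w
      proof -
        have "w \<in> P" "w \<noteq> s" using w img S sbox by auto
        then have "w + s \<noteq> 0" "w - s \<noteq> 0" using ns by auto
        moreover have "w\<^sup>2 - of_real t = (w + s) * (w - s)" by (simp add: s2[symmetric] power2_eq_square algebra_simps)
        moreover have "of_real (2 * t) = 2 * s\<^sup>2" by (simp add: s2)
        ultimately show ?thesis by (simp add: divide_simps power2_eq_square) (simp add: algebra_simps)
      qed
      ultimately show ?thesis by (metis (no_types, lifting) has_contour_integral_eq)
    qed
    have tot: "((\<lambda>w. q w * E w) has_contour_integral (\<Sum>t\<in>T. of_real (c t) * (2 * pi * \<i> * of_real (r t - k0)))) (rectpath a1 a3)"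
    proof -
      have "((\<lambda>w. \<Sum>t\<in>T. of_real (c t) * (q w * (of_real (2 * t) / (w\<^sup>2 - of_real t)))) has_contour_integral
          (\<Sum>t\<in>T. of_real (c t) * (2 * pi * \<i> * of_real (r t - k0)))) (rectpath a1 a3)"
        by (intro has_contour_integral_sum T(1) has_contour_integral_lmul pt)
      then show ?thesis
        by (rule has_contour_integral_eq) (simp add: E_def sum_distrib_left mult_ac)
    qed
    have "(\<lambda>w. q w * E w) contour_integrable_on (rectpath a1 a3)"
      using tot by (rule has_contour_integral_integrable)
    then have int: "(\<lambda>w. q w * E w) contour_integrable_on linepath a1 a2" "(\<lambda>w. q w * E w) contour_integrable_on linepath a2 a3"
        "(\<lambda>w. q w * E w) contour_integrable_on linepath a3 a4" "(\<lambda>w. q w * E w) contour_integrable_on linepath a4 a1"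
      unfolding rp by (auto dest!: contour_integrable_joinD1 contour_integrable_joinD2)
    define I where "I a b = contour_integral (linepath a b) (\<lambda>w. q w * E w)" for a b
    have sum_eq: "(\<Sum>t\<in>T. of_real (c t) * (2 * pi * \<i> * of_real (r t - k0))) = I a1 a2 + I a2 a3 + I a3 a4 + I a4 a1"
      using contour_integral_unique[OF tot] int unfolding rp I_def by (simp add: add.assoc)
    have side: "cmod (I a b) \<le> 4 * C * A / R\<^sup>2"
      if ab: "(\<lambda>w. q w * E w) contour_integrable_on linepath a b" "cmod (b - a) \<le> 2 * R"
        "\<And>w. w \<in> closed_segment a b \<Longrightarrow> w \<in> P \<and> cmod w \<ge> R" for a b
    proof -
      have R0: "R > 0" using R by simp
      have B0: "0 \<le> 2 * C / R * (A / R\<^sup>2)" using C A R0 by simp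
      have "cmod (I a b) \<le> (2 * C / R * (A / R\<^sup>2)) * cmod (b - a)"
        unfolding I_def
      proof (rule contour_integral_bound_linepath[OF ab(1) B0])
        fix w assume "w \<in> closed_segment a b"
        then have w: "w \<in> P" "cmod w \<ge> R" using ab(3) by auto
        show "cmod (q w * E w) \<le> 2 * C / R * (A / R\<^sup>2)"
          unfolding norm_mult using C R0 by (intro mult_mono qbd[OF w R0] Ebd[OF R0 R(2) w(2)]) auto
      qed
      also have "\<dots> \<le> (2 * C / R * (A / R\<^sup>2)) * (2 * R)" using ab(2) B0 by (rule mult_left_mono)
      also have "\<dots> = 4 * C * A / R\<^sup>2" using R0 by (simp add: field_simps)
      finally show ?thesis .
    qed
    have big: "cmod w \<ge> R" if "\<bar>Re w\<bar> = R \<or> \<bar>Im w\<bar> = R" for w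
      using that abs_Re_le_cmod[of w] abs_Im_le_cmod[of w] by auto
    have "cmod (I a1 a2) \<le> 4 * C * A / R\<^sup>2"
    proof (rule side[OF int(1)])
      have "a2 - a1 = of_real R" by (simp add: a1_def a2_def complex_eq_iff)
      then show "cmod (a2 - a1) \<le> 2 * R" using R by simp
      fix w assume w: "w \<in> closed_segment a1 a2"
      then have "Im w = - R" "0 \<le> Re w" using R
        by (auto simp: closed_segment_same_Im a1_def a2_def closed_segment_eq_real_ivl)
      then show "w \<in> P \<and> cmod w \<ge> R" using R big[of w] by (simp add: P_def)
    qed
    moreover have "cmod (I a2 a3) \<le> 4 * C * A / R\<^sup>2"
    proof (rule side[OF int(2)])
      have "a3 - a2 = of_real (2 * R) * \<i>" by (simp add: a3_def a2_def complex_eq_iff)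
      then show "cmod (a3 - a2) \<le> 2 * R" using R by (simp add: norm_mult)
      fix w assume w: "w \<in> closed_segment a2 a3"
      then have "Re w = R" using R
        by (auto simp: closed_segment_same_Re a3_def a2_def)
      then show "w \<in> P \<and> cmod w \<ge> R" using R big[of w] by (simp add: P_def)
    qed
    moreover have "cmod (I a3 a4) \<le> 4 * C * A / R\<^sup>2"
    proof (rule side[OF int(3)])
      have "a4 - a3 = - of_real R" by (simp add: a3_def a4_def complex_eq_iff)
      then show "cmod (a4 - a3) \<le> 2 * R" using R by simp
      fix w assume w: "w \<in> closed_segment a3 a4"
      then have "Im w = R" "0 \<le> Re w" using R
        by (auto simp: closed_segment_same_Im a3_def a4_def closed_segment_eq_real_ivl)
      then show "w \<in> P \<and> cmod w \<ge> R" using R big[of w] by (simp add: P_def)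
    qed
    moreover have "Im (I a4 a1) \<ge> 0"
    proof (rule Im_contour_integral_nonneg)
      show "((\<lambda>w. q w * E w) has_contour_integral I a4 a1) (linepath a4 a1)"
        unfolding I_def using int(4) by (rule has_contour_integral_integral)
      fix x :: real
      define y where "y = R - 2 * R * x"
      have lp: "linepath a4 a1 x = \<i> * of_real y" by (simp add: linepath_def a4_def a1_def y_def complex_eq_iff algebra_simps)
      have df: "a1 - a4 = - (2 * \<i> * of_real R)" by (simp add: a4_def a1_def complex_eq_iff)
      define W where "W = (\<Sum>t\<in>T. c t * (t / (t + y\<^sup>2)))"
      have W: "W \<ge> 0" unfolding W_def by (rule c) simp
      \<comment> \<open>On the imaginary axis \<open>E\<close> is real and nonpositive, and
        \<open>W \<ge> 0\<close> is exactly the hypothesis on \<open>c\<close> at l = y^2.\<close>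
      have EW: "E (\<i> * of_real y) = of_real (- 2 * W)"
        unfolding E_def W_def sum_distrib_left of_real_sum
      proof (rule sum.cong)
        fix t assume "t \<in> T"
        then have "t + y\<^sup>2 \<noteq> 0" using T(2) by (metis add_pos_nonneg greaterThan_iff less_irrefl subsetD zero_le_power2)
        have den: "(\<i> * of_real y)\<^sup>2 - of_real t = complex_of_real (- (t + y\<^sup>2))"
          by (simp add: power_mult_distrib)
        have "of_real (c t) * (of_real (2 * t) / ((\<i> * of_real y)\<^sup>2 - of_real t)) = complex_of_real (c t * (2 * t / (- (t + y\<^sup>2))))"
          by (simp only: den of_real_mult of_real_divide)
        also have "c t * (2 * t / (- (t + y\<^sup>2))) = - 2 * (c t * (t / (t + y\<^sup>2)))"
          unfolding minus_divide_right[symmetric] by simp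
        finally show "of_real (c t) * (of_real (2 * t) / ((\<i> * of_real y)\<^sup>2 - of_real t)) = complex_of_real (- 2 * (c t * (t / (t + y\<^sup>2))))" .
      qed simp
      show "Im (q (linepath a4 a1 x) * E (linepath a4 a1 x) * (a1 - a4)) \<ge> 0"
      proof (cases "y = 0")
        case True
        then show ?thesis by (simp add: lp q_def)
      next
        case False
        have "q (\<i> * of_real y) * E (\<i> * of_real y) * (a1 - a4) = (k (\<i> * of_real y) - of_real k0) * of_real (4 * R * W / y)"
          using False by (simp add: q_def EW df k0 field_simps)
        then have "Im (q (\<i> * of_real y) * E (\<i> * of_real y) * (a1 - a4)) = Im (k (\<i> * of_real y)) * (4 * R * W / y)"
          by simp
        also have "\<dots> = 4 * R * W * (Im (k (\<i> * of_real y)) / y)" by simp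
        also have "\<dots> \<ge> 0" using R W sgn by (intro mult_nonneg_nonneg) auto
        finally show ?thesis by (simp add: lp)
      qed
    qed
    moreover have "Im (I a1 a2) \<ge> - cmod (I a1 a2)" "Im (I a2 a3) \<ge> - cmod (I a2 a3)" "Im (I a3 a4) \<ge> - cmod (I a3 a4)"
      using abs_Im_le_cmod by (metis abs_le_iff minus_le_iff)+
    ultimately have "Im (I a1 a2 + I a2 a3 + I a3 a4 + I a4 a1) \<ge> - (3 * (4 * C * A / R\<^sup>2))"
      unfolding plus_complex.sel by linarith
    moreover have "Im (\<Sum>t\<in>T. of_real (c t) * (2 * pi * \<i> * of_real (r t - k0))) = 2 * pi * (\<Sum>t\<in>T. c t * (r t - k0))"
      by (simp add: sum_distrib_left mult_ac)
    ultimately have "- (3 * (4 * C * A / R\<^sup>2)) \<le> 2 * pi * (\<Sum>t\<in>T. c t * (r t - k0))"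
      by (simp only: sum_eq)
    then show ?thesis by simp
  qed
  have "((\<lambda>R. - (12 * (C * A) / R\<^sup>2)) \<longlongrightarrow> - 0) at_top"
    by (intro tendsto_minus real_tendsto_divide_at_top tendsto_const filterlim_pow_at_top filterlim_ident) auto
  moreover have "\<forall>\<^sub>F R in at_top. - (12 * (C * A) / R\<^sup>2) \<le> 2 * pi * (\<Sum>t\<in>T. c t * (r t - k0))"
    using eventually_ge_at_top[of "1 + (\<Sum>t\<in>T. 2 * t + sqrt t)"]
  proof eventually_elim
    case (elim R)
    have each: "2 * t + sqrt t \<le> R - 1" if "t \<in> T" for t
    proof -
      have "2 * t + sqrt t \<le> (\<Sum>t\<in>T. 2 * t + sqrt t)"
        using T that by (intro member_le_sum) (auto simp: less_imp_le)
      then show ?thesis using elim by simp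
    qed
    have R1: "R \<ge> 1" using elim sum_nonneg[of T "\<lambda>t. 2 * t + sqrt t"] T by (force simp: less_imp_le)
    show ?case
    proof (rule main[OF R1])
      fix t assume t: "t \<in> T"
      then have "t > 0" using T by auto
      then have "sqrt t > 0" by simp
      then have "2 * t \<le> R" "sqrt t < R" using each[OF t] \<open>t > 0\<close> by linarith+
      moreover have "R \<le> R\<^sup>2" using R1 by (simp add: power2_eq_square)
      ultimately show "2 * t \<le> R\<^sup>2" "sqrt t < R" by auto
    qed
  qed
  ultimately have "- 0 \<le> 2 * pi * (\<Sum>t\<in>T. c t * (r t - k0))"
    by (rule tendsto_upperbound) simp
  then show ?thesis using pi_gt_zero by (auto simp: zero_le_mult_iff)
qed

text \<open>Keeps \<epsilon> exp u away from -1: if its real part is nonnegative, adding 1 only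
  increases the modulus; otherwise the imaginary part alone is large enough, as the argument stays
  below p pi in absolute value.\<close>

lemma sector_norm_bound:
  assumes p: "1 / 2 < p" "p < 1" and b: "\<bar>Im u\<bar> \<le> p * pi" and \<epsilon>: "\<epsilon> > 0"
  shows "\<epsilon> * cmod (exp u) * sin (p * pi) \<le> cmod (1 + of_real \<epsilon> * exp u)"
proof (cases "cos (Im u) \<ge> 0")
  case True
  have "(\<epsilon> * cmod (exp u))\<^sup>2 \<le> (cmod (1 + of_real \<epsilon> * exp u))\<^sup>2"
  proof -
    have "(cmod (1 + of_real \<epsilon> * exp u))\<^sup>2 = 1 + 2 * \<epsilon> * Re (exp u) + (\<epsilon> * cmod (exp u))\<^sup>2"
      unfolding power_mult_distrib cmod_power2 by (simp add: power2_eq_square algebra_simps)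
    moreover have "Re (exp u) \<ge> 0" using True by (simp add: Re_exp)
    ultimately show ?thesis using \<epsilon> by simp
  qed
  then have "\<epsilon> * cmod (exp u) \<le> cmod (1 + of_real \<epsilon> * exp u)" by (rule power2_le_imp_le) simp
  moreover have "\<epsilon> * cmod (exp u) * sin (p * pi) \<le> \<epsilon> * cmod (exp u) * 1"
    using \<epsilon> by (intro mult_left_mono) auto
  ultimately show ?thesis by simp
next
  case False
  have pp: "p * pi \<le> pi" using p by (simp add: mult_le_cancel_right1)
  have ab: "\<bar>Im u\<bar> > pi / 2"
  proof (rule ccontr)
    assume "\<not> \<bar>Im u\<bar> > pi / 2"
    then have "cos (Im u) \<ge> 0" by (intro cos_ge_zero) auto
    then show False using False by simp
  qed
  have "sin (p * pi) = sin (pi - p * pi)" by simp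
  also have "\<dots> \<le> sin (pi - \<bar>Im u\<bar>)"
    using b ab pp pi_gt_zero by (intro sin_monotone_2pi_le) linarith+
  also have "\<dots> = sin \<bar>Im u\<bar>" by simp
  also have "\<dots> \<le> \<bar>sin (Im u)\<bar>" by (simp add: abs_if)
  finally have "\<epsilon> * cmod (exp u) * sin (p * pi) \<le> \<epsilon> * cmod (exp u) * \<bar>sin (Im u)\<bar>"
    using \<epsilon> by (intro mult_left_mono) auto
  also have "\<dots> = \<bar>Im (1 + of_real \<epsilon> * exp u)\<bar>" using \<epsilon> by (simp add: Im_exp abs_mult)
  also have "\<dots> \<le> cmod (1 + of_real \<epsilon> * exp u)" by (rule abs_Im_le_cmod)
  finally show ?thesis .
qed

text \<open>The exponent \<open>p < 1\<close> opens the slit, so that the function is continuous up to the negative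
  axis; the shift by \<open>\<delta>\<close> regularises it at the origin; and \<open>h / (1 + \<epsilon> h)\<close> is bounded.\<close>

lemma regularised_dual:
  assumes H: "H holomorphic_on slit_plane" and real: "\<And>t. t > 0 \<Longrightarrow> Im (H (of_real t)) = 0"
    and up: "\<And>z. Im z > 0 \<Longrightarrow> 0 \<le> Im (H z)" "\<And>z. Im z > 0 \<Longrightarrow> Im (H z) \<le> Arg z"
    and p: "1 / 2 < p" "p < 1" and \<delta>: "\<delta> > 0" and \<epsilon>: "\<epsilon> > 0"
    and T: "finite T" "T \<subseteq> {0<..}" and c: "\<And>l. l \<ge> 0 \<Longrightarrow> 0 \<le> (\<Sum>t\<in>T. c t * (t / (t + l)))"
  defines "h \<equiv> \<lambda>t. exp (Re (H (of_real (t powr p + \<delta>))))"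
  shows "0 \<le> (\<Sum>t\<in>T. c t * (h t / (1 + \<epsilon> * h t)))"
proof -
  define P where "P = {w :: complex. Re w \<ge> 0}"
  \<comment> \<open>The power w^(2p), so that g(sqrt t) = t^p matches the evaluation points of
    \<open>half_plane_dual\<close>. It maps the closed right half-plane into the sector of arguments
    at most p pi in absolute value.\<close>
  define g where "g w = (if w = 0 then 0 else exp (of_real (2 * p) * Ln w))" for w :: complex
  define \<zeta> where "\<zeta> w = g w + of_real \<delta>" for w
  define \<Psi> where "\<Psi> u = exp (H u) / (1 + of_real \<epsilon> * exp (H u))" for u
  define k where "k w = \<Psi> (\<zeta> w)" for w
  have g_norm: "cmod (g w) = cmod w powr (2 * p)" for w
    by (cases "w = 0") (auto simp: g_def powr_def)
  have g_real: "g (of_real s) = of_real (s powr (2 * p))" if "s > 0" for s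
    using that by (simp add: g_def Ln_of_real powr_def exp_of_real flip: of_real_mult)
  have slitP: "w \<in> slit_plane" if "w \<in> P" "w \<noteq> 0" for w
    using that by (auto simp: P_def complex_nonpos_Reals_iff complex_eq_iff)
  have g_cnj: "g (cnj w) = cnj (g w)" if "w \<in> P" for w
  proof (cases "w = 0")
    case False
    then have "w \<notin> \<real>\<^sub>\<le>\<^sub>0" using slitP[OF that] by simp
    then have "cnj (Ln w) = Ln (cnj w)" by (rule cnj_Ln)
    then show ?thesis using False by (simp add: g_def exp_cnj)
  qed (simp add: g_def)
  have Hcnj: "H (cnj z) = cnj (H z)" if "z \<in> slit_plane" for z
    by (rule slit_plane_reflection[OF H _ that]) (simp add: real complex_is_Real_iff)
  \<comment> \<open>The argument of \<open>g w\<close> is at most p pi, adding \<delta> decreases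
    it, and the bound of Im H by Arg carries this over to Im H.\<close>
  have upper: "\<zeta> w \<in> slit_plane \<and> 0 \<le> Im (H (\<zeta> w)) \<and> Im (H (\<zeta> w)) \<le> p * pi" if w: "w \<in> P" "Im w > 0" for w
  proof -
    have w0: "w \<noteq> 0" using w by auto
    have "\<bar>Arg w\<bar> \<le> pi / 2" using w unfolding P_def by (simp only: Arg_Re_nonneg mem_Collect_eq)
    moreover have "Arg w > 0" using w by (simp add: Arg_upper)
    ultimately have a: "0 < 2 * p * Arg w" "2 * p * Arg w \<le> p * pi"
      using p mult_left_mono[of "Arg w" "pi / 2" "2 * p"] by auto
    have pp: "p * pi < pi" using p by simp
    have im: "Im (of_real (2 * p) * Ln w) = 2 * p * Arg w" using w0 by (simp add: Arg_eq_Im_Ln)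
    have argg: "Arg (g w) = 2 * p * Arg w"
      using w0 Arg_exp[of "of_real (2 * p) * Ln w"] a pp unfolding im by (simp add: g_def)
    have "sin (2 * p * Arg w) > 0" using a pp by (intro sin_gt_zero) linarith+
    moreover have "Im (g w) = exp (Re (of_real (2 * p) * Ln w)) * sin (2 * p * Arg w)"
      using w0 unfolding g_def by (simp only: if_False Im_exp im)
    ultimately have "Im (g w) > 0" by simp
    then have imz: "Im (\<zeta> w) > 0" by (simp add: \<zeta>_def)
    have "Arg (\<zeta> w) \<le> Arg (g w)"
      using Arg_diff_real_ge[OF imz, of \<delta>] \<delta> by (simp add: \<zeta>_def)
    moreover have "\<zeta> w \<in> slit_plane" using imz by (intro slit_plane_Im) simp
    ultimately show ?thesis using up[OF imz] a argg by linarith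
  qed
  have mid: "\<zeta> w \<in> slit_plane \<and> Im (H (\<zeta> w)) = 0" if w: "w \<in> P" "Im w = 0" for w
  proof -
    have "\<exists>s>0. \<zeta> w = of_real s"
    proof (cases "w = 0")
      case True
      then show ?thesis using \<delta> by (auto simp: \<zeta>_def g_def)
    next
      case False
      have "w = of_real (Re w)" using w by (simp add: complex_eq_iff)
      moreover have "Re w > 0" using False w by (auto simp: P_def complex_eq_iff)
      ultimately have "\<zeta> w = of_real (Re w powr (2 * p) + \<delta>)" using g_real by (metis \<zeta>_def of_real_add)
      moreover have "Re w powr (2 * p) + \<delta> > 0" using \<delta> by (simp add: add_nonneg_pos)
      ultimately show ?thesis by blast
    qed
    then obtain s where s: "s > 0" "\<zeta> w = of_real s" by blast
    then show ?thesis using real[OF s(1)] slit_plane_of_real[of s] by simp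
  qed
  have lower: "\<zeta> w \<in> slit_plane \<and> Im (H (\<zeta> w)) \<le> 0 \<and> - (p * pi) \<le> Im (H (\<zeta> w))" if w: "w \<in> P" "Im w < 0" for w
  proof -
    have cw: "cnj w \<in> P" "Im (cnj w) > 0" using w by (auto simp: P_def)
    have "\<zeta> (cnj w) = cnj (\<zeta> w)" using g_cnj[OF w(1)] by (simp add: \<zeta>_def)
    then have eq: "\<zeta> w = cnj (\<zeta> (cnj w))" by simp
    have "cnj (\<zeta> (cnj w)) \<in> slit_plane" using upper[OF cw] by (auto simp: complex_nonpos_Reals_iff)
    moreover have "H (\<zeta> w) = cnj (H (\<zeta> (cnj w)))" unfolding eq using upper[OF cw] by (intro Hcnj) blast
    ultimately show ?thesis using upper[OF cw] eq by simp
  qed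
  have pp0: "p * pi > 0" using p by simp
  have slit: "\<zeta> w \<in> slit_plane" and Hbd: "\<bar>Im (H (\<zeta> w))\<bar> \<le> p * pi" if "w \<in> P" for w
    using upper[OF that] mid[OF that] lower[OF that] pp0 by (cases "Im w" "0 :: real" rule: linorder_cases; fastforce)+
  have sp: "sin (p * pi) > 0" using p by (intro sin_gt_zero) auto
  have den: "cmod (1 + of_real \<epsilon> * exp (H (\<zeta> w))) \<ge> \<epsilon> * cmod (exp (H (\<zeta> w))) * sin (p * pi)" if "w \<in> P" for w
    by (rule sector_norm_bound[OF p Hbd[OF that] \<epsilon>])
  have den_pos: "\<epsilon> * cmod (exp (H (\<zeta> w))) * sin (p * pi) > 0" for w
    using \<epsilon> sp by simp
  have den0: "1 + of_real \<epsilon> * exp (H (\<zeta> w)) \<noteq> 0" if "w \<in> P" for w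
    using den[OF that] den_pos[of w] by (metis norm_zero not_less)
  have bd: "cmod (k w) \<le> 1 / (\<epsilon> * sin (p * pi))" if "w \<in> P" for w
  proof -
    have "cmod (k w) = cmod (exp (H (\<zeta> w))) / cmod (1 + of_real \<epsilon> * exp (H (\<zeta> w)))"
      by (simp add: k_def \<Psi>_def norm_divide)
    also have "\<dots> \<le> cmod (exp (H (\<zeta> w))) / (\<epsilon> * cmod (exp (H (\<zeta> w))) * sin (p * pi))"
      using den[OF that] den_pos[of w] by (intro divide_left_mono) (auto intro!: mult_pos_pos elim: less_le_trans)
    also have "\<dots> = 1 / (\<epsilon> * sin (p * pi))" by simp
    finally show ?thesis .
  qed
  have g0: "(g \<longlongrightarrow> 0) (at 0 within P)"
  proof (rule tendsto_norm_zero_cancel)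
    have "((\<lambda>w. cmod w powr (2 * p)) \<longlongrightarrow> 0) (at 0 within P)"
      using p by (intro tendsto_zero_powrI[where b = "2 * p"] tendsto_eq_intros refl) auto
    then show "((\<lambda>w. cmod (g w)) \<longlongrightarrow> 0) (at 0 within P)" by (simp add: g_norm)
  qed
  have ghol: "g holomorphic_on slit_plane"
  proof -
    have "(\<lambda>w. exp (of_real (2 * p) * Ln w)) holomorphic_on slit_plane"
      by (intro holomorphic_intros) auto
    then show ?thesis by (rule holomorphic_transform) (auto simp: g_def)
  qed
  have gcont: "continuous_on P g"
    unfolding continuous_on_def
  proof
    fix w assume w: "w \<in> P"
    show "(g \<longlongrightarrow> g w) (at w within P)"
    proof (cases "w = 0")
      case True
      then show ?thesis using g0 by (simp add: g_def)
    next
      case False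
      have "isCont g w"
        using continuous_on_eq_continuous_at[OF open_slit_plane] holomorphic_on_imp_continuous_on[OF ghol] slitP[OF w False] by blast
      then show ?thesis by (simp add: continuous_at_imp_continuous_at_within flip: continuous_within)
    qed
  qed
  have zcont: "continuous_on P \<zeta>" unfolding \<zeta>_def by (intro continuous_intros gcont)
  have Hcont: "continuous_on P (\<lambda>w. H (\<zeta> w))"
    by (rule continuous_on_compose2[OF holomorphic_on_imp_continuous_on[OF H] zcont]) (use slit in blast)
  have kcont: "continuous_on P k"
    unfolding k_def \<Psi>_def by (intro continuous_intros Hcont ballI den0)
  have khol: "k holomorphic_on {w. Re w > 0}"
  proof -
    have sub: "{w. Re w > 0} \<subseteq> P" "{w. Re w > 0} \<subseteq> slit_plane"
      by (auto simp: P_def complex_nonpos_Reals_iff)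
    have "\<zeta> holomorphic_on {w. Re w > 0}"
      unfolding \<zeta>_def by (intro holomorphic_intros holomorphic_on_subset[OF ghol sub(2)])
    then have "(H \<circ> \<zeta>) holomorphic_on {w. Re w > 0}"
      by (rule holomorphic_on_compose_gen[OF _ H]) (use slit sub in blast)
    then have "(\<lambda>w. H (\<zeta> w)) holomorphic_on {w. Re w > 0}" by (simp add: o_def)
    then show ?thesis unfolding k_def \<Psi>_def using den0 sub by (intro holomorphic_intros) auto
  qed
  \<comment> \<open>The map e/(1 + \<epsilon> e) divides the imaginary part by a positive number, so
    bounding the function does not disturb the signs.\<close>
  have Imk: "Im (k w) = exp (Re (H (\<zeta> w))) * sin (Im (H (\<zeta> w))) / (cmod (1 + of_real \<epsilon> * exp (H (\<zeta> w))))\<^sup>2" for w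
    unfolding k_def \<Psi>_def Im_divide cmod_power2
    by (rule arg_cong2[where f = "(/)"]) (simp_all add: Im_exp[symmetric] algebra_simps)
  have sgn: "Im (k (\<i> * of_real y)) / y \<ge> 0" for y
  proof -
    have iy: "\<i> * of_real y \<in> P" by (simp add: P_def)
    have pp: "p * pi \<le> pi" using p by (simp add: mult_le_cancel_right1)
    let ?s = "sin (Im (H (\<zeta> (\<i> * of_real y))))"
    have "?s / y \<ge> 0"
    proof (cases y "0 :: real" rule: linorder_cases)
      case less
      have "- pi \<le> Im (H (\<zeta> (\<i> * of_real y)))" "Im (H (\<zeta> (\<i> * of_real y))) \<le> 0"
      proof -
        have "Im (\<i> * of_real y) < 0" using less by simp
        from lower[OF iy this] pp show "- pi \<le> Im (H (\<zeta> (\<i> * of_real y)))" "Im (H (\<zeta> (\<i> * of_real y))) \<le> 0"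
          by linarith+
      qed
      then have "sin (- Im (H (\<zeta> (\<i> * of_real y)))) \<ge> 0" by (intro sin_ge_zero) auto
      then show ?thesis using less by (simp add: divide_nonpos_neg)
    next
      case greater
      have "0 \<le> Im (H (\<zeta> (\<i> * of_real y)))" "Im (H (\<zeta> (\<i> * of_real y))) \<le> pi"
      proof -
        have "Im (\<i> * of_real y) > 0" using greater by simp
        from upper[OF iy this] pp show "0 \<le> Im (H (\<zeta> (\<i> * of_real y)))" "Im (H (\<zeta> (\<i> * of_real y))) \<le> pi"
          by linarith+
      qed
      then have "?s \<ge> 0" by (rule sin_ge_zero)
      then show ?thesis using greater by simp
    qed simp
    then have "exp (Re (H (\<zeta> (\<i> * of_real y)))) / (cmod (1 + of_real \<epsilon> * exp (H (\<zeta> (\<i> * of_real y)))))\<^sup>2 * (?s / y) \<ge> 0"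
      by (intro mult_nonneg_nonneg) auto
    then show ?thesis by (simp add: Imk)
  qed
  have \<Psi>_real: "\<Psi> (of_real s) = of_real (exp (Re (H (of_real s))) / (1 + \<epsilon> * exp (Re (H (of_real s)))))" if "s > 0" for s
  proof -
    have "H (of_real s) = of_real (Re (H (of_real s)))" using real[OF that] by (simp add: complex_eq_iff)
    then have "exp (H (of_real s)) = of_real (exp (Re (H (of_real s))))" by (metis exp_of_real)
    then show ?thesis by (simp add: \<Psi>_def)
  qed
  define k0 where "k0 = exp (Re (H (of_real \<delta>))) / (1 + \<epsilon> * exp (Re (H (of_real \<delta>))))"
  have k0: "k 0 = of_real k0" using \<Psi>_real[OF \<delta>] by (simp add: k_def \<zeta>_def g_def k0_def)
  \<comment> \<open>Here \<open>p > 1 / 2\<close> is decisive: the quotient is a bounded difference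
    quotient of \<open>\<Psi>\<close> times g(w)/w, and the latter has modulus |w|^(2p - 1), which
    tends to 0.\<close>
  have lim: "((\<lambda>w. (k w - k 0) / w) \<longlongrightarrow> 0) (at 0 within P)"
  proof -
    have \<delta>s: "of_real \<delta> \<in> slit_plane" using \<delta> by (simp only: slit_plane_of_real)
    have "H field_differentiable at (of_real \<delta>)"
      using H \<delta>s open_slit_plane by (meson holomorphic_on_imp_differentiable_at)
    moreover have "1 + of_real \<epsilon> * exp (H (of_real \<delta>)) \<noteq> 0"
      using den0[of 0] by (simp add: P_def \<zeta>_def g_def)
    ultimately have "\<Psi> field_differentiable at (of_real \<delta>)"
      unfolding \<Psi>_def
      by (intro field_differentiable_divide field_differentiable_add field_differentiable_mult field_differentiable_const
          field_differentiable_compose[of H _ exp, unfolded o_def] field_differentiable_within_exp)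
    then obtain D where D: "(\<Psi> has_field_derivative D) (at (of_real \<delta>))" by (auto simp: field_differentiable_def)
    define Q where "Q u = (if u = 0 then D else (\<Psi> (of_real \<delta> + u) - \<Psi> (of_real \<delta>)) / u)" for u
    have "((\<lambda>u. (\<Psi> (of_real \<delta> + u) - \<Psi> (of_real \<delta>)) / u) \<longlongrightarrow> D) (at 0)"
      using D by (simp add: DERIV_def)
    then have "(Q \<longlongrightarrow> D) (at 0)"
      by (rule Lim_transform_eventually) (auto simp: Q_def eventually_at_filter)
    then have "isCont Q 0" by (simp add: isCont_def Q_def)
    then have QD: "((\<lambda>w. Q (g w)) \<longlongrightarrow> Q 0) (at 0 within P)" using g0 by (rule isCont_tendsto_compose)
    have "((\<lambda>w. g w / w) \<longlongrightarrow> 0) (at 0 within P)"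
    proof (rule tendsto_norm_zero_cancel)
      have "((\<lambda>w. cmod w powr (2 * p - 1)) \<longlongrightarrow> 0) (at 0 within P)"
        using p by (intro tendsto_zero_powrI[where b = "2 * p - 1"] tendsto_eq_intros refl) auto
      moreover have "cmod (g w / w) = cmod w powr (2 * p - 1)" if "w \<noteq> 0" for w
        using that by (simp add: norm_divide g_norm powr_diff)
      ultimately show "((\<lambda>w. cmod (g w / w)) \<longlongrightarrow> 0) (at 0 within P)"
        by (elim Lim_transform_eventually) (auto simp: eventually_at_filter)
    qed
    from tendsto_mult[OF QD this]
    have "((\<lambda>w. Q (g w) * (g w / w)) \<longlongrightarrow> 0) (at 0 within P)" by simp
    moreover have "Q (g w) * (g w / w) = (k w - k 0) / w" if "w \<noteq> 0" for w
    proof -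
      have "g w \<noteq> 0" using that by (simp add: g_def)
      then show ?thesis by (simp add: Q_def k_def \<zeta>_def g_def[of 0] add.commute)
    qed
    ultimately show ?thesis
      by (elim Lim_transform_eventually) (auto simp: eventually_at_filter)
  qed
  have kr: "k (of_real (sqrt t)) = of_real (h t / (1 + \<epsilon> * h t))" if "t \<in> T" for t
  proof -
    have t: "t > 0" using that T by auto
    have "sqrt t powr (2 * p) = t powr p"
      using t by (simp add: powr_half_sqrt[symmetric] powr_powr)
    then have eq: "\<zeta> (of_real (sqrt t)) = of_real (t powr p + \<delta>)" using g_real[of "sqrt t"] t by (simp add: \<zeta>_def)
    have "t powr p + \<delta> > 0" using \<delta> by (simp add: add_nonneg_pos)
    then show ?thesis unfolding k_def h_def eq by (rule \<Psi>_real)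
  qed
  have "0 \<le> (\<Sum>t\<in>T. c t * (h t / (1 + \<epsilon> * h t) - k0))"
    by (rule half_plane_dual[OF kcont[unfolded P_def] khol _ sgn k0 lim[unfolded P_def] T c kr])
      (use bd in \<open>auto simp: P_def\<close>)
  also have "\<dots> = (\<Sum>t\<in>T. c t * (h t / (1 + \<epsilon> * h t))) - k0 * (\<Sum>t\<in>T. c t)"
    by (simp add: right_diff_distrib sum_subtractf sum_distrib_left mult.commute)
  finally have "k0 * (\<Sum>t\<in>T. c t) \<le> (\<Sum>t\<in>T. c t * (h t / (1 + \<epsilon> * h t)))" by simp
  \<comment> \<open>The constant \<open>k0\<close> is removed by the condition at l = 0, which says
    that the weights have nonnegative sum.\<close>
  moreover have "(\<Sum>t\<in>T. c t) = (\<Sum>t\<in>T. c t * (t / (t + 0)))"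
    by (rule sum.cong) (use T in auto)
  then have "(\<Sum>t\<in>T. c t) \<ge> 0" using c[of 0] by simp
  moreover have "1 + \<epsilon> * exp (Re (H (of_real \<delta>))) > 0" using \<epsilon> by (simp add: add_pos_pos)
  then have "k0 \<ge> 0" by (simp add: k0_def)
  ultimately show ?thesis by (meson mult_nonneg_nonneg order_trans)
qed

theorem exp_pick_imp_dual:
  assumes H: "H holomorphic_on slit_plane" and real: "\<And>t. t > 0 \<Longrightarrow> Im (H (of_real t)) = 0"
    and up: "\<And>z. Im z > 0 \<Longrightarrow> 0 \<le> Im (H z)" "\<And>z. Im z > 0 \<Longrightarrow> Im (H z) \<le> Arg z"
  shows "loewner_dual (\<lambda>t. exp (Re (H (of_real t))))"
  unfolding loewner_dual_def
proof (intro allI impI)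
  fix T and c :: "real \<Rightarrow> real"
  assume T: "finite T" "T \<subseteq> {0<..}" and c: "\<forall>l\<ge>0. 0 \<le> (\<Sum>t\<in>T. c t * (t / (t + l)))"
  \<comment> \<open>Starts at 2/3, so that all exponents exceed 1/2.\<close>
  define p where "p n = 1 - inverse (real (Suc (Suc (Suc n))))" for n
  define \<delta> where "\<delta> n = inverse (real (Suc n))" for n
  define h where "h n t = exp (Re (H (of_real (t powr p n + \<delta> n))))" for n t
  have p: "1 / 2 < p n" "p n < 1" for n by (auto simp: p_def field_simps)
  have \<delta>: "\<delta> n > 0" for n by (simp add: \<delta>_def)
  have plim: "p \<longlonglongrightarrow> 1"
  proof -
    have "(\<lambda>n. 1 - inverse (real (Suc (n + 2)))) \<longlonglongrightarrow> 1 - 0"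
      by (intro tendsto_diff tendsto_const LIMSEQ_ignore_initial_segment[OF LIMSEQ_inverse_real_of_nat])
    moreover have "p = (\<lambda>n. 1 - inverse (real (Suc (n + 2))))" by (rule ext) (simp add: p_def)
    ultimately show ?thesis by simp
  qed
  have \<delta>lim: "\<delta> \<longlonglongrightarrow> 0" unfolding \<delta>_def by (rule LIMSEQ_inverse_real_of_nat)
  have hlim: "(\<lambda>n. h n t) \<longlonglongrightarrow> exp (Re (H (of_real t)))" if t: "t > 0" for t
  proof -
    have "(\<lambda>n. t powr p n + \<delta> n) \<longlonglongrightarrow> t powr 1 + 0"
      using t by (intro tendsto_add tendsto_powr tendsto_const plim \<delta>lim) auto
    then have "(\<lambda>n. t powr p n + \<delta> n) \<longlonglongrightarrow> t" using t by simp
    then have tl: "(\<lambda>n. complex_of_real (t powr p n + \<delta> n)) \<longlonglongrightarrow> of_real t" by (rule tendsto_of_real)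
    have "of_real t \<in> slit_plane" using t by (simp only: slit_plane_of_real)
    then have "isCont H (of_real t)"
      using continuous_on_eq_continuous_at[OF open_slit_plane] holomorphic_on_imp_continuous_on[OF H] by blast
    then have "(\<lambda>n. H (of_real (t powr p n + \<delta> n))) \<longlonglongrightarrow> H (of_real t)"
      using tl by (rule isCont_tendsto_compose)
    then show ?thesis unfolding h_def by (intro tendsto_exp tendsto_Re)
  qed
  have "(\<lambda>n. \<Sum>t\<in>T. c t * (h n t / (1 + \<delta> n * h n t))) \<longlonglongrightarrow> (\<Sum>t\<in>T. c t * (exp (Re (H (of_real t))) / (1 + 0 * exp (Re (H (of_real t))))))"
  proof (rule tendsto_sum)
    fix t assume "t \<in> T"
    then have "t > 0" using T by auto
    from hlim[OF this]
    show "(\<lambda>n. c t * (h n t / (1 + \<delta> n * h n t))) \<longlonglongrightarrow> c t * (exp (Re (H (of_real t))) / (1 + 0 * exp (Re (H (of_real t)))))"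
      by (intro tendsto_mult[OF tendsto_const] tendsto_divide tendsto_add[OF tendsto_const] tendsto_mult[OF \<delta>lim]) simp_all
  qed
  note lim = this
  \<comment> \<open>The sequence \<delta> serves at once as shift at the origin and as the parameter
    \<epsilon> of the bounding transformation.\<close>
  have nn: "0 \<le> (\<Sum>t\<in>T. c t * (h n t / (1 + \<delta> n * h n t)))" for n
    unfolding h_def using c by (intro regularised_dual[OF H real up p \<delta> \<delta> T]) simp_all
  have "0 \<le> (\<Sum>t\<in>T. c t * (exp (Re (H (of_real t))) / (1 + 0 * exp (Re (H (of_real t))))))"
    by (rule LIMSEQ_le_const[OF lim]) (use nn in blast)
  then show "0 \<le> (\<Sum>t\<in>T. c t * exp (Re (H (of_real t))))" by simp
qed

section \<open>Products of quotients\<close>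

text \<open>Ensures that the principal logarithm of the continuation is holomorphic: nonconstant
  continuations preserve the open upper half-plane, and by reflection the lower one.\<close>

lemma pick_in_slit_plane:
  assumes \<phi>: "\<phi> holomorphic_on slit_plane" "\<And>t. t > 0 \<Longrightarrow> \<phi> (of_real t) = of_real (f t)"
    and up: "\<And>z. Im z > 0 \<Longrightarrow> Im (\<phi> z) \<ge> 0" and pos: "\<And>t. t > 0 \<Longrightarrow> f t > 0"
    and z: "z \<in> slit_plane"
  shows "\<phi> z \<in> slit_plane"
proof (cases "\<phi> constant_on slit_plane")
  case True
  then obtain k where k: "\<And>x. x \<in> slit_plane \<Longrightarrow> \<phi> x = k" unfolding constant_on_def by blast
  have "of_real 1 \<in> slit_plane" by (subst slit_plane_of_real) simp
  then have "\<phi> z = of_real (f 1)" using k[OF z] k[of "of_real 1"] \<phi>(2)[of 1] by simp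
  then show ?thesis using pos[of 1] slit_plane_of_real[of "f 1"] by simp
next
  case False
  have im: "Im (\<phi> w) > 0" if "Im w > 0" for w
    by (rule pick_Im_pos[OF \<phi>(1) _ False that]) (rule up)
  show ?thesis using z
  proof (cases rule: slit_plane_cases)
    case 1
    then show ?thesis using im[OF 1] by (intro slit_plane_Im) simp
  next
    case 2
    have "cnj z \<in> slit_plane" using 2 by (intro slit_plane_Im) simp
    moreover have "\<phi> (of_real t) \<in> \<real>" if "t > 0" for t using \<phi>(2)[OF that] by simp
    ultimately have "\<phi> (cnj (cnj z)) = cnj (\<phi> (cnj z))" by (intro slit_plane_reflection[OF \<phi>(1)])
    then have "Im (\<phi> z) < 0" using im[of "cnj z"] 2 by simp
    then show ?thesis by (intro slit_plane_Im) simp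
  next
    case (3 t)
    then show ?thesis using \<phi>(2)[OF 3(1)] pos[OF 3(1)] slit_plane_of_real[of "f t"] by simp
  qed
qed

lemma operator_monotone_right_limit:
  assumes "operator_monotone_on {0..} f" shows "(f \<longlongrightarrow> f 0) (at_right 0)"
proof -
  have "continuous_on {0..} f" using assms by (simp add: operator_monotone_on_def)
  then have "(f \<longlongrightarrow> f 0) (at 0 within {0..})" by (simp add: continuous_on_def)
  then show ?thesis by (rule tendsto_within_subset) auto
qed

lemma nonconstant_operator_monotone:
  assumes f: "operator_monotone_on {0..} f" and nonneg: "\<And>t. t \<ge> 0 \<Longrightarrow> f t \<ge> 0"
    and nc: "\<not> f constant_on {0..}"
  shows "\<exists>\<phi>. \<phi> holomorphic_on slit_plane \<and> (\<forall>t>0. \<phi> (of_real t) = of_real (f t)) \<and> (\<forall>z. Im z > 0 \<longrightarrow> Im (\<phi> z) > 0)"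
    and "\<And>s t. 0 \<le> s \<Longrightarrow> s < t \<Longrightarrow> f s < f t"
    and "\<And>t. t > 0 \<Longrightarrow> f t > 0"
proof -
  have dual: "loewner_dual f" using operator_monotone_imp_dual[OF f] nonneg by simp
  have nc': "\<not> f constant_on {0<..}"
  proof
    assume "f constant_on {0<..}"
    then obtain k where k: "\<And>t. t > 0 \<Longrightarrow> f t = k" unfolding constant_on_def by auto
    have "\<forall>\<^sub>F t in at_right 0. f t = k"
      using eventually_at_right_less[of "0 :: real"] by eventually_elim (rule k)
    then have "(f \<longlongrightarrow> k) (at_right 0)" by (rule tendsto_eventually)
    then have "f 0 = k"
      using operator_monotone_right_limit[OF f] tendsto_unique[OF trivial_limit_at_right_real] by blast
    then have "f t = k" if "t \<ge> 0" for t using k that by (cases "t = 0") auto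
    then have "f constant_on {0..}" unfolding constant_on_def by auto
    then show False using nc by contradiction
  qed
  obtain \<phi> where \<phi>: "\<phi> holomorphic_on slit_plane" "\<And>t. t > 0 \<Longrightarrow> \<phi> (of_real t) = of_real (f t)"
    "\<And>z. Im z > 0 \<Longrightarrow> Im (\<phi> z) \<ge> 0"
    using loewner_dual_continuation[OF dual] by blast
  have "\<not> \<phi> constant_on slit_plane"
  proof
    assume "\<phi> constant_on slit_plane"
    then obtain k where k: "\<And>x. x \<in> slit_plane \<Longrightarrow> \<phi> x = k" unfolding constant_on_def by blast
    have "f t = Re k" if t: "t > 0" for t
    proof -
      have "of_real t \<in> slit_plane" using t by (simp only: slit_plane_of_real)
      then show ?thesis using k[of "of_real t"] \<phi>(2)[OF t] by (metis Re_complex_of_real)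
    qed
    then have "f constant_on {0<..}" unfolding constant_on_def by auto
    then show False using nc' by contradiction
  qed
  note nc\<phi> = this
  have "Im (\<phi> z) > 0" if "Im z > 0" for z
    by (rule pick_Im_pos[OF \<phi>(1) _ nc\<phi> that]) (rule \<phi>(3))
  with \<phi>(1,2) show "\<exists>\<phi>. \<phi> holomorphic_on slit_plane \<and> (\<forall>t>0. \<phi> (of_real t) = of_real (f t)) \<and> (\<forall>z. Im z > 0 \<longrightarrow> Im (\<phi> z) > 0)"
    by blast
  show strict: "f s < f t" if st: "0 \<le> s" "s < t" for s t
  proof (cases "s = 0")
    case True
    \<comment> \<open>The intermediate point t/2 preserves strictness, since only a weak inequality
      survives the limit at 0.\<close>
    have "\<forall>\<^sub>F x in at_right 0. x < t / 2" using st True eventually_at_right_real[of 0 "t / 2"] by (auto elim!: eventually_mono)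
    then have "\<forall>\<^sub>F x in at_right 0. f x \<le> f (t / 2)"
      using eventually_at_right_less[of "0 :: real"]
      by eventually_elim (auto intro: loewner_dual_mono[OF dual])
    then have "f 0 \<le> f (t / 2)"
      using tendsto_upperbound[OF operator_monotone_right_limit[OF f] _ trivial_limit_at_right_real] by blast
    also have "\<dots> < f t" using st True by (intro loewner_dual_strict_mono[OF dual nc']) auto
    finally show ?thesis using True by simp
  next
    case False
    then show ?thesis using st by (intro loewner_dual_strict_mono[OF dual nc']) auto
  qed
  show "f t > 0" if "t > 0" for t using strict[of 0 t] nonneg[of 0] that by simp
qed

section \<open>Argument bounds for the individual factors of h\<close>

lemma Arg_minus_divide_upper:
  assumes "Im w > 0" "\<kappa> > 0"
  shows "Im (- of_real \<kappa> / w) > 0" "Arg (- of_real \<kappa> / w) = pi - Arg w"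
proof -
  have w0: "w \<noteq> 0" using assms by auto
  have "0 < (Re w)\<^sup>2 + (Im w)\<^sup>2" using assms by (simp add: add_nonneg_pos)
  then show "Im (- of_real \<kappa> / w) > 0" using assms by (simp add: Im_divide)
  show "Arg (- of_real \<kappa> / w) = pi - Arg w"
  proof (rule Arg_unique'[of "\<kappa> / cmod w"])
    show "\<kappa> / cmod w > 0" using assms w0 by simp
    show "pi - Arg w \<in> {- pi<..pi}" using Arg_upper[OF assms(1)] by auto
    have "- complex_of_real \<kappa> = rcis \<kappa> pi" by (simp add: rcis_def)
    moreover have "w = rcis (cmod w) (Arg w)" by (simp add: rcis_cmod_Arg)
    ultimately have "- of_real \<kappa> / w = rcis \<kappa> pi / rcis (cmod w) (Arg w)" by simp
    also have "\<dots> = rcis (\<kappa> / cmod w) (pi - Arg w)" by (rule rcis_divide)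
    finally show "- of_real \<kappa> / w = rcis (\<kappa> / cmod w) (pi - Arg w)" .
  qed
qed

text \<open>The argument of the quotient is Arg (z - a) - Arg (\<phi> z - f a). Subtracting a
  nonnegative real only increases an argument, which bounds each term from below by Arg z and Arg
  (\<phi> z); from above both are below pi.\<close>

lemma numerator_factor:
  assumes \<phi>: "\<phi> holomorphic_on slit_plane" "\<And>t. t > 0 \<Longrightarrow> \<phi> (of_real t) = of_real (f t)"
    and up: "\<And>z. Im z > 0 \<Longrightarrow> Im (\<phi> z) > 0" and strict: "\<And>s t. 0 \<le> s \<Longrightarrow> s < t \<Longrightarrow> f s < f t"
    and nonneg: "f 0 \<ge> 0" and a: "a \<ge> 0"
  shows "\<exists>\<Phi>. \<Phi> holomorphic_on slit_plane \<and> (\<forall>z \<in> slit_plane. \<Phi> z \<in> slit_plane) \<and>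
    (\<forall>t>0. \<Phi> (of_real t) \<in> \<real>) \<and>
    (\<forall>t>0. t \<noteq> a \<longrightarrow> \<Phi> (of_real t) = of_real ((t - a) / (f t - f a))) \<and>
    (\<forall>z. Im z > 0 \<longrightarrow> Arg z - pi \<le> Arg (\<Phi> z) \<and> Arg (\<Phi> z) \<le> pi - Arg (\<phi> z))"
proof -
  have pos: "(t - a) / (f t - f a) > 0" if "t > 0" "t \<noteq> a" for t
    using strict[of t a] strict[of a t] that a
    by (cases "t < a") (auto intro: divide_neg_neg divide_pos_pos)
  have fa: "f a \<ge> 0" using strict[of 0 a] a nonneg by (cases "a = 0") auto
  obtain \<Phi> where \<Phi>: "\<Phi> holomorphic_on slit_plane" "\<And>z. z \<in> slit_plane \<Longrightarrow> \<Phi> z \<in> slit_plane"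
    "\<And>t. t > 0 \<Longrightarrow> \<Phi> (of_real t) \<in> \<real>"
    "\<And>z. z \<in> slit_plane \<Longrightarrow> z \<noteq> of_real a \<Longrightarrow> \<Phi> z = (z - of_real a) / (\<phi> z - of_real (f a))"
    using pick_quotient[OF \<phi> up a refl pos] by blast
  have "\<Phi> (of_real t) = of_real ((t - a) / (f t - f a))" if t: "t > 0" "t \<noteq> a" for t
  proof -
    have "of_real t \<in> slit_plane" using t by (simp only: slit_plane_of_real)
    then show ?thesis using \<Phi>(4)[of "of_real t"] \<phi>(2)[OF t(1)] t(2) by simp
  qed
  moreover have "Arg z - pi \<le> Arg (\<Phi> z) \<and> Arg (\<Phi> z) \<le> pi - Arg (\<phi> z)" if z: "Im z > 0" for z
  proof -
    have "z \<in> slit_plane" using z by (intro slit_plane_Im) simp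
    moreover have "z \<noteq> of_real a" using z by auto
    ultimately have "\<Phi> z = (z - of_real a) / (\<phi> z - of_real (f a))" by (rule \<Phi>(4))
    also have "Arg \<dots> = Arg (z - of_real a) - Arg (\<phi> z - of_real (f a))"
      using z up[OF z] by (intro Arg_divide_upper) auto
    finally have "Arg (\<Phi> z) = Arg (z - of_real a) - Arg (\<phi> z - of_real (f a))" .
    moreover have "Arg (z - of_real a) \<ge> Arg z" by (rule Arg_diff_real_ge[OF z a])
    moreover have "Arg (\<phi> z - of_real (f a)) \<ge> Arg (\<phi> z)" by (rule Arg_diff_real_ge[OF up[OF z] fa])
    moreover have "Arg (z - of_real a) < pi" "Arg (\<phi> z - of_real (f a)) < pi"
      using z up[OF z] by (auto intro!: Arg_upper)
    ultimately show ?thesis by linarith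
  qed
  ultimately show ?thesis using \<Phi>(1-3) by blast
qed

text \<open>Dividing by \<open>g\<close>, the factor becomes \<open>(z - b) / (z - b g(b) / g(z))\<close>, whose denominator maps
  the upper half-plane into itself.\<close>

lemma denominator_factor:
  assumes \<gamma>: "\<gamma> holomorphic_on slit_plane" "\<And>t. t > 0 \<Longrightarrow> \<gamma> (of_real t) = of_real (g t)"
    and up: "\<And>z. Im z > 0 \<Longrightarrow> Im (\<gamma> z) > 0" and strict: "\<And>s t. 0 \<le> s \<Longrightarrow> s < t \<Longrightarrow> g s < g t"
    and nonneg: "g 0 \<ge> 0" and b: "b \<ge> 0"
  shows "\<exists>\<Phi>. \<Phi> holomorphic_on slit_plane \<and> (\<forall>z \<in> slit_plane. \<Phi> z \<in> slit_plane) \<and>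
    (\<forall>t>0. \<Phi> (of_real t) \<in> \<real>) \<and>
    (\<forall>t>0. t \<noteq> b \<longrightarrow> \<Phi> (of_real t) = of_real (g t * (t - b) / (t * g t - b * g b))) \<and>
    (\<forall>z. Im z > 0 \<longrightarrow> Arg z - pi \<le> Arg (\<Phi> z) \<and> Arg (\<Phi> z) \<le> (pi - Arg z) + Arg (\<gamma> z))"
proof -
  define \<kappa> where "\<kappa> = b * g b"
  define \<psi> where "\<psi> z = z - of_real \<kappa> / \<gamma> z" for z
  have gpos: "g t > 0" if "t > 0" for t using strict[of 0 t] nonneg that by simp
  have gb: "g b \<ge> 0" using gpos[of b] b nonneg by (cases "b = 0") auto
  have \<kappa>: "\<kappa> \<ge> 0" using b gb by (simp add: \<kappa>_def)
  have \<gamma>slit: "\<gamma> z \<in> slit_plane" if "z \<in> slit_plane" for z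
    by (rule pick_in_slit_plane[OF \<gamma> _ gpos that]) (use up in \<open>auto simp: less_imp_le\<close>)
  have \<gamma>0: "\<gamma> z \<noteq> 0" if "z \<in> slit_plane" for z using \<gamma>slit[OF that] by auto
  have \<psi>hol: "\<psi> holomorphic_on slit_plane"
    unfolding \<psi>_def by (intro holomorphic_on_diff holomorphic_on_divide holomorphic_on_ident holomorphic_on_const \<gamma>(1) \<gamma>0)
  have \<psi>real: "\<psi> (of_real t) = of_real (t - \<kappa> / g t)" if "t > 0" for t
    using \<gamma>(2)[OF that] by (simp add: \<psi>_def)
  \<comment> \<open>Both z and -\<kappa>/\<gamma>(z) lie in the upper half-plane, with arguments Arg
    z and pi - Arg (\<gamma> z); the argument of a sum is at least the smaller one.\<close>
  have \<psi>Arg: "Im (\<psi> z) > 0 \<and> min (Arg z) (pi - Arg (\<gamma> z)) \<le> Arg (\<psi> z)" if z: "Im z > 0" for z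
  proof (cases "\<kappa> = 0")
    case True
    then show ?thesis using z by (simp add: \<psi>_def)
  next
    case False
    then have k: "\<kappa> > 0" using \<kappa> by simp
    note m = Arg_minus_divide_upper[OF up[OF z] k]
    have eq: "\<psi> z = z + - of_real \<kappa> / \<gamma> z" by (simp add: \<psi>_def)
    show ?thesis unfolding eq using z m(1) Arg_add_ge_min[OF z m(1), unfolded m(2)] by simp
  qed
  have quot: "(t - b) / (t - \<kappa> / g t) = g t * (t - b) / (t * g t - b * g b)" if "t > 0" for t
    using gpos[OF that] by (simp add: \<kappa>_def field_simps)
  have pos: "(t - b) / (t - \<kappa> / g t - 0) > 0" if t: "t > 0" "t \<noteq> b" for t
  proof -
    have gt: "g t > 0" by (rule gpos[OF t(1)])
    have "g t * (t - b) / (t * g t - b * g b) > 0"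
    proof (cases "t < b")
      case True
      have "t * g t < b * g t" using True gt by simp
      also have "\<dots> \<le> b * g b" using strict[of t b] True t b by (intro mult_left_mono) auto
      finally show ?thesis using True gt by (intro divide_neg_neg) (auto intro: mult_pos_neg)
    next
      case False
      then have "b < t" using t by simp
      have "b * g b \<le> b * g t" using strict[OF b \<open>b < t\<close>] b by (intro mult_left_mono) auto
      also have "\<dots> < t * g t" using \<open>b < t\<close> gt by simp
      finally show ?thesis using \<open>b < t\<close> gt by simp
    qed
    then show ?thesis using quot[OF t(1)] by simp
  qed
  \<comment> \<open>In \<open>pick_quotient\<close> the constant \<open>c\<close> is 0 here, because
    \<kappa> was chosen to make \<psi> vanish at \<open>b\<close>.\<close>
  have b0: "0 = b - \<kappa> / g b" if "b > 0" using gpos[OF that] by (simp add: \<kappa>_def)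
  obtain \<Phi> where \<Phi>: "\<Phi> holomorphic_on slit_plane" "\<And>z. z \<in> slit_plane \<Longrightarrow> \<Phi> z \<in> slit_plane"
    "\<And>t. t > 0 \<Longrightarrow> \<Phi> (of_real t) \<in> \<real>"
    "\<And>z. z \<in> slit_plane \<Longrightarrow> z \<noteq> of_real b \<Longrightarrow> \<Phi> z = (z - of_real b) / (\<psi> z - of_real 0)"
    using pick_quotient[OF \<psi>hol \<psi>real _ b b0 pos] \<psi>Arg by blast
  have "\<Phi> (of_real t) = of_real (g t * (t - b) / (t * g t - b * g b))" if t: "t > 0" "t \<noteq> b" for t
  proof -
    have "of_real t \<in> slit_plane" using t by (simp only: slit_plane_of_real)
    then have "\<Phi> (of_real t) = of_real ((t - b) / (t - \<kappa> / g t))"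
      using \<Phi>(4)[of "of_real t"] \<psi>real[OF t(1)] t(2) by simp
    then show ?thesis by (simp only: quot[OF t(1)])
  qed
  moreover have "Arg z - pi \<le> Arg (\<Phi> z) \<and> Arg (\<Phi> z) \<le> (pi - Arg z) + Arg (\<gamma> z)" if z: "Im z > 0" for z
  proof -
    have "z \<in> slit_plane" using z by (intro slit_plane_Im) simp
    moreover have "z \<noteq> of_real b" using z by auto
    ultimately have "\<Phi> z = (z - of_real b) / (\<psi> z - of_real 0)" by (rule \<Phi>(4))
    also have "\<dots> = (z - of_real b) / \<psi> z" by simp
    also have "Arg \<dots> = Arg (z - of_real b) - Arg (\<psi> z)"
      using z \<psi>Arg[OF z] by (intro Arg_divide_upper) auto
    finally have "Arg (\<Phi> z) = Arg (z - of_real b) - Arg (\<psi> z)" .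
    moreover have "Arg (z - of_real b) \<ge> Arg z" by (rule Arg_diff_real_ge[OF z b])
    moreover have "Arg (z - of_real b) < pi" "Arg (\<psi> z) < pi" "Arg (\<gamma> z) > 0" "Arg z < pi"
      using z \<psi>Arg[OF z] up[OF z] by (auto intro!: Arg_upper)
    \<comment> \<open>According to which term is the minimum, the quotient has argument below pi -
      Arg z or below Arg (\<gamma> z). Both are positive, so their sum covers either case.\<close>
    moreover have "min (Arg z) (pi - Arg (\<gamma> z)) \<le> Arg (\<psi> z)" using \<psi>Arg[OF z] by simp
    ultimately show ?thesis by linarith
  qed
  ultimately show ?thesis using \<Phi>(1-3) by blast
qed

text \<open>Lets \<theta> tend to pi, so that of a ray bound c + d (pi - \<theta>) only
  \<open>c\<close>, its value at the negative axis, remains.\<close>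

lemma sector_limit:
  assumes "\<And>\<theta>. 0 < \<theta> \<Longrightarrow> \<theta> < pi \<Longrightarrow> x \<le> \<theta> \<Longrightarrow> y \<le> (c + d * (pi - \<theta>)) / \<theta> * x" and "x < pi"
  shows "y \<le> c / pi * x"
proof -
  have "((\<lambda>\<theta>. (c + d * (pi - \<theta>)) / \<theta> * x) \<longlongrightarrow> (c + d * (pi - pi)) / pi * x) (at_left pi)"
    by (intro tendsto_intros) auto
  moreover have "\<forall>\<^sub>F \<theta> in at_left pi. \<theta> \<in> {max 0 x<..<pi}"
    using assms(2) by (intro eventually_at_left_real) simp
  then have "\<forall>\<^sub>F \<theta> in at_left pi. y \<le> (c + d * (pi - \<theta>)) / \<theta> * x"
    by eventually_elim (rule assms(1), auto)
  ultimately have "y \<le> (c + d * (pi - pi)) / pi * x"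
    by (rule tendsto_lowerbound) (rule trivial_limit_at_left_real)
  then show ?thesis by simp
qed

theorem product_quotient_operator_monotone:
  fixes m n :: nat
    and f g :: "nat \<Rightarrow> real \<Rightarrow> real"
    and a b :: "nat \<Rightarrow> real"
    and F h :: "real \<Rightarrow> real"
  assumes m: "m > 0"
    and f: "\<And>i. i \<in> {1..m} \<Longrightarrow> operator_monotone_on {0..} (f i)"
      "\<And>i t. i \<in> {1..m} \<Longrightarrow> t \<ge> 0 \<Longrightarrow> f i t \<ge> 0"
      "\<And>i. i \<in> {1..m} \<Longrightarrow> \<not> f i constant_on {0..}"
    and g: "\<And>j. j \<in> {1..n} \<Longrightarrow> operator_monotone_on {0..} (g j)"
      "\<And>j t. j \<in> {1..n} \<Longrightarrow> t \<ge> 0 \<Longrightarrow> g j t \<ge> 0"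
      "\<And>j. j \<in> {1..n} \<Longrightarrow> \<not> g j constant_on {0..}"
    and F_def: "\<And>t. F t = (\<Prod>i=1..m. f i t) / (t ^ (m - 1) * (\<Prod>j=1..n. g j t))"
    and F: "extends_operator_monotone {0..} {0} F"
    and a: "\<And>i. i \<in> {1..m} \<Longrightarrow> a i \<ge> 0"
    and b: "\<And>j. j \<in> {1..n} \<Longrightarrow> b j \<ge> 0"
    and h_def: "\<And>t. h t = (\<Prod>i=1..m. (t - a i) / (f i t - f i (a i))) *
                       (\<Prod>j=1..n. (g j t * (t - b j)) / (t * g j t - b j * g j (b j)))"
  shows "extends_operator_monotone {0..} (a ` {1..m} \<union> b ` {1..n} \<union> {0}) h"
proof -
  let ?I = "{1..m}" and ?J = "{1..n}"
  have fpos: "f i t > 0" if "i \<in> ?I" "t > 0" for i t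
    by (rule nonconstant_operator_monotone(3)[OF f(1)[OF that(1)] f(2)[OF that(1)] f(3)[OF that(1)] that(2)])
  have gpos: "g j t > 0" if "j \<in> ?J" "t > 0" for j t
    by (rule nonconstant_operator_monotone(3)[OF g(1)[OF that(1)] g(2)[OF that(1)] g(3)[OF that(1)] that(2)])
  have "\<forall>i\<in>?I. \<exists>\<phi>. \<phi> holomorphic_on slit_plane \<and> (\<forall>t>0. \<phi> (of_real t) = of_real (f i t)) \<and> (\<forall>z. Im z > 0 \<longrightarrow> Im (\<phi> z) > 0)"
    by (intro ballI nonconstant_operator_monotone(1) f)
  from bchoice[OF this] obtain \<phi> where \<phi>: "\<And>i. i \<in> ?I \<Longrightarrow> \<phi> i holomorphic_on slit_plane"
      "\<And>i t. i \<in> ?I \<Longrightarrow> t > 0 \<Longrightarrow> \<phi> i (of_real t) = of_real (f i t)" "\<And>i z. i \<in> ?I \<Longrightarrow> Im z > 0 \<Longrightarrow> Im (\<phi> i z) > 0"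
    by blast
  have "\<forall>j\<in>?J. \<exists>\<gamma>. \<gamma> holomorphic_on slit_plane \<and> (\<forall>t>0. \<gamma> (of_real t) = of_real (g j t)) \<and> (\<forall>z. Im z > 0 \<longrightarrow> Im (\<gamma> z) > 0)"
    by (intro ballI nonconstant_operator_monotone(1) g)
  from bchoice[OF this] obtain \<gamma> where \<gamma>: "\<And>j. j \<in> ?J \<Longrightarrow> \<gamma> j holomorphic_on slit_plane"
      "\<And>j t. j \<in> ?J \<Longrightarrow> t > 0 \<Longrightarrow> \<gamma> j (of_real t) = of_real (g j t)" "\<And>j z. j \<in> ?J \<Longrightarrow> Im z > 0 \<Longrightarrow> Im (\<gamma> j z) > 0"
    by blast
  have "\<exists>\<Phi>. \<Phi> holomorphic_on slit_plane \<and> (\<forall>z \<in> slit_plane. \<Phi> z \<in> slit_plane) \<and>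
    (\<forall>t>0. \<Phi> (of_real t) \<in> \<real>) \<and>
    (\<forall>t>0. t \<noteq> a i \<longrightarrow> \<Phi> (of_real t) = of_real ((t - a i) / (f i t - f i (a i)))) \<and>
    (\<forall>z. Im z > 0 \<longrightarrow> Arg z - pi \<le> Arg (\<Phi> z) \<and> Arg (\<Phi> z) \<le> pi - Arg (\<phi> i z))"
    if i: "i \<in> ?I" for i
    by (rule numerator_factor[OF \<phi>(1)[OF i] \<phi>(2)[OF i] \<phi>(3)[OF i]
          nonconstant_operator_monotone(2)[OF f(1)[OF i] f(2)[OF i] f(3)[OF i]] f(2)[OF i order_refl] a[OF i]])
  from bchoice[OF ballI[OF this]] obtain \<Phi> where \<Phi>': "\<forall>i\<in>?I. \<Phi> i holomorphic_on slit_plane \<and> (\<forall>z \<in> slit_plane. \<Phi> i z \<in> slit_plane) \<and>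
    (\<forall>t>0. \<Phi> i (of_real t) \<in> \<real>) \<and>
    (\<forall>t>0. t \<noteq> a i \<longrightarrow> \<Phi> i (of_real t) = of_real ((t - a i) / (f i t - f i (a i)))) \<and>
    (\<forall>z. Im z > 0 \<longrightarrow> Arg z - pi \<le> Arg (\<Phi> i z) \<and> Arg (\<Phi> i z) \<le> pi - Arg (\<phi> i z))" ..
  have \<Phi>: "\<Phi> i holomorphic_on slit_plane" "\<And>z. z \<in> slit_plane \<Longrightarrow> \<Phi> i z \<in> slit_plane"
      "\<And>t. t > 0 \<Longrightarrow> \<Phi> i (of_real t) \<in> \<real>"
      "\<And>t. t > 0 \<Longrightarrow> t \<noteq> a i \<Longrightarrow> \<Phi> i (of_real t) = of_real ((t - a i) / (f i t - f i (a i)))"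
      "\<And>z. Im z > 0 \<Longrightarrow> Arg z - pi \<le> Arg (\<Phi> i z)" "\<And>z. Im z > 0 \<Longrightarrow> Arg (\<Phi> i z) \<le> pi - Arg (\<phi> i z)"
    if "i \<in> ?I" for i
    using bspec[OF \<Phi>' that] by blast+
  have "\<exists>\<Psi>. \<Psi> holomorphic_on slit_plane \<and> (\<forall>z \<in> slit_plane. \<Psi> z \<in> slit_plane) \<and>
    (\<forall>t>0. \<Psi> (of_real t) \<in> \<real>) \<and>
    (\<forall>t>0. t \<noteq> b j \<longrightarrow> \<Psi> (of_real t) = of_real (g j t * (t - b j) / (t * g j t - b j * g j (b j)))) \<and>
    (\<forall>z. Im z > 0 \<longrightarrow> Arg z - pi \<le> Arg (\<Psi> z) \<and> Arg (\<Psi> z) \<le> (pi - Arg z) + Arg (\<gamma> j z))"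
    if j: "j \<in> ?J" for j
    by (rule denominator_factor[OF \<gamma>(1)[OF j] \<gamma>(2)[OF j] \<gamma>(3)[OF j]
          nonconstant_operator_monotone(2)[OF g(1)[OF j] g(2)[OF j] g(3)[OF j]] g(2)[OF j order_refl] b[OF j]])
  from bchoice[OF ballI[OF this]] obtain \<Psi> where \<Psi>': "\<forall>j\<in>?J. \<Psi> j holomorphic_on slit_plane \<and> (\<forall>z \<in> slit_plane. \<Psi> j z \<in> slit_plane) \<and>
    (\<forall>t>0. \<Psi> j (of_real t) \<in> \<real>) \<and>
    (\<forall>t>0. t \<noteq> b j \<longrightarrow> \<Psi> j (of_real t) = of_real (g j t * (t - b j) / (t * g j t - b j * g j (b j)))) \<and>
    (\<forall>z. Im z > 0 \<longrightarrow> Arg z - pi \<le> Arg (\<Psi> j z) \<and> Arg (\<Psi> j z) \<le> (pi - Arg z) + Arg (\<gamma> j z))" ..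
  have \<Psi>: "\<Psi> j holomorphic_on slit_plane" "\<And>z. z \<in> slit_plane \<Longrightarrow> \<Psi> j z \<in> slit_plane"
      "\<And>t. t > 0 \<Longrightarrow> \<Psi> j (of_real t) \<in> \<real>"
      "\<And>t. t > 0 \<Longrightarrow> t \<noteq> b j \<Longrightarrow> \<Psi> j (of_real t) = of_real (g j t * (t - b j) / (t * g j t - b j * g j (b j)))"
      "\<And>z. Im z > 0 \<Longrightarrow> Arg z - pi \<le> Arg (\<Psi> j z)" "\<And>z. Im z > 0 \<Longrightarrow> Arg (\<Psi> j z) \<le> (pi - Arg z) + Arg (\<gamma> j z)"
    if "j \<in> ?J" for j
    using bspec[OF \<Psi>' that] by blast+
  have \<phi>slit: "\<phi> i z \<in> slit_plane" if "i \<in> ?I" "z \<in> slit_plane" for i z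
    by (rule pick_in_slit_plane[OF \<phi>(1)[OF that(1)] \<phi>(2)[OF that(1)] less_imp_le[OF \<phi>(3)[OF that(1)]] fpos[OF that(1)] that(2)])
  have \<gamma>slit: "\<gamma> j z \<in> slit_plane" if "j \<in> ?J" "z \<in> slit_plane" for j z
    by (rule pick_in_slit_plane[OF \<gamma>(1)[OF that(1)] \<gamma>(2)[OF that(1)] less_imp_le[OF \<gamma>(3)[OF that(1)]] gpos[OF that(1)] that(2)])
  have ArgF: "(\<Sum>i\<in>?I. Arg (\<phi> i z)) - (\<Sum>j\<in>?J. Arg (\<gamma> j z)) \<ge> real (m - 1) * Arg z" if z: "Im z > 0" for z
  proof -
    obtain F' where F': "operator_monotone_on {0..} F'" "\<And>t. t > 0 \<Longrightarrow> F' t = F t"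
      using F unfolding extends_operator_monotone_def by auto
    have Fpos: "F t > 0" if "t > 0" for t
      unfolding F_def using that fpos[OF _ that] gpos[OF _ that] by (auto intro!: divide_pos_pos mult_pos_pos prod_pos)
    \<comment> \<open>\<open>operator_monotone_imp_dual\<close> asks for the sign of the extension
      at 0, which is the limit of positive values.\<close>
    have "\<forall>\<^sub>F t in at_right 0. 0 \<le> F' t"
      using eventually_at_right_less[of "0 :: real"] by eventually_elim (use F'(2) Fpos in \<open>simp add: less_imp_le\<close>)
    then have "F' 0 \<ge> 0"
      using tendsto_lowerbound[OF operator_monotone_right_limit[OF F'(1)] _ trivial_limit_at_right_real] by blast
    then have dual: "loewner_dual F'" by (rule operator_monotone_imp_dual[OF F'(1)])
    obtain \<chi> where \<chi>: "\<chi> holomorphic_on slit_plane" "\<And>t. t > 0 \<Longrightarrow> \<chi> (of_real t) = of_real (F' t)"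
      "\<And>z. Im z > 0 \<Longrightarrow> Im (\<chi> z) \<ge> 0"
      using loewner_dual_continuation[OF dual] by blast
    have \<chi>slit: "\<chi> w \<in> slit_plane" if "w \<in> slit_plane" for w
    proof (rule pick_in_slit_plane[OF \<chi> _ that])
      show "F' t > 0" if "t > 0" for t using F'(2)[OF that] Fpos[OF that] by simp
    qed
    \<comment> \<open>A sum of principal logarithms that agrees with Ln \<chi> on the positive axis,
      hence everywhere on the slit plane. This makes the arguments add up exactly, and not merely
      modulo 2 pi.\<close>
    define L where "L w = (\<Sum>i\<in>?I. Ln (\<phi> i w)) - of_nat (m - 1) * Ln w - (\<Sum>j\<in>?J. Ln (\<gamma> j w))" for w
    have Lhol: "L holomorphic_on slit_plane"
      unfolding L_def using \<phi>slit \<gamma>slit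
      by (intro holomorphic_on_diff holomorphic_on_sum holomorphic_on_mult holomorphic_on_const holomorphic_on_Ln' \<phi>(1) \<gamma>(1) holomorphic_on_ident) auto
    have \<chi>hol: "(\<lambda>w. Ln (\<chi> w)) holomorphic_on slit_plane"
      using \<chi>slit by (intro holomorphic_on_Ln' \<chi>(1)) auto
    have eqL: "L (of_real t) = Ln (\<chi> (of_real t))" if t: "t > 0" for t
    proof -
      have "L (of_real t) = of_real ((\<Sum>i\<in>?I. ln (f i t)) - real (m - 1) * ln t - (\<Sum>j\<in>?J. ln (g j t)))"
        using t by (simp add: L_def \<phi>(2) \<gamma>(2) fpos gpos Ln_of_real)
      also have "(\<Sum>i\<in>?I. ln (f i t)) - real (m - 1) * ln t - (\<Sum>j\<in>?J. ln (g j t)) = ln (F t)"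
      proof -
        define Pf Pg where "Pf = (\<Prod>i\<in>?I. f i t)" and "Pg = (\<Prod>j\<in>?J. g j t)"
        have P: "Pf > 0" "Pg > 0" using fpos gpos t unfolding Pf_def Pg_def by (auto intro: prod_pos)
        have "ln Pf = (\<Sum>i\<in>?I. ln (f i t))" unfolding Pf_def using less_imp_neq[OF fpos[OF _ t]] by (intro ln_prod) (metis finite_atLeastAtMost)+
        moreover have "ln Pg = (\<Sum>j\<in>?J. ln (g j t))" unfolding Pg_def using less_imp_neq[OF gpos[OF _ t]] by (intro ln_prod) (metis finite_atLeastAtMost)+
        moreover have "ln (F t) = ln Pf - (real (m - 1) * ln t + ln Pg)"
          unfolding F_def Pf_def[symmetric] Pg_def[symmetric] using t P by (simp add: ln_div ln_mult ln_realpow)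
        ultimately show ?thesis by simp
      qed
      also have "complex_of_real (ln (F t)) = Ln (\<chi> (of_real t))"
        using t Fpos[OF t] by (simp add: \<chi>(2) F'(2) Ln_of_real)
      finally show ?thesis .
    qed
    have "z \<in> slit_plane" using z by (intro slit_plane_Im) simp
    have "L z = Ln (\<chi> z)"
    proof (rule slit_plane_identity[OF Lhol \<chi>hol _ _ _ \<open>z \<in> slit_plane\<close>])
      show "L (of_real x) = Ln (\<chi> (of_real x))" if "1 < x" "x < 2" for x using that by (intro eqL) simp
    qed simp_all
    then have "Im (L z) = Arg (\<chi> z)" using \<chi>slit[OF \<open>z \<in> slit_plane\<close>] by (subst Arg_eq_Im_Ln) auto
    moreover have "Arg (\<chi> z) \<ge> 0" using \<chi>(3)[OF z] by (simp add: Arg_less_0)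
    moreover have "Im (L z) = (\<Sum>i\<in>?I. Arg (\<phi> i z)) - real (m - 1) * Arg z - (\<Sum>j\<in>?J. Arg (\<gamma> j z))"
    proof -
      have "Im (Ln (\<phi> i z)) = Arg (\<phi> i z)" if "i \<in> ?I" for i
        using \<phi>slit[OF that \<open>z \<in> slit_plane\<close>] by (subst Arg_eq_Im_Ln) auto
      moreover have "Im (Ln (\<gamma> j z)) = Arg (\<gamma> j z)" if "j \<in> ?J" for j
        using \<gamma>slit[OF that \<open>z \<in> slit_plane\<close>] by (subst Arg_eq_Im_Ln) auto
      moreover have "Im (Ln z) = Arg z" using z by (subst Arg_eq_Im_Ln) auto
      ultimately show ?thesis by (simp add: L_def)
    qed
    ultimately show ?thesis by linarith
  qed
  \<comment> \<open>The logarithms are summed before any product is formed: the product of the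
    factors is not yet known to avoid the slit, while each factor does.\<close>
  define H where "H z = (\<Sum>i\<in>?I. Ln (\<Phi> i z)) + (\<Sum>j\<in>?J. Ln (\<Psi> j z))" for z
  have Hhol: "H holomorphic_on slit_plane"
    unfolding H_def using \<Phi>(2) \<Psi>(2)
    by (intro holomorphic_on_add holomorphic_on_sum holomorphic_on_Ln' \<Phi>(1) \<Psi>(1)) auto
  have ImLn: "Im (Ln w) = Arg w" if "w \<in> slit_plane" for w using that by (subst Arg_eq_Im_Ln) auto
  have ImH: "Im (H z) = (\<Sum>i\<in>?I. Arg (\<Phi> i z)) + (\<Sum>j\<in>?J. Arg (\<Psi> j z))" if "z \<in> slit_plane" for z
    using that \<Phi>(2) \<Psi>(2) by (simp add: H_def ImLn del: Compl_iff)
  have Hreal: "Im (H (of_real t)) = 0" if t: "t > 0" for t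
  proof -
    have ts: "of_real t \<in> slit_plane" using t by (simp only: slit_plane_of_real)
    have Arg0: "Arg w = 0" if "w \<in> \<real>" "w \<in> slit_plane" for w
    proof -
      have x: "w = of_real (Re w)" using of_real_Re[OF that(1)] by simp
      have "of_real (Re w) \<in> slit_plane" using that(2) unfolding x[symmetric] .
      then have "Re w > 0" by (simp only: slit_plane_of_real)
      then show ?thesis by (subst x) simp
    qed
    show ?thesis unfolding ImH[OF ts] using \<Phi>(2,3) \<Psi>(2,3) ts t by (simp add: Arg0 del: Compl_iff)
  qed
  have exph: "exp (Re (H (of_real t))) = h t"
    if t: "t > 0" "t \<notin> a ` ?I" "t \<notin> b ` ?J" for t
  proof -
    have ts: "of_real t \<in> slit_plane" using t by (simp only: slit_plane_of_real)
    have expLn: "exp (Ln w) = w" if "w \<in> slit_plane" for w using that by (intro exp_Ln) auto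
    have "H (of_real t) = of_real (Re (H (of_real t)))" using Hreal[OF t(1)] by (simp add: complex_eq_iff)
    then have "complex_of_real (exp (Re (H (of_real t)))) = exp (H (of_real t))" by (metis exp_of_real)
    also have "\<dots> = (\<Prod>i\<in>?I. \<Phi> i (of_real t)) * (\<Prod>j\<in>?J. \<Psi> j (of_real t))"
      using \<Phi>(2)[OF _ ts] \<Psi>(2)[OF _ ts] by (simp add: H_def exp_add exp_sum expLn del: Compl_iff)
    also have "(\<Prod>i\<in>?I. \<Phi> i (of_real t)) = (\<Prod>i\<in>?I. complex_of_real ((t - a i) / (f i t - f i (a i))))"
    proof (rule prod.cong[OF refl])
      fix i assume i: "i \<in> ?I"
      then have "t \<noteq> a i" using t by blast
      then show "\<Phi> i (of_real t) = complex_of_real ((t - a i) / (f i t - f i (a i)))" by (rule \<Phi>(4)[OF i t(1)])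
    qed
    also have "(\<Prod>j\<in>?J. \<Psi> j (of_real t)) = (\<Prod>j\<in>?J. complex_of_real (g j t * (t - b j) / (t * g j t - b j * g j (b j))))"
    proof (rule prod.cong[OF refl])
      fix j assume j: "j \<in> ?J"
      then have "t \<noteq> b j" using t by blast
      then show "\<Psi> j (of_real t) = complex_of_real (g j t * (t - b j) / (t * g j t - b j * g j (b j)))" by (rule \<Psi>(4)[OF j t(1)])
    qed
    finally have "complex_of_real (exp (Re (H (of_real t)))) = of_real (h t)" by (simp only: h_def of_real_mult of_real_prod)
    then show ?thesis by (simp only: of_real_eq_iff)
  qed
  have upper: "Im (H z) \<le> pi + (real (m - 1) + real n) * (pi - Arg z)" if z: "Im z > 0" for z
  proof -
    have zs: "z \<in> slit_plane" using z by (intro slit_plane_Im) simp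
    have "Im (H z) \<le> (\<Sum>i\<in>?I. pi - Arg (\<phi> i z)) + (\<Sum>j\<in>?J. (pi - Arg z) + Arg (\<gamma> j z))"
      unfolding ImH[OF zs] using z by (intro add_mono sum_mono \<Phi>(6) \<Psi>(6))
    also have "\<dots> = real m * pi + real n * (pi - Arg z) - ((\<Sum>i\<in>?I. Arg (\<phi> i z)) - (\<Sum>j\<in>?J. Arg (\<gamma> j z)))"
      by (simp add: sum_subtractf sum.distrib)
    also have "\<dots> \<le> real m * pi + real n * (pi - Arg z) - real (m - 1) * Arg z"
      using ArgF[OF z] by simp
    \<comment> \<open>The subtraction m - 1 is one of naturals and agrees with the real one because
      m > 0; of the m terms pi, one remains unpaired.\<close>
    also have "\<dots> = pi + (real (m - 1) + real n) * (pi - Arg z)"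
      using m by (simp add: of_nat_diff algebra_simps)
    finally show ?thesis .
  qed
  have lower: "- Im (H z) \<le> (real m + real n) * (pi - Arg z)" if z: "Im z > 0" for z
  proof -
    have zs: "z \<in> slit_plane" using z by (intro slit_plane_Im) simp
    have "(\<Sum>i\<in>?I. Arg z - pi) + (\<Sum>j\<in>?J. Arg z - pi) \<le> Im (H z)"
      unfolding ImH[OF zs] using z by (intro add_mono sum_mono \<Phi>(5) \<Psi>(5))
    then show ?thesis by (simp add: algebra_simps)
  qed
  have bd: "pi - Arg z \<le> pi" if "Im z > 0" for z using Arg_upper(1)[OF that] by simp
  have le_Arg: "Im (H z) \<le> Arg z" if z: "Im z > 0" for z
  proof -
    have "Im (H z) \<le> pi / pi * Arg z"
    proof (rule sector_limit)
      show "Arg z < pi" using z by (rule Arg_upper)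
      fix \<theta> assume \<theta>: "0 < \<theta>" "\<theta> < pi" "Arg z \<le> \<theta>"
      show "Im (H z) \<le> (pi + (real (m - 1) + real n) * (pi - \<theta>)) / \<theta> * Arg z"
      proof (rule phragmen_lindeloef_sector[OF Hhol Hreal \<theta>(1,2) _ _ _ z \<theta>(3)])
        \<comment> \<open>The maximum principle needs some bound on the whole half-plane; its size
          does not influence the conclusion.\<close>
        show "Im (H w) \<le> pi + (real (m - 1) + real n) * pi" if "Im w > 0" for w
          using upper[OF that] mult_left_mono[OF bd[OF that], of "real (m - 1) + real n"] by linarith
        show "Im (H w) \<le> pi + (real (m - 1) + real n) * (pi - \<theta>)" if "Im w > 0" "Arg w = \<theta>" for w
          using upper[OF that(1)] that(2) by simp
        show "pi + (real (m - 1) + real n) * (pi - \<theta>) \<ge> 0" using \<theta> by (intro add_nonneg_nonneg mult_nonneg_nonneg) auto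
      qed
    qed
    then show ?thesis by simp
  qed
  have ge_0: "0 \<le> Im (H z)" if z: "Im z > 0" for z
  proof -
    have nhol: "(\<lambda>z. - H z) holomorphic_on slit_plane" by (intro holomorphic_on_minus Hhol)
    \<comment> \<open>The lower bound is the upper bound for -H. Its ray bound has no constant term,
      so nothing remains in the limit.\<close>
    have "Im (- H z) \<le> 0 / pi * Arg z"
    proof (rule sector_limit)
      show "Arg z < pi" using z by (rule Arg_upper)
      fix \<theta> assume \<theta>: "0 < \<theta>" "\<theta> < pi" "Arg z \<le> \<theta>"
      show "Im (- H z) \<le> (0 + (real m + real n) * (pi - \<theta>)) / \<theta> * Arg z"
      proof (rule phragmen_lindeloef_sector[OF nhol _ \<theta>(1,2) _ _ _ z \<theta>(3)])
        show "Im (- H (of_real t)) = 0" if "t > 0" for t using Hreal[OF that] by simp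
        show "Im (- H w) \<le> (real m + real n) * pi" if "Im w > 0" for w
          using lower[OF that] mult_left_mono[OF bd[OF that], of "real m + real n"] unfolding uminus_complex.sel by linarith
        show "Im (- H w) \<le> 0 + (real m + real n) * (pi - \<theta>)" if "Im w > 0" "Arg w = \<theta>" for w
          using lower[OF that(1)] that(2) by simp
        show "0 + (real m + real n) * (pi - \<theta>) \<ge> 0" using \<theta> by simp
      qed
    qed
    then show ?thesis by simp
  qed
  have "loewner_dual (\<lambda>t. exp (Re (H (of_real t))))"
    by (rule exp_pick_imp_dual[OF Hhol Hreal ge_0 le_Arg])
  from loewner_dual_imp_operator_monotone[OF this]
  obtain h' where h': "operator_monotone_on {0..} h'" "\<And>t. t > 0 \<Longrightarrow> h' t = exp (Re (H (of_real t)))"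
    by blast
  have "h' t = h t" if "t \<in> {0..} - (a ` ?I \<union> b ` ?J \<union> {0})" for t
  proof -
    have "t > 0" "t \<notin> a ` ?I" "t \<notin> b ` ?J" using that by auto
    then show ?thesis using h'(2) exph by simp
  qed
  then show ?thesis using h'(1) unfolding extends_operator_monotone_def by blast
qed

theorem theorem8:
  fixes m n :: nat
    and f g :: "nat \<Rightarrow> real \<Rightarrow> real"
    and a b :: "nat \<Rightarrow> real"
    and F h :: "real \<Rightarrow> real"
  assumes "m > 0" and "n > 0"
    and "\<And>i. i \<in> {1..m} \<Longrightarrow> operator_monotone_on {0..} (f i)"
    and "\<And>i t. i \<in> {1..m} \<Longrightarrow> t \<ge> 0 \<Longrightarrow> f i t \<ge> 0"
    and "\<And>i. i \<in> {1..m} \<Longrightarrow> \<not> f i constant_on {0..}"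
    and "\<And>j. j \<in> {1..n} \<Longrightarrow> operator_monotone_on {0..} (g j)"
    and "\<And>j t. j \<in> {1..n} \<Longrightarrow> t \<ge> 0 \<Longrightarrow> g j t \<ge> 0"
    and "\<And>j. j \<in> {1..n} \<Longrightarrow> \<not> g j constant_on {0..}"
    and F_def: "\<And>t. F t = (\<Prod>i=1..m. f i t) / (t ^ (m - 1) * (\<Prod>j=1..n. g j t))"
    and "extends_operator_monotone {0..} {0} F"
    and "\<And>i. i \<in> {1..m} \<Longrightarrow> a i \<ge> 0"
    and "\<And>j. j \<in> {1..n} \<Longrightarrow> b j \<ge> 0"
    and h_def: "\<And>t. h t = (\<Prod>i=1..m. (t - a i) / (f i t - f i (a i))) *
                       (\<Prod>j=1..n. (g j t * (t - b j)) / (t * g j t - b j * g j (b j)))"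
  shows "((\<forall>i\<in>{1..m}. continuous_on_closed_half_plane (f i)) \<and>
          (\<forall>j\<in>{1..n}. continuous_on_closed_half_plane (g j)) \<and>
          (\<forall>t<0. \<forall>i\<in>{1..m}. boundary_value (f i) t - complex_of_real (f i (a i)) \<noteq> 0) \<and>
          (\<forall>t<0. \<forall>j\<in>{1..n}. complex_of_real t * boundary_value (g j) t
                              - complex_of_real (b j * g j (b j)) \<noteq> 0)
          \<longrightarrow> extends_operator_monotone {0..} (a ` {1..m} \<union> b ` {1..n} \<union> {0}) h)
       \<and> ((\<exists>\<alpha>>0. \<forall>z\<in>upper_half_plane. \<alpha> * Arg z \<le> Arg (upper_continuation F z))
          \<longrightarrow> extends_operator_monotone {0..} (a ` {1..m} \<union> b ` {1..n} \<union> {0}) h)"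
  using product_quotient_operator_monotone[OF assms(1,3-8) F_def assms(10-12) h_def] by simp

end
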